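(* Let $R$ be a one-dimensional Cohen-Macaulay local ring. Let $I$ be a regular ideal of $R$ and let $M$ be a maximal Cohen-Macaulay $R$-module. The following are equivalent: 1. $IM\cong M$. 2. $M$ is $I$-Ulrich. 3. $M$ is $I^n$-Ulrich for all $n\ge1$. 4. $M$ is $I^n$-Ulrich for infinitely many $n$. 5. $M$ is $I^n$-Ulrich for some $n\ge1$. 6. $M\in \mathrm{CM}(B(I))$.
   Context: All rings are commutative Noetherian with unity and modules are finitely generated. An ideal is regular if it contains a nonzerodivisor. $Q(R)$ is the total ring of fractions of $R$. For an ideal $J$ containing a nonzerodivisor and a maximal Cohen-Macaulay $R$-module $M$, $M$ is $J$-Ulrich if $e_J(M)=\ell(M/JM)$, where $\ell$ is length and $e_J(M)$ is the Hilbert-Samuel multiplicity, i.e. the eventual constant value of $\ell(J^nM/J^{n+1}M)$ for $n\gg0$. $B(I)=\bigcup_{n\ge0}(I^n:I^n)$ is the blow-up ring of $I$, where $I^n:I^n=\{a\in Q(R): aI^n\subseteq I^n\}$. For a finite birational extension $S$ of $R$ (a module-finite ring extension with $R\subseteq S\subseteq Q(R)$), $\mathrm{CM}(S)$ is the category of finitely generated $S$-modules that are maximal Cohen-Macaulay over $R$; $M\in\mathrm{CM}(B(I))$ means that there is an action of $B(I)$ on $M$ which extends the given action of $R$ and makes $M$ an object of $\mathrm{CM}(B(I))$. *)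

theory Defs
  imports Complex_Main "HOL-Library.Extended_Nat"
begin

text \<open>
  A commutative ring R is a type \<open>'a :: comm_ring_1\<close>, and an R-module is a type
  \<open>'m :: ab_group_add\<close> with a scalar multiplication satisfying the locale \<^locale>\<open>module\<close>;
  submodules, generated submodules and linear maps are the library's \<open>module.subspace\<close>,
  \<open>module.span\<close> and \<^locale>\<open>module_hom\<close>.  The ring R as a module over itself is \<open>(*)\<close>.
  Predicates on R alone take the argument \<open>TYPE('a)\<close>.
\<close>

section \<open>Ideals, Noetherian local rings, dimension\<close>

definition ring_ideal :: "'a::comm_ring_1 set \<Rightarrow> bool" where
  "ring_ideal I \<longleftrightarrow> module.subspace (*) I"

definition prime_ideal :: "'a::comm_ring_1 set \<Rightarrow> bool" where
  "prime_ideal P \<longleftrightarrow> ring_ideal P \<and> P \<noteq> UNIV \<and> (\<forall>a b. a * b \<in> P \<longrightarrow> a \<in> P \<or> b \<in> P)"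

definition maximal_ideal :: "'a::comm_ring_1 set \<Rightarrow> bool" where
  "maximal_ideal P \<longleftrightarrow> ring_ideal P \<and> P \<noteq> UNIV \<and>
     (\<forall>J. ring_ideal J \<longrightarrow> P \<subseteq> J \<longrightarrow> J = P \<or> J = UNIV)"

definition noetherian :: "'a::comm_ring_1 itself \<Rightarrow> bool" where
  "noetherian _ \<longleftrightarrow>
     (\<forall>I::'a set. ring_ideal I \<longrightarrow> (\<exists>F. finite F \<and> module.span (*) F = I))"

definition local_ring :: "'a::comm_ring_1 itself \<Rightarrow> bool" where
  "local_ring _ \<longleftrightarrow> (\<exists>!P::'a set. maximal_ideal P)"

text \<open>The maximal ideal; only meaningful when the ring is local.\<close>

definition max_ideal :: "'a::comm_ring_1 set" where
  "max_ideal = (THE P. maximal_ideal P)"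

definition krull_dim :: "'a::comm_ring_1 itself \<Rightarrow> enat" where
  "krull_dim _ = Sup {enat n | n. \<exists>P :: nat \<Rightarrow> 'a set.
     (\<forall>i\<le>n. prime_ideal (P i)) \<and> (\<forall>i<n. P i \<subset> P (Suc i))}"

definition nonzerodivisor :: "'a::comm_ring_1 \<Rightarrow> bool" where
  "nonzerodivisor a \<longleftrightarrow> (\<forall>b. a * b = 0 \<longrightarrow> b = 0)"

definition regular_ideal :: "'a::comm_ring_1 set \<Rightarrow> bool" where
  "regular_ideal I \<longleftrightarrow> ring_ideal I \<and> (\<exists>a\<in>I. nonzerodivisor a)"


section \<open>Modules, depth, maximal Cohen-Macaulay modules\<close>

definition fin_gen :: "('a::comm_ring_1 \<Rightarrow> 'm::ab_group_add \<Rightarrow> 'm) \<Rightarrow> bool" where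
  "fin_gen scale \<longleftrightarrow> (\<exists>F. finite F \<and> module.span scale F = UNIV)"

text \<open>\<open>set_smult scale A N\<close> is the submodule generated by all products \<open>a x\<close> with \<open>a \<in> A\<close> and
  \<open>x \<in> N\<close>.  It is \<open>I N\<close> if A is an ideal I, and \<open>(A) N\<close> if N is a submodule.\<close>

definition set_smult ::
    "('a::comm_ring_1 \<Rightarrow> 'm::ab_group_add \<Rightarrow> 'm) \<Rightarrow> 'a set \<Rightarrow> 'm set \<Rightarrow> 'm set" where
  "set_smult scale A N = module.span scale {scale a x | a x. a \<in> A \<and> x \<in> N}"

primrec ideal_power :: "'a::comm_ring_1 set \<Rightarrow> nat \<Rightarrow> 'a set" where
  "ideal_power I 0 = UNIV"
| "ideal_power I (Suc n) = set_smult (*) I (ideal_power I n)"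

text \<open>The first condition says that \<open>x\<^sub>i\<close> is a nonzerodivisor on \<open>M/(x\<^sub>0,\<dots>,x\<^sub>i\<^sub>-\<^sub>1)M\<close>.\<close>

definition regular_sequence ::
    "('a::comm_ring_1 \<Rightarrow> 'm::ab_group_add \<Rightarrow> 'm) \<Rightarrow> 'a list \<Rightarrow> bool" where
  "regular_sequence scale xs \<longleftrightarrow>
     (\<forall>i<length xs. \<forall>y. scale (xs ! i) y \<in> set_smult scale (set (take i xs)) UNIV \<longrightarrow>
        y \<in> set_smult scale (set (take i xs)) UNIV) \<and>
     set_smult scale (set xs) UNIV \<noteq> UNIV"

definition depth :: "('a::comm_ring_1 \<Rightarrow> 'm::ab_group_add \<Rightarrow> 'm) \<Rightarrow> enat" where
  "depth scale = Sup {enat (length xs) | xs. set xs \<subseteq> max_ideal \<and> regular_sequence scale xs}"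

text \<open>The zero module (whose depth in the above sense is the supremum of the empty set) counts as
  maximal Cohen-Macaulay.\<close>

definition max_cohen_macaulay :: "('a::comm_ring_1 \<Rightarrow> 'm::ab_group_add \<Rightarrow> 'm) \<Rightarrow> bool" where
  "max_cohen_macaulay scale \<longleftrightarrow> (UNIV :: 'm set) = {0} \<or> depth scale = krull_dim TYPE('a)"

definition cohen_macaulay_local_ring :: "'a::comm_ring_1 itself \<Rightarrow> bool" where
  "cohen_macaulay_local_ring R \<longleftrightarrow> noetherian R \<and> local_ring R \<and>
     depth ((*) :: 'a \<Rightarrow> 'a \<Rightarrow> 'a) = krull_dim R"


section \<open>Length, multiplicity, Ulrich modules\<close>

text \<open>The length of the quotient module \<open>N/K\<close>, for submodules \<open>K \<subseteq> N\<close>: the supremum of the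
  lengths of chains of submodules of \<open>N/K\<close> from \<open>0\<close> to \<open>N/K\<close>.  A submodule of \<open>N/K\<close> is \<open>L/K\<close>
  for a unique submodule L with \<open>K \<subseteq> L \<subseteq> N\<close> and is represented by L.\<close>

definition quotient_length ::
    "('a::comm_ring_1 \<Rightarrow> 'm::ab_group_add \<Rightarrow> 'm) \<Rightarrow> 'm set \<Rightarrow> 'm set \<Rightarrow> enat" where
  "quotient_length scale N K = Sup {enat n | n. \<exists>L :: nat \<Rightarrow> 'm set.
     L 0 = K \<and> L n = N \<and> (\<forall>i\<le>n. module.subspace scale (L i)) \<and> (\<forall>i<n. L i \<subset> L (Suc i))}"

text \<open>The eventual constant value of the length of \<open>J\<^sup>n M / J\<^sup>n\<^sup>+\<^sup>1 M\<close>.\<close>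

definition hs_multiplicity ::
    "('a::comm_ring_1 \<Rightarrow> 'm::ab_group_add \<Rightarrow> 'm) \<Rightarrow> 'a set \<Rightarrow> enat" where
  "hs_multiplicity scale J = (THE e. \<exists>N. \<forall>n\<ge>N.
     quotient_length scale (set_smult scale (ideal_power J n) UNIV)
       (set_smult scale (ideal_power J (Suc n)) UNIV) = e)"

definition ulrich :: "('a::comm_ring_1 \<Rightarrow> 'm::ab_group_add \<Rightarrow> 'm) \<Rightarrow> 'a set \<Rightarrow> bool" where
  "ulrich scale J \<longleftrightarrow> regular_ideal J \<and> max_cohen_macaulay scale \<and>
     hs_multiplicity scale J = quotient_length scale UNIV (set_smult scale J UNIV)"


section \<open>The total ring of fractions\<close>

lemma nonzerodivisor_1 [simp]: "nonzerodivisor 1"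
  by (simp add: nonzerodivisor_def)

lemma nonzerodivisor_mult: "nonzerodivisor a \<Longrightarrow> nonzerodivisor b \<Longrightarrow> nonzerodivisor (a * b)"
  unfolding nonzerodivisor_def by (metis mult.assoc)

lemma nonzerodivisor_cancel:
  assumes "nonzerodivisor a" "a * b = a * c"
  shows "b = c"
proof -
  have "a * (b - c) = 0" using assms(2) by (simp add: right_diff_distrib)
  then show ?thesis using assms(1) unfolding nonzerodivisor_def by fastforce
qed

definition tfrac_rel :: "'a::comm_ring_1 \<times> 'a \<Rightarrow> 'a \<times> 'a \<Rightarrow> bool" where
  "tfrac_rel x y \<longleftrightarrow>
     nonzerodivisor (snd x) \<and> nonzerodivisor (snd y) \<and> fst x * snd y = fst y * snd x"

lemma part_equivp_tfrac_rel:
  "part_equivp (tfrac_rel :: 'a::comm_ring_1 \<times> 'a \<Rightarrow> 'a \<times> 'a \<Rightarrow> bool)"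
proof (rule part_equivpI)
  show "\<exists>x :: 'a \<times> 'a. tfrac_rel x x"
    by (rule exI[of _ "(0, 1)"]) (simp add: tfrac_rel_def)
  show "symp (tfrac_rel :: 'a \<times> 'a \<Rightarrow> 'a \<times> 'a \<Rightarrow> bool)"
    by (auto simp: symp_def tfrac_rel_def)
  show "transp (tfrac_rel :: 'a \<times> 'a \<Rightarrow> 'a \<times> 'a \<Rightarrow> bool)"
  proof (rule transpI)
    fix x y z :: "'a \<times> 'a"
    assume xy: "tfrac_rel x y" and yz: "tfrac_rel y z"
    have eqs: "fst x * snd y = fst y * snd x" "fst y * snd z = fst z * snd y"
      using xy yz by (simp_all add: tfrac_rel_def)
    have "snd y * (fst x * snd z) = (fst x * snd y) * snd z" by (simp only: ac_simps)
    also have "\<dots> = (fst y * snd z) * snd x" unfolding eqs(1) by (simp only: ac_simps)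
    also have "\<dots> = snd y * (fst z * snd x)" unfolding eqs(2) by (simp only: ac_simps)
    finally have eq: "snd y * (fst x * snd z) = snd y * (fst z * snd x)" .
    have nz: "nonzerodivisor (snd x)" "nonzerodivisor (snd y)" "nonzerodivisor (snd z)"
      using xy yz by (simp_all add: tfrac_rel_def)
    show "tfrac_rel x z"
      using nz nonzerodivisor_cancel[OF nz(2) eq] by (simp add: tfrac_rel_def)
  qed
qed

quotient_type (overloaded) 'a tfrac = "'a::comm_ring_1 \<times> 'a" / partial: "tfrac_rel"
  by (rule part_equivp_tfrac_rel)

instantiation tfrac :: (comm_ring_1) comm_ring_1
begin

lift_definition zero_tfrac :: "'a tfrac" is "(0, 1)"
  by (simp add: tfrac_rel_def)

lift_definition one_tfrac :: "'a tfrac" is "(1, 1)"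
  by (simp add: tfrac_rel_def)

lift_definition plus_tfrac :: "'a tfrac \<Rightarrow> 'a tfrac \<Rightarrow> 'a tfrac"
  is "\<lambda>x y. (fst x * snd y + fst y * snd x, snd x * snd y)"
proof -
  fix x x' y y' :: "'a \<times> 'a"
  assume x: "tfrac_rel x x'" and y: "tfrac_rel y y'"
  have "(fst x * snd y + fst y * snd x) * (snd x' * snd y')
      = (fst x * snd x') * (snd y * snd y') + (fst y * snd y') * (snd x * snd x')"
    by (simp add: algebra_simps)
  also have "\<dots> = (fst x' * snd x) * (snd y * snd y') + (fst y' * snd y) * (snd x * snd x')"
    using x y by (simp add: tfrac_rel_def)
  also have "\<dots> = (fst x' * snd y' + fst y' * snd x') * (snd x * snd y)"
    by (simp add: algebra_simps)
  finally show "tfrac_rel (fst x * snd y + fst y * snd x, snd x * snd y)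
      (fst x' * snd y' + fst y' * snd x', snd x' * snd y')"
    using x y by (simp add: tfrac_rel_def nonzerodivisor_mult)
qed

lift_definition uminus_tfrac :: "'a tfrac \<Rightarrow> 'a tfrac" is "\<lambda>x. (- fst x, snd x)"
  by (simp add: tfrac_rel_def)

definition minus_tfrac :: "'a tfrac \<Rightarrow> 'a tfrac \<Rightarrow> 'a tfrac" where
  "minus_tfrac x y = x + (- y)"

lift_definition times_tfrac :: "'a tfrac \<Rightarrow> 'a tfrac \<Rightarrow> 'a tfrac"
  is "\<lambda>x y. (fst x * fst y, snd x * snd y)"
proof -
  fix x x' y y' :: "'a \<times> 'a"
  assume x: "tfrac_rel x x'" and y: "tfrac_rel y y'"
  have "(fst x * fst y) * (snd x' * snd y') = (fst x * snd x') * (fst y * snd y')"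
    by (simp add: ac_simps)
  also have "\<dots> = (fst x' * snd x) * (fst y' * snd y)"
    using x y by (simp add: tfrac_rel_def)
  also have "\<dots> = (fst x' * fst y') * (snd x * snd y)"
    by (simp add: ac_simps)
  finally show "tfrac_rel (fst x * fst y, snd x * snd y) (fst x' * fst y', snd x' * snd y')"
    using x y by (simp add: tfrac_rel_def nonzerodivisor_mult)
qed

instance
proof
  fix x y z :: "'a tfrac"
  show "x + y + z = x + (y + z)"
    by transfer (simp add: tfrac_rel_def nonzerodivisor_mult algebra_simps)
  show "x + y = y + x"
    by transfer (simp add: tfrac_rel_def nonzerodivisor_mult algebra_simps)
  show "0 + x = x"
    by transfer (simp add: tfrac_rel_def)
  show "- x + x = 0"
    by transfer (simp add: tfrac_rel_def nonzerodivisor_mult algebra_simps)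
  show "x - y = x + - y"
    by (simp add: minus_tfrac_def)
  show "x * y * z = x * (y * z)"
    by transfer (simp add: tfrac_rel_def nonzerodivisor_mult algebra_simps)
  show "x * y = y * x"
    by transfer (simp add: tfrac_rel_def nonzerodivisor_mult algebra_simps)
  show "1 * x = x"
    by transfer (simp add: tfrac_rel_def)
  show "(x + y) * z = x * z + y * z"
    by transfer (simp add: tfrac_rel_def nonzerodivisor_mult algebra_simps)
  show "(0 :: 'a tfrac) \<noteq> 1"
    by transfer (simp add: tfrac_rel_def)
qed

end

lift_definition to_tfrac :: "'a::comm_ring_1 \<Rightarrow> 'a tfrac" is "\<lambda>a. (a, 1)"
  by (simp add: tfrac_rel_def)

text \<open>\<open>to_tfrac\<close> is an injective ring homomorphism that sends nonzerodivisors to units, and every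
  element of \<open>'a tfrac\<close> is a fraction with a nonzerodivisor as denominator.\<close>

lemma to_tfrac_eq_iff [simp]: "to_tfrac a = to_tfrac b \<longleftrightarrow> a = b"
  by transfer (simp add: tfrac_rel_def)

lemma to_tfrac_hom:
  "to_tfrac 0 = 0" "to_tfrac 1 = 1"
  "to_tfrac (a + b) = to_tfrac a + to_tfrac b"
  "to_tfrac (a * b) = to_tfrac a * to_tfrac b"
  by (transfer; simp add: tfrac_rel_def)+

lemma to_tfrac_unit:
  assumes "nonzerodivisor s"
  shows "\<exists>q. to_tfrac s * q = 1"
proof (transfer fixing: s)
  show "\<exists>q\<in>Collect (\<lambda>x. tfrac_rel x x). tfrac_rel (fst (s, 1) * fst q, snd (s, 1) * snd q) (1, 1)"
    using assms by (intro bexI[of _ "(1, s)"]) (simp_all add: tfrac_rel_def)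
qed

lemma tfrac_is_fraction: "\<exists>a s. nonzerodivisor s \<and> q * to_tfrac s = to_tfrac a"
proof transfer
  fix q :: "'a \<times> 'a"
  assume q: "tfrac_rel q q"
  show "\<exists>a s. nonzerodivisor s \<and> tfrac_rel (fst q * fst (s, 1), snd q * snd (s, 1)) (a, 1)"
    using q by (intro exI[of _ "fst q"] exI[of _ "snd q"]) (simp add: tfrac_rel_def)
qed


section \<open>The blow-up ring and its Cohen-Macaulay modules\<close>

text \<open>\<open>I : I = {q \<in> Q(R). q I \<subseteq> I}\<close>, with I regarded as a subset of \<open>Q(R)\<close>.\<close>

definition self_colon :: "'a::comm_ring_1 set \<Rightarrow> 'a tfrac set" where
  "self_colon I = {q. \<forall>x\<in>I. q * to_tfrac x \<in> to_tfrac ` I}"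

definition blowup_ring :: "'a::comm_ring_1 set \<Rightarrow> 'a tfrac set" where
  "blowup_ring I = (\<Union>n. self_colon (ideal_power I n))"

text \<open>A module structure on \<open>'m\<close> over a subring S of \<open>Q(R)\<close>; the values of \<open>act\<close> outside S are
  irrelevant.\<close>

definition subring_module ::
    "'a::comm_ring_1 tfrac set \<Rightarrow> ('a tfrac \<Rightarrow> 'm::ab_group_add \<Rightarrow> 'm) \<Rightarrow> bool" where
  "subring_module S act \<longleftrightarrow>
     (\<forall>a\<in>S. \<forall>x y. act a (x + y) = act a x + act a y) \<and>
     (\<forall>a\<in>S. \<forall>b\<in>S. \<forall>x. act (a + b) x = act a x + act b x) \<and>
     (\<forall>a\<in>S. \<forall>b\<in>S. \<forall>x. act (a * b) x = act a (act b x)) \<and>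
     (\<forall>x. act 1 x = x)"

definition subring_fin_gen ::
    "'a::comm_ring_1 tfrac set \<Rightarrow> ('a tfrac \<Rightarrow> 'm::ab_group_add \<Rightarrow> 'm) \<Rightarrow> bool" where
  "subring_fin_gen S act \<longleftrightarrow> (\<exists>F. finite F \<and>
     (\<forall>x. \<exists>c. (\<forall>f\<in>F. c f \<in> S) \<and> x = (\<Sum>f\<in>F. act (c f) f)))"

text \<open>\<open>M \<in> CM(S)\<close>, for a finite birational extension S of R and a given R-module M: some action
  of S on M extends that of R and makes M a finitely generated S-module that is maximal
  Cohen-Macaulay over R.\<close>

definition in_CM ::
    "('a::comm_ring_1 \<Rightarrow> 'm::ab_group_add \<Rightarrow> 'm) \<Rightarrow> 'a tfrac set \<Rightarrow> bool" where
  "in_CM scale S \<longleftrightarrow> (\<exists>act. subring_module S act \<and>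
     (\<forall>r x. act (to_tfrac r) x = scale r x) \<and> subring_fin_gen S act \<and> max_cohen_macaulay scale)"

text \<open>An isomorphism from a module onto one of its submodules N.\<close>

definition iso_to_submodule ::
    "('a::comm_ring_1 \<Rightarrow> 'm::ab_group_add \<Rightarrow> 'm) \<Rightarrow> 'm set \<Rightarrow> bool" where
  "iso_to_submodule scale N \<longleftrightarrow> (\<exists>f. module_hom scale scale f \<and> bij_betw f UNIV N)"

end

theory Submission
  imports Defs
begin

text \<open>
  Some \<open>x \<in> I\<^sup>r\<close> satisfies \<open>I\<^sup>n\<^sup>+\<^sup>r = x I\<^sup>n\<close> for large \<open>n\<close>; over a finite residue field \<open>r = 1\<close> may be
  impossible, but every large \<open>r\<close> will do. All six conditions are equivalent to \<open>I\<^sup>r M = x M\<close>, which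
  expresses that \<open>M\<close> is stable under \<open>B(I)\<close>. Let \<open>f n\<close> be the length of \<open>I\<^sup>n M / I\<^sup>n\<^sup>+\<^sup>1 M\<close>. It has an
  eventual value \<open>e\<close>, always \<open>f n \<le> e\<close>, and \<open>f 0 = e\<close> holds only if \<open>M\<close> is stable. Since \<open>I\<^sup>k\<close> has
  multiplicity \<open>k e\<close> and \<open>M / I\<^sup>k M\<close> has length \<open>f 0 + \<dots> + f (k - 1)\<close>, each Ulrich condition amounts to
  \<open>f 0 = e\<close>. If \<open>M\<close> is stable and \<open>y \<in> I\<^sup>r\<^sup>+\<^sup>1\<close> plays the role of \<open>x\<close> in degree \<open>r + 1\<close>, then \<open>y M = x I M\<close>,
  so that \<open>y / x\<close> maps \<open>M\<close> isomorphically onto \<open>I M\<close>.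
\<close>

section \<open>Length of quotient modules\<close>

text \<open>If some \<open>x\<close> in \<open>I\<close> itself satisfied I^(n+1) = x I^n, then M/IM
  would be a quotient of M/xM, which has length \<open>e\<close>, and comparing lengths would settle
  everything. With \<open>x\<close> only in I^r, the same comparison weighs the sum f 0 + ... + f (r
  - 1) against r e, whereas the Ulrich condition for \<open>I\<close> concerns f 0 alone. The
  termwise bound with its equality case is therefore the crux. It comes from comparing N/C with
  IN/IC for N between stable modules, where one element of \<open>I\<close> after another takes the
  place of \<open>x\<close>.

  Finding \<open>x\<close> is homogeneous prime avoidance in the associated graded ring, which
  succeeds in all large degrees. It is carried out on generators of \<open>I\<close> by inequalities
  between ideals, without points of a projective spectrum. Having two consecutive degrees is what
  makes y / x a fraction of degree one.

  Modules of fractions are avoided: nonzerodivisors of R act injectively on M, as M is zero or of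
  depth one, so multiplying by a power of \<open>x\<close> keeps every comparison inside M.\<close>

lemma increasing_chain_mono:
  fixes L :: "nat \<Rightarrow> 'b::order"
  assumes "\<And>i. i < n \<Longrightarrow> L i < L (Suc i)" "i \<le> j" "j \<le> n"
  shows "L i \<le> L j"
  using assms(2,3)
proof (induction j rule: dec_induct)
  case (step j)
  then show ?case using assms(1)[of j] by force
qed simp

locale comm_module = module scale
  for scale :: "'a::comm_ring_1 \<Rightarrow> 'm::ab_group_add \<Rightarrow> 'm" (infixr "*s" 75)
begin

abbreviation len :: "'m set \<Rightarrow> 'm set \<Rightarrow> enat" where
  "len \<equiv> quotient_length scale"

lemma module_hom_scale: "module_hom scale scale (scale c)"
  by unfold_locales (auto simp: algebra_simps)

definition submodule_chain :: "'m set \<Rightarrow> 'm set \<Rightarrow> nat \<Rightarrow> bool" where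
  "submodule_chain K N n \<longleftrightarrow> (\<exists>L :: nat \<Rightarrow> 'm set. L 0 = K \<and> L n = N \<and>
     (\<forall>i\<le>n. subspace (L i)) \<and> (\<forall>i<n. L i \<subset> L (Suc i)))"

lemma quotient_length_chain: "len N K = Sup {enat n | n. submodule_chain K N n}"
  by (simp add: quotient_length_def submodule_chain_def)

lemma submodule_chain_0: "subspace K \<Longrightarrow> submodule_chain K K 0"
  by (auto simp: submodule_chain_def)

lemma submodule_chain_Suc_0:
  "subspace K \<Longrightarrow> subspace N \<Longrightarrow> K \<subset> N \<Longrightarrow> submodule_chain K N (Suc 0)"
  unfolding submodule_chain_def
  by (rule exI[of _ "\<lambda>i. if i = 0 then K else N"]) auto

lemma submodule_chain_trans:
  assumes "submodule_chain K N m" "submodule_chain N P n"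
  shows "submodule_chain K P (m + n)"
proof -
  obtain L L' where
    L: "L 0 = K" "L m = N" "\<And>i. i \<le> m \<Longrightarrow> subspace (L i)" "\<And>i. i < m \<Longrightarrow> L i \<subset> L (Suc i)" and
    L': "L' 0 = N" "L' n = P" "\<And>i. i \<le> n \<Longrightarrow> subspace (L' i)" "\<And>i. i < n \<Longrightarrow> L' i \<subset> L' (Suc i)"
    using assms unfolding submodule_chain_def by metis
  let ?L = "\<lambda>i. if i \<le> m then L i else L' (i - m)"
  have "?L i \<subset> ?L (Suc i)" if i: "i < m + n" for i
  proof -
    consider "i < m" | "i = m" | "i > m" by linarith
    then show ?thesis
    proof cases
      case 2
      then show ?thesis using L(2) L'(1) L'(4)[of 0] i by simp
    next
      case 3
      then show ?thesis using L'(4)[of "i - m"] i by (simp add: Suc_diff_le)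
    qed (use L(4) in simp)
  qed
  moreover have "?L (m + n) = P" using L L' by (cases "n = 0") auto
  moreover have "\<forall>i\<le>m + n. subspace (?L i)" using L(3) L'(3) by auto
  ultimately show ?thesis
    unfolding submodule_chain_def by (intro exI[of _ ?L]) (use L(1) in auto)
qed

lemma chain_le_len: "submodule_chain K N n \<Longrightarrow> enat n \<le> len N K"
  unfolding quotient_length_chain by (rule Sup_upper) auto

text \<open>A supremum of lengths may be infinite without being attained, but if all chains were
  shorter than \<open>n\<close>, it would be at most \<open>n - 1\<close>.\<close>

lemma len_geE:
  assumes "subspace K" "subspace N" "K \<subseteq> N" "enat n \<le> len N K"
  obtains m where "m \<ge> n" "submodule_chain K N m"
proof -
  have "\<exists>m\<ge>n. submodule_chain K N m"
  proof (rule ccontr)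
    assume *: "\<not> ?thesis"
    have "K = N \<or> K \<subset> N" using assms(3) by auto
    then have "\<exists>m. submodule_chain K N m"
      using submodule_chain_0 submodule_chain_Suc_0 assms by metis
    with * have "n \<noteq> 0" by auto
    have "len N K \<le> enat (n - 1)"
      unfolding quotient_length_chain
    proof (rule Sup_least)
      fix x assume "x \<in> {enat n | n. submodule_chain K N n}"
      then obtain m where m: "x = enat m" "submodule_chain K N m" by auto
      then have "m < n" using * by (meson not_le)
      then show "x \<le> enat (n - 1)" using m by simp
    qed
    then show False using assms(4) \<open>n \<noteq> 0\<close>
      by (meson diff_less enat_ord_simps(2) leD less_one order_le_less_trans zero_less_iff_neq_zero)
  qed
  then show ?thesis using that by blast
qed

lemma len_le_I:
  assumes "\<And>n. submodule_chain K N n \<Longrightarrow> enat n \<le> b"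
  shows "len N K \<le> b"
  unfolding quotient_length_chain by (rule Sup_least) (use assms in auto)

lemma len_refl [simp]: "len K K = 0"
proof -
  have "len K K \<le> 0"
  proof (rule len_le_I)
    fix n assume "submodule_chain K K n"
    then obtain L where
      L: "L 0 = K" "L n = K" "\<And>i. i \<le> n \<Longrightarrow> subspace (L i)" "\<And>i. i < n \<Longrightarrow> L i \<subset> L (Suc i)"
      unfolding submodule_chain_def by metis
    have "i \<le> n \<Longrightarrow> i > 0 \<Longrightarrow> L 0 \<subset> L i" for i
    proof (induction i)
      case (Suc i)
      then show ?case using L(4)[of i] by (cases "i = 0") auto
    qed simp
    from this[of n] L show "enat n \<le> 0" by (cases "n = 0") (auto simp: zero_enat_def)
  qed
  then show ?thesis by simp
qed

lemma len_superadd: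
  assumes "subspace K" "subspace N" "subspace P" "K \<subseteq> N" "N \<subseteq> P"
  shows "len P N + len N K \<le> len P K"
proof -
  have *: "enat (a + b) \<le> len P K" if ab: "enat a \<le> len P N" "enat b \<le> len N K" for a b
  proof -
    obtain a' where a': "a' \<ge> a" "submodule_chain N P a'"
      by (rule len_geE[OF assms(2,3,5) ab(1)])
    obtain b' where b': "b' \<ge> b" "submodule_chain K N b'"
      by (rule len_geE[OF assms(1,2,4) ab(2)])
    have "enat (b' + a') \<le> len P K"
      using a' b' by (intro chain_le_len submodule_chain_trans)
    moreover have "enat (a + b) \<le> enat (b' + a')" using a' b' by simp
    ultimately show ?thesis using order_trans by blast
  qed
  have inf: "c = \<infinity>" if "\<And>n. enat n \<le> c" for c
    using that by (metis Suc_n_not_le_n enat.exhaust enat_ord_simps(1))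
  show ?thesis
  proof (cases "len P N")
    case (enat a)
    show ?thesis
    proof (cases "len N K")
      case (enat b)
      then show ?thesis using *[of a b] \<open>len P N = enat a\<close> by simp
    next
      case infinity
      have "enat n \<le> len P K" for n
        using *[of 0 n] infinity by (simp add: zero_enat_def[symmetric])
      then have "len P K = \<infinity>" by (rule inf)
      then show ?thesis by simp
    qed
  next
    case infinity
    have "enat n \<le> len P K" for n
      using *[of n 0] infinity by (simp add: zero_enat_def[symmetric])
    then have "len P K = \<infinity>" by (rule inf)
    then show ?thesis by simp
  qed
qed

lemma len_ge_1:
  assumes "subspace K" "subspace N" "K \<subset> N"
  shows "1 \<le> len N K"
  using chain_le_len[OF submodule_chain_Suc_0[OF assms]] by (simp add: one_enat_def)

lemma subspace_set_sum:
  assumes "subspace A" "subspace B"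
  shows "subspace {x + y | x y. x \<in> A \<and> y \<in> B}"
  using subspace_span[of "A \<union> B"] assms unfolding span_Un by (simp add: span_eq_iff[THEN iffD2])

text \<open>Intersecting a chain with \<open>N\<close> and adding \<open>N\<close> to it gives two chains; by the modular law
  at least one of them moves whenever the given chain does.\<close>

lemma len_subadd:
  assumes "subspace K" "subspace N" "subspace P" "K \<subseteq> N" "N \<subseteq> P"
  shows "len P K \<le> len P N + len N K"
proof (rule len_le_I)
  fix n assume "submodule_chain K P n"
  then obtain L where
    L: "L 0 = K" "L n = P" "\<And>i. i \<le> n \<Longrightarrow> subspace (L i)" "\<And>i. i < n \<Longrightarrow> L i \<subset> L (Suc i)"
    unfolding submodule_chain_def by metis
  define A where "A i = {x + y | x y. x \<in> L i \<and> y \<in> N}" for i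
  define B where "B i = L i \<inter> N" for i
  have subA: "subspace (A i)" and subB: "subspace (B i)" if "i \<le> n" for i
    using that L(3) assms(2) by (auto simp: A_def B_def subspace_set_sum subspace_inter)
  have mA: "A i \<subseteq> A (Suc i)" and mB: "B i \<subseteq> B (Suc i)" if "i < n" for i
    using L(4)[OF that] unfolding A_def B_def by blast+
  have NA: "N \<subseteq> A i" if "i \<le> n" for i
  proof
    fix y assume "y \<in> N"
    then have "0 + y \<in> A i" using subspace_0[OF L(3)[OF that]] unfolding A_def by blast
    then show "y \<in> A i" by simp
  qed
  have L0: "K \<subseteq> L i" if "i \<le> n" for i
    using increasing_chain_mono[of n L 0 i] L(1,4) that by auto
  then have KB: "K \<subseteq> B i" if "i \<le> n" for i using that assms(4) by (auto simp: B_def)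
  have step: "A i \<subset> A (Suc i) \<or> B i \<subset> B (Suc i)" if i: "i < n" for i
  proof (rule ccontr)
    assume "\<not> ?thesis"
    then have eq: "A i = A (Suc i)" "B i = B (Suc i)" using mA mB i by blast+
    have "L (Suc i) \<subseteq> L i"
    proof
      fix x assume x: "x \<in> L (Suc i)"
      then have "x + 0 \<in> A (Suc i)" using subspace_0[OF assms(2)] unfolding A_def by blast
      then have "x \<in> A i" using eq by simp
      then obtain u v where uv: "x = u + v" "u \<in> L i" "v \<in> N" unfolding A_def by auto
      have "v = x - u" using uv by simp
      then have "v \<in> L (Suc i)"
        using x uv L(4)[OF i] L(3)[of "Suc i"] i subspace_diff[of "L (Suc i)" x u] by auto
      then have "v \<in> L i" using uv eq(2) by (auto simp: B_def)
      then show "x \<in> L i" using uv subspace_add L(3)[of i] i by auto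
    qed
    then show False using L(4)[OF i] by blast
  qed
  \<comment> \<open>Every step of \<open>L\<close> adds at least one to one of the two
    lengths.\<close>
  have "i \<le> n \<Longrightarrow> enat i \<le> len (A i) N + len (B i) K" for i
  proof (induction i)
    case (Suc i)
    then have i: "i < n" "i \<le> n" by auto
    have 1: "len (A (Suc i)) (A i) + len (A i) N \<le> len (A (Suc i)) N"
      using i Suc.prems by (intro len_superadd) (auto simp: subA assms NA mA)
    have 2: "len (B (Suc i)) (B i) + len (B i) K \<le> len (B (Suc i)) K"
      using i Suc.prems by (intro len_superadd) (auto simp: subB assms KB mB)
    have "1 \<le> len (A (Suc i)) (A i) + len (B (Suc i)) (B i)"
      using step[OF i(1)] len_ge_1[of "A i" "A (Suc i)"] len_ge_1[of "B i" "B (Suc i)"]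
        subA[of i] subA[of "Suc i"] subB[of i] subB[of "Suc i"] i Suc.prems
      by (metis add_increasing add_increasing2 zero_le)
    then have "1 + enat i \<le> (len (A (Suc i)) (A i) + len (B (Suc i)) (B i))
        + (len (A i) N + len (B i) K)"
      using Suc.IH[OF i(2)] by (rule add_mono)
    also have "\<dots> = (len (A (Suc i)) (A i) + len (A i) N) + (len (B (Suc i)) (B i) + len (B i) K)"
      by (simp only: ac_simps)
    also have "\<dots> \<le> len (A (Suc i)) N + len (B (Suc i)) K"
      using 1 2 by (rule add_mono)
    finally show ?case by (simp add: one_enat_def)
  qed (simp add: zero_enat_def[symmetric])
  from this[of n] have "enat n \<le> len (A n) N + len (B n) K" by simp
  moreover have "A n = P"
    using NA[of n] subspace_add[OF assms(3)] assms(5) L(2) subspace_0[OF assms(2)]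
    unfolding A_def by (auto, metis add.right_neutral)
  moreover have "B n = N" using L(2) assms(5) by (auto simp: B_def)
  ultimately show "enat n \<le> len P N + len N K" by simp
qed

lemma len_add:
  assumes "subspace K" "subspace N" "subspace P" "K \<subseteq> N" "N \<subseteq> P"
  shows "len P K = len P N + len N K"
  using len_superadd[OF assms] len_subadd[OF assms] by (rule order.antisym[rotated])

lemma len_mono_upper:
  assumes "subspace K" "subspace N" "subspace P" "K \<subseteq> N" "N \<subseteq> P"
  shows "len N K \<le> len P K"
  using len_add[OF assms] by simp

lemma len_mono_lower:
  assumes "subspace K" "subspace N" "subspace P" "K \<subseteq> N" "N \<subseteq> P"
  shows "len P N \<le> len P K"
  using len_add[OF assms] by simp

lemma len_0_imp_eq:
  assumes "subspace K" "subspace N" "K \<subseteq> N" "len N K = 0"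
  shows "N = K"
  using len_ge_1[of K N] assms by (metis not_one_le_zero psubsetI)

lemma len_eq_upper_imp_eq:
  assumes "subspace K" "subspace N" "subspace P" "K \<subseteq> N" "N \<subseteq> P"
    and "len P K \<le> len N K" "len N K \<noteq> \<infinity>"
  shows "P = N"
proof -
  have "len P N + len N K \<le> 0 + len N K" using len_add[OF assms(1-5)] assms(6) by simp
  then have "len P N = 0" using assms(7) by (cases "len P N"; cases "len N K") (auto simp: zero_enat_def)
  then show ?thesis using len_0_imp_eq assms by blast
qed

text \<open>A chain from \<open>K\<close> to \<open>N\<close> is pushed forward and
  \<open>K'\<close> is added to each member. By \<open>inj\<close>, the induced map from N/K to
  N'/K' is injective, which keeps the steps strict.\<close>

lemma len_le_of_inj:
  assumes f: "module_hom scale scale f"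
    and sub: "subspace K" "subspace N" "subspace K'" "subspace N'" "K \<subseteq> N" "K' \<subseteq> N'"
    and img: "f ` N \<subseteq> N'" "f ` K \<subseteq> K'"
    and inj: "\<And>x. x \<in> N \<Longrightarrow> f x \<in> K' \<Longrightarrow> x \<in> K"
  shows "len N K \<le> len N' K'"
proof (rule len_le_I)
  interpret f: module_hom scale scale f by (rule f)
  fix n assume "submodule_chain K N n"
  then obtain L where
    L: "L 0 = K" "L n = N" "\<And>i. i \<le> n \<Longrightarrow> subspace (L i)" "\<And>i. i < n \<Longrightarrow> L i \<subset> L (Suc i)"
    unfolding submodule_chain_def by metis
  define A where "A i = {x + y | x y. x \<in> f ` L i \<and> y \<in> K'}" for i
  have subA: "subspace (A i)" if "i \<le> n" for i
    unfolding A_def by (intro subspace_set_sum f.subspace_image L sub that)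
  have KL: "K \<subseteq> L i" if "i \<le> n" for i
    using increasing_chain_mono[of n L 0 i] L(1,4) that by auto
  have LN: "L i \<subseteq> N" if "i \<le> n" for i
    using increasing_chain_mono[of n L i n] L(2,4) that by auto
  have AN: "A i \<subseteq> N'" if "i \<le> n" for i
    using LN[OF that] img(1) sub(6) subspace_add[OF sub(4)] unfolding A_def by blast
  have KA: "K' \<subseteq> A i" if "i \<le> n" for i
  proof
    fix y assume "y \<in> K'"
    moreover have "0 \<in> f ` L i" using subspace_0[OF L(3)[OF that]] f.zero by force
    ultimately have "0 + y \<in> A i" unfolding A_def by blast
    then show "y \<in> A i" by simp
  qed
  have step: "A i \<subset> A (Suc i)" if i: "i < n" for i
  proof -
    have "A i \<subseteq> A (Suc i)" using L(4)[OF i] unfolding A_def by blast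
    moreover obtain x where x: "x \<in> L (Suc i)" "x \<notin> L i" using L(4)[OF i] by blast
    have "f x + 0 \<in> A (Suc i)" using x subspace_0[OF sub(3)] unfolding A_def by blast
    moreover have "f x \<notin> A i"
    proof
      assume "f x \<in> A i"
      then obtain u v where uv: "u \<in> L i" "v \<in> K'" "f x = f u + v" unfolding A_def by auto
      then have "f (x - u) \<in> K'" by (simp add: f.diff)
      moreover have "x - u \<in> N"
        using x uv LN[of i] LN[of "Suc i"] i subspace_diff[OF sub(2)] by auto
      ultimately have "x - u \<in> L i" using inj KL[of i] i by auto
      then have "(x - u) + u \<in> L i" using uv i by (intro subspace_add[OF L(3)[of i]]) simp_all
      then show False using x by simp
    qed
    ultimately show ?thesis by auto
  qed
  have "submodule_chain (A 0) (A n) n"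
    unfolding submodule_chain_def using subA step by blast
  then have "enat n \<le> len (A n) (A 0)" by (rule chain_le_len)
  also have "\<dots> \<le> len (A n) K'"
  proof (rule len_mono_lower[OF sub(3)])
    show "A 0 \<subseteq> A n" using increasing_chain_mono[of n A 0 n] step by auto
  qed (auto intro: subA KA[THEN subsetD])
  also have "\<dots> \<le> len N' K'" by (rule len_mono_upper) (auto intro: subA KA[THEN subsetD] AN[THEN subsetD] sub)
  finally show "enat n \<le> len N' K'" .
qed

text \<open>Dual to the injective case: preimages in \<open>N\<close> of a chain from
  \<open>K'\<close> to \<open>N'\<close> lie above \<open>K\<close>, and \<open>surj\<close>
  provides for each step an element that witnesses strictness.\<close>

lemma len_le_of_surj:
  assumes f: "module_hom scale scale f"
    and sub: "subspace K" "subspace N" "subspace K'" "subspace N'" "K \<subseteq> N" "K' \<subseteq> N'"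
    and img: "f ` K \<subseteq> K'"
    and surj: "\<And>y. y \<in> N' \<Longrightarrow> \<exists>x\<in>N. y - f x \<in> K'"
  shows "len N' K' \<le> len N K"
proof (rule len_le_I)
  interpret f: module_hom scale scale f by (rule f)
  fix n assume "submodule_chain K' N' n"
  then obtain L where
    L: "L 0 = K'" "L n = N'" "\<And>i. i \<le> n \<Longrightarrow> subspace (L i)" "\<And>i. i < n \<Longrightarrow> L i \<subset> L (Suc i)"
    unfolding submodule_chain_def by metis
  define A where "A i = N \<inter> f -` L i" for i
  have subA: "subspace (A i)" if "i \<le> n" for i
    unfolding A_def by (intro subspace_inter f.subspace_vimage L sub that)
  have KL: "K' \<subseteq> L i" if "i \<le> n" for i
    using increasing_chain_mono[of n L 0 i] L(1,4) that by auto
  have LN: "L i \<subseteq> N'" if "i \<le> n" for i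
    using increasing_chain_mono[of n L i n] L(2,4) that by auto
  have AN: "A i \<subseteq> N" for i by (auto simp: A_def)
  have KA: "K \<subseteq> A i" if "i \<le> n" for i
    using sub(5) img KL[OF that] by (auto simp: A_def)
  have step: "A i \<subset> A (Suc i)" if i: "i < n" for i
  proof -
    have "A i \<subseteq> A (Suc i)" using L(4)[OF i] unfolding A_def by blast
    moreover obtain y where y: "y \<in> L (Suc i)" "y \<notin> L i" using L(4)[OF i] by blast
    obtain x where x: "x \<in> N" "y - f x \<in> K'" using surj y LN[of "Suc i"] i by auto
    have "y - (y - f x) \<in> L (Suc i)"
      using i x y KL[of "Suc i"] by (subst subspace_diff[OF L(3)]) auto
    then have "x \<in> A (Suc i)" using x by (simp add: A_def)
    moreover have "x \<notin> A i"
    proof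
      assume "x \<in> A i"
      then have "f x + (y - f x) \<in> L i"
        using i x KL[of i] by (intro subspace_add[OF L(3)]) (auto simp: A_def)
      then show False using y by simp
    qed
    ultimately show ?thesis by auto
  qed
  have "submodule_chain (A 0) (A n) n"
    unfolding submodule_chain_def using subA step by blast
  then have "enat n \<le> len (A n) (A 0)" by (rule chain_le_len)
  also have "\<dots> \<le> len (A n) K"
  proof (rule len_mono_lower[OF sub(1)])
    show "A 0 \<subseteq> A n" using increasing_chain_mono[of n A 0 n] step by auto
  qed (auto intro: subA KA[THEN subsetD])
  also have "\<dots> \<le> len N K" by (rule len_mono_upper) (auto intro: subA KA[THEN subsetD] AN[THEN subsetD] sub)
  finally show "enat n \<le> len N K" .
qed

lemma len_image:
  assumes f: "module_hom scale scale f" "inj f"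
    and sub: "subspace K" "subspace N" "K \<subseteq> N"
  shows "len (f ` N) (f ` K) = len N K"
proof (rule order.antisym)
  interpret f: module_hom scale scale f by (rule f)
  have s: "subspace (f ` K)" "subspace (f ` N)" using sub f.subspace_image by auto
  show "len (f ` N) (f ` K) \<le> len N K"
    by (rule len_le_of_surj[OF f(1) sub(1,2) s])
      (use sub(3) f.zero subspace_0[OF s(1)] in \<open>auto intro!: bexI\<close>)
  show "len N K \<le> len (f ` N) (f ` K)"
    by (rule len_le_of_inj[OF f(1) sub(1,2) s]) (use sub(3) f(2) in \<open>auto dest: injD\<close>)
qed

end

section \<open>Ideal products and Noetherian modules\<close>

context comm_module
begin

abbreviation smult :: "'a set \<Rightarrow> 'm set \<Rightarrow> 'm set" (infixr "\<odot>" 74) where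
  "A \<odot> N \<equiv> set_smult scale A N"

lemma subspace_smult [simp, intro]: "subspace (A \<odot> N)"
  by (simp add: set_smult_def)

lemma smult_mem: "a \<in> A \<Longrightarrow> x \<in> N \<Longrightarrow> a *s x \<in> A \<odot> N"
  unfolding set_smult_def by (intro span_base) auto

lemma smult_least:
  assumes "\<And>a x. a \<in> A \<Longrightarrow> x \<in> N \<Longrightarrow> a *s x \<in> P" "subspace P"
  shows "A \<odot> N \<subseteq> P"
  unfolding set_smult_def by (rule span_minimal) (use assms in auto)

lemma smult_mono: "A \<subseteq> B \<Longrightarrow> N \<subseteq> P \<Longrightarrow> A \<odot> N \<subseteq> B \<odot> P"
  by (rule smult_least) (auto intro: smult_mem)

lemma smult_subset: "subspace N \<Longrightarrow> A \<odot> N \<subseteq> N"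
  by (rule smult_least) (auto intro: subspace_scale)

lemma smult_UNIV_left: "subspace N \<Longrightarrow> UNIV \<odot> N = N"
  using smult_subset[of N UNIV] smult_mem[of 1 UNIV _ N] by auto

lemma smult_assoc: "set_smult (*) A B \<odot> N = A \<odot> (B \<odot> N)"
proof (rule order.antisym; rule smult_least)
  fix c x assume c: "c \<in> set_smult (*) A B" and x: "x \<in> N"
  interpret R: module "(*) :: 'a \<Rightarrow> 'a \<Rightarrow> 'a" by unfold_locales (simp_all add: algebra_simps)
  \<comment> \<open>The scalars that send \<open>x\<close> into A(BN) form an ideal, so it is enough
    to test products \<open>a * b\<close>.\<close>
  have "R.subspace {c. c *s x \<in> A \<odot> B \<odot> N}"
    by (rule R.subspaceI)
      (auto simp: subspace_0 subspace_add scale_left_distrib scale_scale[symmetric] subspace_scale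
        simp del: scale_scale)
  moreover have "a * b \<in> {c. c *s x \<in> A \<odot> B \<odot> N}" if "a \<in> A" "b \<in> B" for a b
    using that x smult_mem[of a A "b *s x"] smult_mem[of b B x N] by simp
  ultimately have "R.span {a * b | a b. a \<in> A \<and> b \<in> B} \<subseteq> {c. c *s x \<in> A \<odot> B \<odot> N}"
    by (intro R.span_minimal) auto
  then show "c *s x \<in> A \<odot> B \<odot> N" using c unfolding set_smult_def[of "(*)"] by blast
next
  fix a y assume a: "a \<in> A" and y: "y \<in> B \<odot> N"
  interpret f: module_hom scale scale "scale a" by (rule module_hom_scale)
  have "a * b \<in> set_smult (*) A B" if "b \<in> B" for b
  proof -
    interpret R: module "(*) :: 'a \<Rightarrow> 'a \<Rightarrow> 'a" by unfold_locales (simp_all add: algebra_simps)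
    show ?thesis unfolding set_smult_def using a that by (intro R.span_base) blast
  qed
  then have "B \<odot> N \<subseteq> scale a -` (set_smult (*) A B \<odot> N)"
    by (intro smult_least f.subspace_vimage subspace_smult) (auto intro!: smult_mem)
  then show "a *s y \<in> set_smult (*) A B \<odot> N" using y by blast
qed auto

lemma smult_image:
  assumes "module_hom scale scale f"
  shows "A \<odot> (f ` N) = f ` (A \<odot> N)"
proof -
  interpret f: module_hom scale scale f by fact
  have "{a *s x |a x. a \<in> A \<and> x \<in> f ` N} = f ` {a *s x |a x. a \<in> A \<and> x \<in> N}"
    unfolding image_Collect using f.scale by (auto simp: image_iff; metis)
  then show ?thesis unfolding set_smult_def by (simp add: f.span_image)
qed

lemma smult_scale_image: "A \<odot> (scale c ` N) = scale c ` (A \<odot> N)"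
  by (rule smult_image) (rule module_hom_scale)

lemma subspace_scale_image: "subspace N \<Longrightarrow> subspace (scale c ` N)"
  using module_hom.subspace_image[OF module_hom_scale] .

lemma smult_principal: "subspace N \<Longrightarrow> range ((*) c) \<odot> N = scale c ` N"
proof (rule order.antisym)
  assume N: "subspace N"
  show "range ((*) c) \<odot> N \<subseteq> scale c ` N"
  proof (rule smult_least)
    fix a x assume "a \<in> range ((*) c)" "x \<in> N"
    then obtain b where "a *s x = c *s (b *s x)" "b *s x \<in> N" using subspace_scale[OF N] by auto
    then show "a *s x \<in> scale c ` N" by blast
  qed (simp add: subspace_scale_image N)
  show "scale c ` N \<subseteq> range ((*) c) \<odot> N"
    using smult_mem[of c "range ((*) c)"] rangeI[of "(*) c" 1] by auto
qed

end

lemma comm_module_mult: "comm_module ((*) :: 'a::comm_ring_1 \<Rightarrow> 'a \<Rightarrow> 'a)"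
  by unfold_locales (simp_all add: algebra_simps)

lemmas module_mult = comm_module_mult[THEN comm_module.axioms]

lemma ring_ideal_iff:
  "ring_ideal I \<longleftrightarrow> 0 \<in> I \<and> (\<forall>x\<in>I. \<forall>y\<in>I. x + y \<in> I) \<and> (\<forall>c. \<forall>x\<in>I. c * x \<in> I)"
  by (simp add: ring_ideal_def module.subspace_def[OF module_mult])

lemma ring_ideal_set_smult [simp]: "ring_ideal (set_smult (*) A B)"
  unfolding ring_ideal_def by (rule comm_module.subspace_smult[OF comm_module_mult])

lemma ring_ideal_power [simp]: "ring_ideal (ideal_power I n)"
  by (cases n) (simp_all add: ring_ideal_iff[of UNIV])

lemma ring_ideal_range [simp]: "ring_ideal (range ((*) c))"
  using comm_module.subspace_scale_image[OF comm_module_mult, of UNIV c]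
  by (simp add: ring_ideal_def module.subspace_UNIV[OF module_mult])

lemma ring_ideal_eq_UNIV: "ring_ideal I \<Longrightarrow> 1 \<in> I \<Longrightarrow> I = UNIV"
  unfolding ring_ideal_iff by (metis UNIV_eq_I mult.right_neutral)

lemma ideal_mult_commute: "set_smult (*) A B = set_smult (*) B A"
  unfolding set_smult_def by (rule arg_cong[of _ _ "module.span (*)"]) (use mult.commute in blast)

lemma ideal_power_add: "ideal_power I (m + n) = set_smult (*) (ideal_power I m) (ideal_power I n)"
proof (induction m)
  case 0
  then show ?case
    using comm_module.smult_UNIV_left[OF comm_module_mult, of "ideal_power I n"]
      ring_ideal_power[of I n]
    by (simp add: ring_ideal_def)
qed (simp add: comm_module.smult_assoc[OF comm_module_mult])

lemma ideal_power_power: "ideal_power (ideal_power I k) n = ideal_power I (k * n)"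
  by (induction n) (simp_all add: ideal_power_add)

lemma ideal_power_1: "ring_ideal I \<Longrightarrow> ideal_power I (Suc 0) = I"
  using comm_module.smult_UNIV_left[OF comm_module_mult, of I]
  by (simp add: ideal_mult_commute[of I] ring_ideal_def)

lemma ideal_power_mono: "m \<le> n \<Longrightarrow> ideal_power I n \<subseteq> ideal_power I m"
proof (induction n rule: dec_induct)
  case (step n)
  have "set_smult (*) I (ideal_power I n) \<subseteq> ideal_power I n"
    using comm_module.smult_subset[OF comm_module_mult, of "ideal_power I n" I]
      ring_ideal_power[of I n] by (simp add: ring_ideal_def)
  then show ?case using step by simp
qed simp

lemma mult_in_ideal_power_add:
  "a \<in> ideal_power I m \<Longrightarrow> b \<in> ideal_power I n \<Longrightarrow> a * b \<in> ideal_power I (m + n)"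
  unfolding ideal_power_add by (rule comm_module.smult_mem[OF comm_module_mult])

lemma power_in_ideal_power: "a \<in> ideal_power I m \<Longrightarrow> a ^ n \<in> ideal_power I (m * n)"
proof (induction n)
  case (Suc n)
  then show ?case using mult_in_ideal_power_add[of a I m "a ^ n" "m * n"] by simp
qed simp

lemma nonzerodivisor_power: "nonzerodivisor a \<Longrightarrow> nonzerodivisor (a ^ n)"
  by (induction n) (auto intro: nonzerodivisor_mult)

lemma regular_ideal_power: "regular_ideal I \<Longrightarrow> regular_ideal (ideal_power I n)"
proof -
  assume "regular_ideal I"
  then obtain a where "a \<in> I" "ring_ideal I" "nonzerodivisor a" by (auto simp: regular_ideal_def)
  then have "a ^ n \<in> ideal_power I n" "nonzerodivisor (a ^ n)"
    using power_in_ideal_power[of a I "Suc 0" n] nonzerodivisor_power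
    by (simp_all add: ideal_power_1 del: ideal_power.simps)
  then show ?thesis by (auto simp: regular_ideal_def)
qed

locale noetherian_module = comm_module scale
  for scale :: "'a::comm_ring_1 \<Rightarrow> 'm::ab_group_add \<Rightarrow> 'm" (infixr "*s" 75) +
  assumes noetherian: "noetherian TYPE('a)"
    and fin_gen: "fin_gen scale"
begin

text \<open>The coefficients at \<open>u\<close> of elements of \<open>N\<close> form an ideal
  \<open>A\<close>. Lifts to \<open>N\<close> of finitely many generators of \<open>A\<close> reduce
  any element of \<open>N\<close> to one in \<open>N \<inter> span F\<close>, where the induction
  hypothesis applies.\<close>

lemma submodule_of_span_fin_gen:
  assumes "finite F" "subspace N" "N \<subseteq> span F"
  shows "\<exists>G. finite G \<and> span G = N"
  using assms
proof (induction F arbitrary: N rule: finite_induct)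
  case empty
  then show ?case using subspace_0[of N] by (intro exI[of _ "{}"]) auto
next
  case (insert u F)
  interpret R: module "(*) :: 'a \<Rightarrow> 'a \<Rightarrow> 'a" by (rule module_mult)
  define A where "A = {a. \<exists>n\<in>N. n - a *s u \<in> span F}"
  have "R.subspace A"
  proof (rule R.subspaceI)
    show "0 \<in> A" using subspace_0[OF insert.prems(1)] span_zero[of F] by (auto simp: A_def intro!: bexI[of _ 0])
    show "a + b \<in> A" if ab: "a \<in> A" "b \<in> A" for a b
    proof -
      obtain m n where "m \<in> N" "n \<in> N" "m - a *s u \<in> span F" "n - b *s u \<in> span F"
        using ab by (auto simp: A_def)
      then have "m + n \<in> N" "(m - a *s u) + (n - b *s u) \<in> span F"
        using subspace_add[OF insert.prems(1)] span_add by blast+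
      then show ?thesis unfolding A_def by (auto simp: algebra_simps)
    qed
    show "c * a \<in> A" if a: "a \<in> A" for a c
    proof -
      obtain n where "n \<in> N" "n - a *s u \<in> span F" using a by (auto simp: A_def)
      then have "c *s n \<in> N" "c *s (n - a *s u) \<in> span F"
        using subspace_scale[OF insert.prems(1)] span_scale by blast+
      then show ?thesis unfolding A_def by (auto simp: scale_right_diff_distrib)
    qed
  qed
  then obtain G where G: "finite G" "R.span G = A"
    using noetherian unfolding noetherian_def ring_ideal_def by blast
  then have "\<forall>a\<in>G. \<exists>n\<in>N. n - a *s u \<in> span F"
    using R.span_superset[of G] by (auto simp: A_def)
  then obtain h where h: "\<And>a. a \<in> G \<Longrightarrow> h a \<in> N" "\<And>a. a \<in> G \<Longrightarrow> h a - a *s u \<in> span F" by metis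
  obtain G' where G': "finite G'" "span G' = N \<inter> span F"
    using insert.IH[of "N \<inter> span F"] insert.prems subspace_inter by blast
  have lift: "\<exists>w\<in>span (h ` G). w - k *s u \<in> span F" if "k \<in> R.span G" for k
    using that
  proof (induction rule: R.span_induct_alt)
    case base
    then show ?case by (auto intro!: bexI[of _ 0] span_zero)
  next
    case (step c x y)
    then obtain w where w: "w \<in> span (h ` G)" "w - y *s u \<in> span F" by auto
    have "c *s (h x - x *s u) + (w - y *s u) \<in> span F"
      using h step w by (intro span_add span_scale) auto
    then have "(c *s h x + w) - (c * x + y) *s u \<in> span F" by (simp add: algebra_simps)
    moreover have "c *s h x + w \<in> span (h ` G)"
      using w step by (intro span_add span_scale) (auto intro: span_base)
    ultimately show ?case by blast
  qed
  have "span (h ` G \<union> G') \<subseteq> N"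
    using h G' span_superset[of G'] insert.prems by (intro span_minimal) auto
  moreover have "N \<subseteq> span (h ` G \<union> G')"
  proof
    fix n assume n: "n \<in> N"
    then obtain k where k: "n - k *s u \<in> span F"
      using insert.prems by (auto simp: span_insert)
    then have "k \<in> R.span G" using n G by (auto simp: A_def)
    then obtain w where w: "w \<in> span (h ` G)" "w - k *s u \<in> span F" using lift by blast
    have "span (h ` G) \<subseteq> N" using h insert.prems by (intro span_minimal) auto
    then have "n - w \<in> N" using n w insert.prems(1) subspace_diff by auto
    moreover have "(n - k *s u) - (w - k *s u) \<in> span F" by (rule span_diff[OF k w(2)])
    ultimately have "n - w \<in> span G'" using G' by simp
    then have "w + (n - w) \<in> span (h ` G \<union> G')" unfolding span_Un using w by blast
    then show "n \<in> span (h ` G \<union> G')" by simp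
  qed
  ultimately show ?case using G G' by (intro exI[of _ "h ` G \<union> G'"]) auto
qed

lemma submodule_fin_gen: "subspace N \<Longrightarrow> \<exists>G. finite G \<and> span G = N"
  using submodule_of_span_fin_gen fin_gen unfolding fin_gen_def by auto

text \<open>The union of a chain of submodules is finitely generated, so one member contains all
  generators and equals the union. This is the form in which Noetherian induction is used
  below.\<close>

lemma maximal_submodule:
  assumes "S \<noteq> {}" "\<And>N. N \<in> S \<Longrightarrow> subspace N"
  obtains N where "N \<in> S" "\<And>N'. N' \<in> S \<Longrightarrow> N \<subseteq> N' \<Longrightarrow> N' = N"
proof -
  have "\<exists>N\<in>S. \<forall>N'\<in>S. N \<subseteq> N' \<longrightarrow> N' = N"
  proof (rule subset_Zorn_nonempty[OF assms(1)])
    fix C assume C: "C \<noteq> {}" "subset.chain S C"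
    have CS: "C \<subseteq> S" using C unfolding subset.chain_def by auto
    have "subspace (\<Union>C)"
    proof (rule subspaceI)
      show "0 \<in> \<Union>C" using C CS assms(2) subspace_0 by fastforce
      show "x + y \<in> \<Union>C" if xy: "x \<in> \<Union>C" "y \<in> \<Union>C" for x y
      proof -
        obtain N where "N \<in> C" "{x, y} \<subseteq> N"
          using finite_subset_Union_chain[of "{x, y}" C S] C xy by auto
        then have "x + y \<in> N" using CS assms(2) by (intro subspace_add) auto
        then show ?thesis using \<open>N \<in> C\<close> by blast
      qed
      show "c *s x \<in> \<Union>C" if "x \<in> \<Union>C" for c x
        using that CS assms(2) subspace_scale by blast
    qed
    then obtain G where G: "finite G" "span G = \<Union>C" using submodule_fin_gen by blast
    obtain N where N: "N \<in> C" "G \<subseteq> N"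
      using finite_subset_Union_chain[of G C S] C G span_superset by metis
    then have "span G \<subseteq> N" using span_minimal CS assms(2) by blast
    then have "\<Union>C = N" using N G by auto
    then show "\<Union>C \<in> S" using N CS by auto
  qed
  then show ?thesis using that by blast
qed

end

lemma noetherian_module_mult:
  assumes "noetherian TYPE('a::comm_ring_1)"
  shows "noetherian_module ((*) :: 'a \<Rightarrow> 'a \<Rightarrow> 'a)"
proof -
  interpret R: comm_module "(*) :: 'a \<Rightarrow> 'a \<Rightarrow> 'a" by (rule comm_module_mult)
  have "R.span {1} = UNIV" by (auto simp: R.span_singleton)
  then show ?thesis
    by unfold_locales (auto simp: assms fin_gen_def intro!: exI[of _ "{1}"])
qed

section \<open>Prime and maximal ideals in a Noetherian ring of dimension one\<close>

lemma ring_ideal_adjoin: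
  assumes "ring_ideal P"
  shows "ring_ideal {p + r * a | p r. p \<in> P}" "P \<subseteq> {p + r * a | p r. p \<in> P}"
    "a \<in> {p + r * a | p r. p \<in> P}"
proof -
  have P: "0 \<in> P" "\<And>x y. x \<in> P \<Longrightarrow> y \<in> P \<Longrightarrow> x + y \<in> P" "\<And>c x. x \<in> P \<Longrightarrow> c * x \<in> P"
    using assms by (auto simp: ring_ideal_iff)
  let ?J = "{p + r * a | p r. p \<in> P}"
  show "P \<subseteq> ?J"
  proof
    fix p assume "p \<in> P"
    then have "p + 0 * a \<in> ?J" by blast
    then show "p \<in> ?J" by simp
  qed
  then have "0 \<in> ?J" using P by blast
  moreover have "x + y \<in> ?J" if xy: "x \<in> ?J" "y \<in> ?J" for x y
  proof -
    obtain p r p' r' where "x = p + r * a" "p \<in> P" "y = p' + r' * a" "p' \<in> P" using xy by blast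
    then have "x + y = (p + p') + (r + r') * a" "p + p' \<in> P" using P by (auto simp: algebra_simps)
    then show ?thesis by blast
  qed
  moreover have "c * x \<in> ?J" if x: "x \<in> ?J" for c x
  proof -
    obtain p r where "x = p + r * a" "p \<in> P" using x by blast
    then have "c * x = c * p + (c * r) * a" "c * p \<in> P"
      using P(3)[of p c] by (simp_all add: distrib_left mult.assoc)
    then show ?thesis by blast
  qed
  ultimately show "ring_ideal ?J" unfolding ring_ideal_iff by blast
  have "0 + 1 * a \<in> ?J" using P by blast
  then show "a \<in> ?J" by simp
qed

lemma maximal_ideal_imp_prime:
  assumes "maximal_ideal P"
  shows "prime_ideal P"
proof -
  have P: "ring_ideal P" "P \<noteq> UNIV" "\<And>J. ring_ideal J \<Longrightarrow> P \<subseteq> J \<Longrightarrow> J = P \<or> J = UNIV"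
    using assms by (auto simp: maximal_ideal_def)
  have "b \<in> P" if ab: "a * b \<in> P" "a \<notin> P" for a b
  proof -
    define J where "J = {p + r * a | p r. p \<in> P}"
    have "ring_ideal J" "P \<subseteq> J" "a \<in> J" unfolding J_def by (rule ring_ideal_adjoin[OF P(1)])+
    then have "J = UNIV" using P(3) ab(2) by auto
    then have "1 \<in> J" by simp
    then obtain p r where p: "p \<in> P" "1 = p + r * a" by (auto simp: J_def)
    have "b = (p + r * a) * b" by (simp add: p(2)[symmetric])
    also have "\<dots> = b * p + r * (a * b)" by (simp add: algebra_simps)
    finally have "b = b * p + r * (a * b)" .
    then show "b \<in> P" using P(1) p(1) ab(1) unfolding ring_ideal_iff by metis
  qed
  then show ?thesis using P unfolding prime_ideal_def by blast
qed

context
  assumes noeth: "noetherian TYPE('a::comm_ring_1)"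
begin

lemma maximal_in_family_of_ideals:
  fixes S :: "'a set set"
  assumes "S \<noteq> {}" "\<And>J. J \<in> S \<Longrightarrow> ring_ideal J"
  obtains J where "J \<in> S" "\<And>J'. J' \<in> S \<Longrightarrow> J \<subseteq> J' \<Longrightarrow> J' = J"
  using noetherian_module.maximal_submodule[OF noetherian_module_mult[OF noeth], of S] assms
  unfolding ring_ideal_def by blast

lemma exists_maximal_ideal:
  fixes J :: "'a set"
  assumes "ring_ideal J" "J \<noteq> UNIV"
  obtains P where "maximal_ideal P" "J \<subseteq> P"
proof -
  let ?S = "{P. ring_ideal P \<and> P \<noteq> UNIV \<and> J \<subseteq> P}"
  obtain P where P: "P \<in> ?S" "\<And>J'. J' \<in> ?S \<Longrightarrow> P \<subseteq> J' \<Longrightarrow> J' = P"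
    by (rule maximal_in_family_of_ideals[of ?S]) (use assms in auto)
  then have "maximal_ideal P" unfolding maximal_ideal_def by blast
  then show ?thesis using P that by auto
qed

text \<open>An ideal \<open>Q\<close> maximal among those disjoint from the multiplicative set
  \<open>S\<close> is prime: if \<open>a\<close> and \<open>b\<close> are outside \<open>Q\<close>,
  then adjoining either yields an element of \<open>S\<close>, and the product of the two elements
  would lie in \<open>Q\<close> if \<open>a * b\<close> did.\<close>

lemma exists_prime_avoiding:
  fixes S :: "'a set"
  assumes "1 \<in> S" "\<And>a b. a \<in> S \<Longrightarrow> b \<in> S \<Longrightarrow> a * b \<in> S" "0 \<notin> S"
  obtains Q where "prime_ideal Q" "Q \<inter> S = {}"
proof -
  let ?F = "{J. ring_ideal J \<and> J \<inter> S = {}}"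
  have "{0} \<in> ?F" using assms by (auto simp: ring_ideal_iff)
  then obtain Q where Q: "Q \<in> ?F" "\<And>J'. J' \<in> ?F \<Longrightarrow> Q \<subseteq> J' \<Longrightarrow> J' = Q"
    using maximal_in_family_of_ideals[of ?F] by blast
  have Qi: "0 \<in> Q" "\<And>x y. x \<in> Q \<Longrightarrow> y \<in> Q \<Longrightarrow> x + y \<in> Q" "\<And>c x. x \<in> Q \<Longrightarrow> c * x \<in> Q"
    using Q(1) by (auto simp: ring_ideal_iff)
  have adj: "\<exists>q r. q \<in> Q \<and> q + r * a \<in> S" if "a \<notin> Q" for a
  proof (rule ccontr)
    assume no: "\<not> ?thesis"
    define J where "J = {q + r * a | q r. q \<in> Q}"
    have J: "ring_ideal J" "Q \<subseteq> J" "a \<in> J"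
      unfolding J_def by (rule ring_ideal_adjoin; use Q(1) in simp)+
    moreover have "J \<inter> S = {}" using no by (auto simp: J_def)
    ultimately have "J = Q" using Q(2) by blast
    then show False using that J(3) by simp
  qed
  have "a \<in> Q \<or> b \<in> Q" if ab: "a * b \<in> Q" for a b
  proof (rule ccontr)
    assume "\<not> ?thesis"
    then obtain q r q' r' where
      q: "q \<in> Q" "q + r * a \<in> S" "q' \<in> Q" "q' + r' * b \<in> S" using adj by metis
    have "(q + r * a) * (q' + r' * b) = (q' + r' * b) * q + ((r * a) * q' + (r * r') * (a * b))"
      by (simp add: algebra_simps)
    moreover have "(q' + r' * b) * q \<in> Q" "(r * a) * q' \<in> Q" "(r * r') * (a * b) \<in> Q"
      using q ab Qi(3) by simp_all
    then have "(q' + r' * b) * q + ((r * a) * q' + (r * r') * (a * b)) \<in> Q" by (intro Qi(2))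
    ultimately show False using assms(2)[OF q(2,4)] Q(1) by auto
  qed
  moreover have "Q \<noteq> UNIV" using Q(1) assms(1) by auto
  ultimately have "prime_ideal Q" using Q(1) unfolding prime_ideal_def by auto
  then show ?thesis using Q(1) that by auto
qed

text \<open>A nonzerodivisor \<open>x\<close> lies in no minimal prime: the multiplicative set of all
  \<open>s x\<^sup>n\<close> with \<open>s \<notin> P\<close> does not contain 0.\<close>

lemma prime_over_nonzerodivisor_maximal:
  fixes P :: "'a set"
  assumes dim: "krull_dim TYPE('a) = 1" and P: "prime_ideal P" and x: "x \<in> P" "nonzerodivisor x"
  shows "maximal_ideal P"
proof (rule ccontr)
  assume notmax: "\<not> maximal_ideal P"
  obtain m where m: "maximal_ideal m" "P \<subseteq> m"
    using exists_maximal_ideal[of P] P by (auto simp: prime_ideal_def)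
  have Pm: "P \<subset> m" using m notmax by auto
  let ?S = "{s * x ^ n | s n. s \<notin> P}"
  have P1: "1 \<notin> P" using P ring_ideal_eq_UNIV by (auto simp: prime_ideal_def)
  have "1 * x ^ 0 \<in> ?S" using P1 by blast
  then have 1: "1 \<in> ?S" by simp
  have 2: "a * b \<in> ?S" if ab: "a \<in> ?S" "b \<in> ?S" for a b
  proof -
    obtain s n t k where s: "a = s * x ^ n" "s \<notin> P" "b = t * x ^ k" "t \<notin> P" using ab by blast
    then have "a * b = (s * t) * x ^ (n + k)" by (simp add: power_add algebra_simps)
    moreover have "s * t \<notin> P" using s P by (auto simp: prime_ideal_def)
    ultimately show ?thesis by blast
  qed
  have 3: "0 \<notin> ?S"
  proof
    assume "0 \<in> ?S"
    then obtain s n where s: "0 = s * x ^ n" "s \<notin> P" by blast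
    then have "x ^ n * s = 0" by (simp add: mult.commute)
    then have "s = 0" using nonzerodivisor_power[OF x(2), of n] by (simp add: nonzerodivisor_def)
    then show False using s P by (auto simp: prime_ideal_def ring_ideal_iff)
  qed
  obtain Q where Q: "prime_ideal Q" "Q \<inter> ?S = {}" by (rule exists_prime_avoiding[OF 1 2 3])
  \<comment> \<open>The exponent 0 puts the complement of \<open>P\<close> into \<open>?S\<close>,
    and \<open>s = 1\<close> puts \<open>x\<close> there, so avoiding \<open>?S\<close> means to be
    inside \<open>P\<close> and to miss \<open>x\<close>.\<close>
  have "Q \<subseteq> P"
  proof
    fix q assume "q \<in> Q"
    moreover have "q * x ^ 0 \<in> ?S" if "q \<notin> P" using that by blast
    ultimately show "q \<in> P" using Q(2) by (auto simp del: mem_Collect_eq)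
  qed
  moreover have "1 * x ^ 1 \<in> ?S" using P1 by blast
  then have "x \<notin> Q" using Q(2) by auto
  ultimately have QP: "Q \<subset> P" using x by auto
  let ?C = "\<lambda>i::nat. if i = 0 then Q else if i = 1 then P else m"
  have "\<exists>C :: nat \<Rightarrow> 'a set. (\<forall>i\<le>2. prime_ideal (C i)) \<and> (\<forall>i<2. C i \<subset> C (Suc i))"
    by (rule exI[of _ ?C]) (use Q P m QP Pm maximal_ideal_imp_prime in \<open>auto simp: less_2_cases_iff\<close>)
  then have "enat 2 \<le> krull_dim TYPE('a)"
    unfolding krull_dim_def by (intro Sup_upper) blast
  then show False using dim by (simp add: one_enat_def)
qed

end

lemma local_ring_maximal_ideal:
  assumes "local_ring TYPE('a::comm_ring_1)" "maximal_ideal (P :: 'a set)"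
  shows "P = max_ideal"
  using assms unfolding local_ring_def max_ideal_def by (metis the_equality)

section \<open>Associated primes, finite length and Nakayama's lemma\<close>

context noetherian_module
begin

text \<open>Take an annihilator \<open>P\<close> that is maximal among those of nonzero classes
  modulo \<open>N\<close> of elements of \<open>W\<close>. For \<open>b\<close> outside
  \<open>P\<close>, the class of \<open>b *s u\<close> is nonzero and its annihilator contains
  \<open>P\<close>, hence equals \<open>P\<close>; this is primality.\<close>

lemma exists_associated_prime:
  assumes N: "subspace N" and W: "subspace W" "\<not> W \<subseteq> N"
  obtains u where "u \<in> W" "u \<notin> N" "prime_ideal {a. a *s u \<in> N}"
proof -
  let ?S = "{{a. a *s u \<in> N} | u. u \<in> W \<and> u \<notin> N}"
  have id: "ring_ideal {a. a *s u \<in> N}" for u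
    unfolding ring_ideal_iff
    by (auto simp: subspace_0[OF N] subspace_add[OF N] scale_left_distrib scale_scale[symmetric]
        subspace_scale[OF N] simp del: scale_scale)
  obtain P where P: "P \<in> ?S" "\<And>J'. J' \<in> ?S \<Longrightarrow> P \<subseteq> J' \<Longrightarrow> J' = P"
    using maximal_in_family_of_ideals[OF noetherian, of ?S] W(2) id by blast
  then obtain u where u: "u \<in> W" "u \<notin> N" "P = {a. a *s u \<in> N}" by auto
  have "a \<in> P" if ab: "a * b \<in> P" "b \<notin> P" for a b
  proof -
    have b: "b *s u \<in> W" "b *s u \<notin> N" using u ab subspace_scale[OF W(1)] by auto
    have "P \<subseteq> {c. c *s (b *s u) \<in> N}"
    proof
      fix c assume "c \<in> P"
      then have "b *s (c *s u) \<in> N" using u by (intro subspace_scale[OF N, of "c *s u"]) auto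
      then show "c \<in> {c. c *s (b *s u) \<in> N}" by (simp add: mult.commute)
    qed
    moreover have "{c. c *s (b *s u) \<in> N} \<in> ?S" using b by blast
    ultimately have "{c. c *s (b *s u) \<in> N} = P" using P(2) by blast
    moreover have "a \<in> {c. c *s (b *s u) \<in> N}" using ab u by simp
    ultimately show ?thesis by blast
  qed
  moreover have "1 \<notin> P" using u by simp
  ultimately have "prime_ideal P" using id[of u] u(3) unfolding prime_ideal_def by blast
  then show ?thesis using that u by simp
qed

text \<open>Let \<open>K\<close> be maximal among the counterexamples. An associated prime of M/K
  contains \<open>x\<close>, so it is maximal in dimension one, and the corresponding submodule K'/K
  is simple. As M/K' has finite length, so has M/K.\<close>

lemma finite_length_quotient:
  assumes dim: "krull_dim TYPE('a) = 1" and x: "nonzerodivisor x"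
    and N: "subspace N" "range (scale x) \<subseteq> N"
  shows "len UNIV N \<noteq> \<infinity>"
proof
  assume inf: "len UNIV N = \<infinity>"
  let ?S = "{N. subspace N \<and> range (scale x) \<subseteq> N \<and> len UNIV N = \<infinity>}"
  have "N \<in> ?S" using N inf by simp
  then obtain K where K: "K \<in> ?S" "\<And>N'. N' \<in> ?S \<Longrightarrow> K \<subseteq> N' \<Longrightarrow> N' = K"
    using maximal_submodule[of ?S] by blast
  then have sK: "subspace K" by simp
  have "\<not> UNIV \<subseteq> K"
  proof
    assume "UNIV \<subseteq> K"
    then have "K = UNIV" by blast
    then show False using K(1) by simp
  qed
  then obtain u where u: "u \<notin> K" "prime_ideal {a. a *s u \<in> K}" (is "prime_ideal ?P")
    using exists_associated_prime[OF sK subspace_UNIV] by blast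
  have "x \<in> ?P" using K by auto
  then have max: "maximal_ideal ?P"
    using prime_over_nonzerodivisor_maximal[OF noetherian dim u(2)] x by blast
  define K' where "K' = span (insert u K)"
  have K': "subspace K'" "K \<subset> K'" using u(1) span_superset[of "insert u K"] by (auto simp: K'_def)
  have simple: "L = K \<or> L = K'" if L: "subspace L" "K \<subseteq> L" "L \<subseteq> K'" for L
  proof (cases "L = K")
    case False
    then obtain v where v: "v \<in> L" "v \<notin> K" using L by auto
    then obtain k where k: "v - k *s u \<in> K"
      using L sK unfolding K'_def span_insert by (auto simp: span_eq_iff[THEN iffD2])
    have "k \<notin> ?P"
    proof
      assume "k \<in> ?P"
      then have "(v - k *s u) + k *s u \<in> K" using k by (intro subspace_add[OF sK]) auto
      then show False using v by simp
    qed
    define J where "J = {a. a *s u \<in> L}"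
    have "ring_ideal J"
      unfolding ring_ideal_iff J_def
      by (auto simp: subspace_0[OF L(1)] subspace_add[OF L(1)] scale_left_distrib
          scale_scale[symmetric] subspace_scale[OF L(1)] simp del: scale_scale)
    moreover have "?P \<subseteq> J" using L by (auto simp: J_def)
    moreover have "v - (v - k *s u) \<in> L" using v k L by (subst subspace_diff) auto
    then have "k \<in> J" by (simp add: J_def)
    ultimately have "J = UNIV" using max \<open>k \<notin> ?P\<close> unfolding maximal_ideal_def by blast
    then have "1 *s u \<in> L" unfolding J_def by blast
    then have "K' \<subseteq> L" using L unfolding K'_def by (intro span_minimal) auto
    then show ?thesis using L by auto
  qed simp
  have "len K' K \<le> 1"
  proof (rule len_le_I)
    fix n assume "submodule_chain K K' n"
    then obtain L where
      L: "L 0 = K" "L n = K'" "\<And>i. i \<le> n \<Longrightarrow> subspace (L i)" "\<And>i. i < n \<Longrightarrow> L i \<subset> L (Suc i)"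
      unfolding submodule_chain_def by metis
    have "n \<le> 1"
    proof (rule ccontr)
      assume "\<not> n \<le> 1"
      then have n: "1 < n" by simp
      have "L 1 \<subset> L 2" "L 0 \<subset> L 1" using L(4)[of 1] L(4)[of 0] n by (auto simp: numeral_2_eq_2)
      moreover have "L 2 \<subseteq> L n" using increasing_chain_mono[of n L 2 n] L(4) n by auto
      ultimately show False using simple[of "L 1"] L(1,2) L(3)[of 1] n by auto
    qed
    then show "enat n \<le> 1" by (simp add: one_enat_def)
  qed
  moreover have "len UNIV K' \<noteq> \<infinity>"
    using K(2)[of K'] K(1) K' by auto
  moreover have "len UNIV K = len UNIV K' + len K' K"
    using sK K' by (intro len_add) auto
  ultimately have "len UNIV K \<noteq> \<infinity>" by (cases "len K' K"; cases "len UNIV K'") auto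
  then show False using K(1) by simp
qed

text \<open>Depth one provides \<open>y\<close> in the maximal ideal that is injective on M. If the
  kernel of \<open>x\<close> were nonzero, an associated prime of it would contain \<open>x\<close>,
  hence be the maximal ideal, and \<open>y\<close> would kill a nonzero element.\<close>

lemma mcm_torsion_free:
  assumes loc: "local_ring TYPE('a)" and dim: "krull_dim TYPE('a) = 1"
    and mcm: "max_cohen_macaulay scale" and x: "nonzerodivisor x" "x *s u = 0"
  shows "u = 0"
proof (rule ccontr)
  assume u: "u \<noteq> 0"
  have "(UNIV :: 'm set) \<noteq> {0}" using u by auto
  then have "depth scale = 1" using mcm dim by (simp add: max_cohen_macaulay_def)
  moreover have "depth scale \<le> 0"
    if "\<And>xs. set xs \<subseteq> max_ideal \<Longrightarrow> regular_sequence scale xs \<Longrightarrow> xs = []"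
    unfolding depth_def by (rule Sup_least) (use that in \<open>auto simp: zero_enat_def\<close>)
  ultimately obtain xs where xs: "set xs \<subseteq> max_ideal" "regular_sequence scale xs" "xs \<noteq> []"
    by (metis not_one_le_zero)
  define y where "y = xs ! 0"
  \<comment> \<open>The condition on entry 0 of a regular sequence is taken modulo this zero
    submodule.\<close>
  have "set_smult scale {} UNIV = {0}" by (simp add: set_smult_def)
  then have y: "y \<in> max_ideal" "\<And>v. y *s v = 0 \<Longrightarrow> v = 0"
    using xs(1,3) nth_mem[of 0 xs] xs(2)[unfolded regular_sequence_def, THEN conjunct1, rule_format, of 0]
    unfolding y_def by auto
  let ?W = "{u. x *s u = 0}"
  have "subspace ?W" by (rule subspaceI) (auto simp: algebra_simps scale_left_commute simp del: scale_scale)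
  moreover have "\<not> ?W \<subseteq> {0}" using u x by auto
  ultimately obtain v where v: "v \<in> ?W" "v \<notin> {0}" "prime_ideal {a. a *s v \<in> {0}}"
    using exists_associated_prime[OF subspace_single_0] by blast
  then have "maximal_ideal {a. a *s v \<in> {0}}"
    using prime_over_nonzerodivisor_maximal[OF noetherian dim v(3)] x by blast
  then have "{a. a *s v \<in> {0}} = max_ideal" using local_ring_maximal_ideal[OF loc] by blast
  then have "y *s v = 0" using y(1) by auto
  then show False using y(2) v(2) by blast
qed

text \<open>Choose \<open>W\<close> maximal among the proper submodules of \<open>A\<close> above
  \<open>B\<close>. If \<open>a *s u\<close> were outside \<open>W\<close> for some
  \<open>a \<in> I\<close>, then \<open>W\<close> and \<open>a *s u\<close> would generate
  \<open>A\<close>, so (1 - k a) u would lie in \<open>W\<close>; but 1 - k a is a unit. Thus IA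
  lies in \<open>W\<close>, and then so does \<open>A\<close>.\<close>

lemma nakayama:
  assumes loc: "local_ring TYPE('a)" and I: "I \<subseteq> max_ideal"
    and sub: "subspace A" "subspace B" "B \<subseteq> A"
    and gen: "\<And>x. x \<in> A \<Longrightarrow> \<exists>b\<in>B. x - b \<in> I \<odot> A"
  shows "A = B"
proof (rule ccontr)
  assume "A \<noteq> B"
  let ?S = "{W. subspace W \<and> B \<subseteq> W \<and> W \<subset> A}"
  have "B \<in> ?S" using sub \<open>A \<noteq> B\<close> by auto
  then obtain W where W: "W \<in> ?S" "\<And>N'. N' \<in> ?S \<Longrightarrow> W \<subseteq> N' \<Longrightarrow> N' = W"
    using maximal_submodule[of ?S] by blast
  then have sW: "subspace W" "B \<subseteq> W" "W \<subset> A" by auto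
  have "I \<odot> A \<subseteq> W"
  proof (rule smult_least[OF _ sW(1)])
    fix a u assume a: "a \<in> I" and u: "u \<in> A"
    show "a *s u \<in> W"
    proof (rule ccontr)
      assume au: "a *s u \<notin> W"
      define V where "V = span (insert (a *s u) W)"
      have "V \<subseteq> A"
        unfolding V_def using sW u subspace_scale[OF sub(1)] by (intro span_minimal sub) auto
      moreover have "W \<subseteq> V" "a *s u \<in> V" using span_superset[of "insert (a *s u) W"] by (auto simp: V_def)
      ultimately have "V = A"
        using W(2)[of V] sW au by (auto simp: V_def)
      then obtain k where k: "u - k *s (a *s u) \<in> W"
        using u sW unfolding V_def span_insert by (auto simp: span_eq_iff[THEN iffD2])
      have "\<exists>r. r * (1 - k * a) = 1"
      proof (rule ccontr)
        assume no: "\<not> ?thesis"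
        let ?J = "range ((*) (1 - k * a))"
        have "?J \<noteq> UNIV" using no by (metis UNIV_I rangeE mult.commute)
        then obtain P where P: "maximal_ideal P" "?J \<subseteq> P"
          using exists_maximal_ideal[OF noetherian ring_ideal_range] by blast
        have "(1 - k * a) * 1 \<in> P" using P(2) by blast
        moreover have "k * a \<in> P"
        proof -
          have "ring_ideal P" using P(1) by (simp add: maximal_ideal_def)
          moreover have "a \<in> P" using a I local_ring_maximal_ideal[OF loc P(1)] by blast
          ultimately show ?thesis unfolding ring_ideal_iff by blast
        qed
        ultimately have "(1 - k * a) * 1 + k * a \<in> P"
          using P(1) unfolding maximal_ideal_def ring_ideal_iff by blast
        then show False using P(1) ring_ideal_eq_UNIV by (auto simp: maximal_ideal_def)
      qed
      then obtain r where r: "r * (1 - k * a) = 1" by blast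
      have "r *s (u - k *s (a *s u)) = (r * (1 - k * a)) *s u"
        by (simp add: algebra_simps)
      then have "u \<in> W" using r subspace_scale[OF sW(1) k, of r] by simp
      then show False using au subspace_scale[OF sW(1)] by blast
    qed
  qed
  have "A \<subseteq> W"
  proof (intro subsetI)
    fix x assume "x \<in> A"
    then obtain b where "b \<in> B" "x - b \<in> I \<odot> A" using gen by blast
    then have "(x - b) + b \<in> W" using \<open>I \<odot> A \<subseteq> W\<close> sW by (intro subspace_add) auto
    then show "x \<in> W" by simp
  qed
  then show False using sW by auto
qed

end

section \<open>The semiring of ideals\<close>

text \<open>The length of M/cN splits at \<open>N\<close> and also at cM. The layers M/N and cM/cN
  are isomorphic and of finite length, so they cancel.\<close>

lemma (in comm_module) len_scale_quotient:
  assumes inj: "inj (scale c)" and N: "subspace N" and fin: "len UNIV N \<noteq> \<infinity>"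
  shows "len N (scale c ` N) = len UNIV (range (scale c))"
proof -
  have sub: "subspace (scale c ` N)" "subspace (range (scale c))"
    using N subspace_scale_image[OF subspace_UNIV] by (auto intro: subspace_scale_image)
  have cN: "scale c ` N \<subseteq> N" using subspace_scale[OF N] by blast
  have "len UNIV N + len N (scale c ` N) = len UNIV (scale c ` N)"
    using len_add[of "scale c ` N" N UNIV] sub N cN by simp
  also have "\<dots> = len UNIV (range (scale c)) + len (range (scale c)) (scale c ` N)"
    using len_add[of "scale c ` N" "range (scale c)" UNIV] sub by auto
  also have "len (range (scale c)) (scale c ` N) = len UNIV N"
    using len_image[OF module_hom_scale inj N subspace_UNIV] by simp
  finally show ?thesis
    using fin by (cases "len UNIV N"; cases "len N (scale c ` N)"; cases "len UNIV (range (scale c))") auto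
qed

lemma bounded_incseq_nat_eventually_const:
  fixes f :: "nat \<Rightarrow> nat"
  assumes "\<And>n. f n \<le> f (Suc n)" "\<And>n. f n \<le> b"
  obtains N where "\<And>n. n \<ge> N \<Longrightarrow> f n = f N"
proof -
  have "finite (range f)" using assms(2) by (intro finite_subset[of "range f" "{..b}"]) auto
  then obtain N where N: "f N = Max (range f)" using Max_in[of "range f"] by fastforce
  have "f n = f N" if "n \<ge> N" for n
    using lift_Suc_mono_le[of f N n] assms(1) that N Max_ge[OF \<open>finite (range f)\<close>, of "f n"] by force
  then show ?thesis using that by blast
qed

text \<open>Making ideals a type turns sums, products and powers of ideals into an ordered
  commutative semiring, with 1 as the greatest element. The estimates below then become expansions
  of polynomials.\<close>

typedef (overloaded) 'a ideal = "{I :: 'a::comm_ring_1 set. ring_ideal I}"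
  morphisms carrier Ideal
  by (rule exI[of _ UNIV]) (simp add: ring_ideal_iff)

lemma ring_ideal_carrier [simp]: "ring_ideal (carrier A)"
  using carrier by blast

lemma subspace_carrier [simp]: "module.subspace (*) (carrier A)"
  using ring_ideal_carrier unfolding ring_ideal_def .

instantiation ideal :: (comm_ring_1) "{comm_semiring_1, ordered_comm_semiring}"
begin

definition "0 = Ideal {0}"
definition "1 = Ideal UNIV"
definition "A + B = Ideal {x + y | x y. x \<in> carrier A \<and> y \<in> carrier B}"
definition "A * B = Ideal (set_smult (*) (carrier A) (carrier B))"
definition "A \<le> B \<longleftrightarrow> carrier A \<subseteq> carrier B"
definition "A < B \<longleftrightarrow> carrier A \<subset> carrier (B :: 'a ideal)"

lemma carrier_0: "carrier (0 :: 'a ideal) = {0}"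
  unfolding zero_ideal_def by (subst Ideal_inverse) (auto simp: ring_ideal_iff)

lemma carrier_1: "carrier (1 :: 'a ideal) = UNIV"
  unfolding one_ideal_def by (subst Ideal_inverse) (auto simp: ring_ideal_iff)

lemma carrier_add: "carrier (A + B :: 'a ideal) = {x + y | x y. x \<in> carrier A \<and> y \<in> carrier B}"
  unfolding plus_ideal_def
  using comm_module.subspace_set_sum[OF comm_module_mult, of "carrier A" "carrier B"]
  by (subst Ideal_inverse) (auto simp: ring_ideal_def)

lemma carrier_mult: "carrier (A * B :: 'a ideal) = set_smult (*) (carrier A) (carrier B)"
  unfolding times_ideal_def by (subst Ideal_inverse) auto

lemma carrier_zero_mem [simp]: "0 \<in> carrier A"
  and carrier_add_mem: "x \<in> carrier A \<Longrightarrow> y \<in> carrier A \<Longrightarrow> x + y \<in> carrier A"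
  and carrier_mult_left: "x \<in> carrier A \<Longrightarrow> c * x \<in> carrier A"
  using ring_ideal_carrier[of A] unfolding ring_ideal_iff by blast+

instance
proof
  fix A B C :: "'a ideal"
  show "A + B + C = A + (B + C)"
    unfolding carrier_inject[symmetric] carrier_add
    by (rule set_eqI) (auto, (metis add.assoc)+)
  show "A + B = B + A"
    unfolding carrier_inject[symmetric] carrier_add by (rule set_eqI) (auto, (metis add.commute)+)
  show "0 + A = A" unfolding carrier_inject[symmetric] carrier_add carrier_0 by auto
  show "A * B * C = A * (B * C)"
    unfolding carrier_inject[symmetric] carrier_mult
    by (rule comm_module.smult_assoc[OF comm_module_mult])
  show comm: "A * B = B * A" for A B :: "'a ideal"
    unfolding carrier_inject[symmetric] carrier_mult by (rule ideal_mult_commute)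
  show "1 * A = A"
    unfolding carrier_inject[symmetric] carrier_mult carrier_1
    by (rule comm_module.smult_UNIV_left[OF comm_module_mult subspace_carrier])
  show "0 * A = 0" "A * 0 = 0"
  proof -
    have "carrier 0 = carrier (0 * A)"
    proof (rule order.antisym)
      show "carrier (0 * A) \<subseteq> carrier 0"
        unfolding carrier_mult
        by (rule comm_module.smult_least[OF comm_module_mult]) (auto simp: carrier_0 module.subspace_single_0[OF module_mult])
    qed (simp add: carrier_0)
    then show "0 * A = 0" by (simp add: carrier_inject)
    then show "A * 0 = 0" using comm[of A 0] by simp
  qed
  show "(A + B) * C = A * C + B * C"
  proof -
    have "carrier ((A + B) * C) = carrier (A * C + B * C)"
    proof (rule order.antisym)
      show "carrier ((A + B) * C) \<subseteq> carrier (A * C + B * C)"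
        unfolding carrier_mult[of "A + B"]
      proof (rule comm_module.smult_least[OF comm_module_mult])
        fix a x assume "a \<in> carrier (A + B)" and x: "x \<in> carrier C"
        then obtain b c where bc: "a = b + c" "b \<in> carrier A" "c \<in> carrier B"
          by (auto simp: carrier_add)
        have "b * x \<in> carrier (A * C)" "c * x \<in> carrier (B * C)"
          unfolding carrier_mult using bc x by (auto intro: comm_module.smult_mem[OF comm_module_mult])
        then show "a * x \<in> carrier (A * C + B * C)"
          unfolding carrier_add using bc(1) by (auto simp: distrib_right)
      qed simp
      have "carrier A \<subseteq> carrier (A + B)" "carrier B \<subseteq> carrier (A + B)"
        unfolding carrier_add by force+
      then have "carrier (A * C) \<subseteq> carrier ((A + B) * C)" "carrier (B * C) \<subseteq> carrier ((A + B) * C)"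
        unfolding carrier_mult by (auto intro: comm_module.smult_mono[OF comm_module_mult, THEN subsetD])
      then show "carrier (A * C + B * C) \<subseteq> carrier ((A + B) * C)"
        unfolding carrier_add[of "A * C"] using carrier_add_mem by blast
    qed
    then show ?thesis by (simp add: carrier_inject)
  qed
  show "(0 :: 'a ideal) \<noteq> 1"
    unfolding carrier_inject[symmetric] carrier_0 carrier_1 by (metis UNIV_I singletonD zero_neq_one)
  show "A < B \<longleftrightarrow> A \<le> B \<and> \<not> B \<le> A" "A \<le> A" "A \<le> B \<Longrightarrow> B \<le> C \<Longrightarrow> A \<le> C"
    "A \<le> B \<Longrightarrow> B \<le> A \<Longrightarrow> A = B"
    unfolding less_eq_ideal_def less_ideal_def carrier_inject[symmetric] by auto
  show "A \<le> B \<Longrightarrow> C + A \<le> C + B"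
    unfolding less_eq_ideal_def carrier_add by blast
  show "A \<le> B \<Longrightarrow> 0 \<le> C \<Longrightarrow> C * A \<le> C * B"
    unfolding less_eq_ideal_def carrier_mult by (rule comm_module.smult_mono[OF comm_module_mult]) auto
qed

end

lemma carrier_power: "carrier (A ^ n) = ideal_power (carrier A) n"
  by (induction n) (simp_all add: carrier_1 carrier_mult)

lemma ideal_zero_le [simp]: "0 \<le> (A :: 'a::comm_ring_1 ideal)"
  by (simp add: less_eq_ideal_def carrier_0)

lemma ideal_le_one [simp]: "(A :: 'a::comm_ring_1 ideal) \<le> 1"
  by (simp add: less_eq_ideal_def carrier_1)

lemma ideal_mult_mono: "A \<le> B \<Longrightarrow> C \<le> D \<Longrightarrow> A * C \<le> B * (D :: 'a::comm_ring_1 ideal)"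
  by (intro mult_mono) auto

lemma ideal_pow_mono: "A \<le> B \<Longrightarrow> A ^ n \<le> (B :: 'a::comm_ring_1 ideal) ^ n"
  by (induction n) (auto intro: ideal_mult_mono)

lemma ideal_le_add1: "A \<le> A + (B :: 'a::comm_ring_1 ideal)"
  using add_left_mono[of 0 B A] by simp

lemma ideal_le_add2: "B \<le> A + (B :: 'a::comm_ring_1 ideal)"
  using ideal_le_add1[of B A] by (simp add: add.commute)

lemma ideal_add_le: "A \<le> C \<Longrightarrow> B \<le> C \<Longrightarrow> A + B \<le> (C :: 'a::comm_ring_1 ideal)"
  unfolding less_eq_ideal_def carrier_add using carrier_add_mem by blast

lemma ideal_le_addI1: "A \<le> B \<Longrightarrow> A \<le> B + (C :: 'a::comm_ring_1 ideal)"
  using ideal_le_add1 order_trans by blast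

lemma ideal_le_addI2: "A \<le> C \<Longrightarrow> A \<le> B + (C :: 'a::comm_ring_1 ideal)"
  using ideal_le_add2 order_trans by blast

lemma ideal_pow_antimono: "m \<le> n \<Longrightarrow> A ^ n \<le> (A :: 'a::comm_ring_1 ideal) ^ m"
  unfolding less_eq_ideal_def carrier_power by (rule ideal_power_mono)

definition principal :: "'a::comm_ring_1 \<Rightarrow> 'a ideal" where
  "principal c = Ideal (range ((*) c))"

lemma carrier_principal: "carrier (principal c) = range ((*) c)"
  unfolding principal_def by (subst Ideal_inverse) auto

lemma principal_le_iff: "principal c \<le> A \<longleftrightarrow> c \<in> carrier A"
proof
  assume "principal c \<le> A"
  moreover have "c * 1 \<in> carrier (principal c)" unfolding carrier_principal by blast
  ultimately show "c \<in> carrier A" by (auto simp: less_eq_ideal_def)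
next
  assume "c \<in> carrier A"
  then show "principal c \<le> A"
    using carrier_mult_left[of c A] by (auto simp: less_eq_ideal_def carrier_principal mult.commute)
qed

lemma carrier_principal_mult: "carrier (principal c * A) = (*) c ` carrier A"
  unfolding carrier_mult carrier_principal
  by (rule comm_module.smult_principal[OF comm_module_mult subspace_carrier])

lemma principal_mult: "principal (a * b) = principal a * principal b"
  unfolding carrier_inject[symmetric] carrier_principal_mult carrier_principal
  by (auto simp: image_iff mult.assoc)

lemma principal_1: "principal 1 = 1"
  unfolding carrier_inject[symmetric] carrier_principal carrier_1 by auto

lemma principal_power: "principal (a ^ n) = principal a ^ n"
  by (induction n) (simp_all add: principal_1 principal_mult)

lemma principal_mono_power: "principal a \<le> I ^ d \<Longrightarrow> principal (a ^ k) \<le> I ^ (d * k)"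
  using ideal_pow_mono[of "principal a" "I ^ d" k] by (simp add: principal_power power_mult)

lemma ideal_eq_span:
  assumes "carrier I = module.span (*) (insert b F)"
    and "carrier T = module.span (*) F"
  shows "I = T + principal b"
proof -
  have "carrier I = module.span (*) (F \<union> {b})" using assms(1) by simp
  also have "\<dots> = carrier (T + principal b)"
    unfolding module.span_Un[OF module_mult] carrier_add assms(2)[symmetric]
      module.span_singleton[OF module_mult] carrier_principal
    by (auto simp: mult.commute)
  finally show ?thesis by (simp add: carrier_inject)
qed

section \<open>Binomial estimates for powers of ideals\<close>

text \<open>The summand \<open>principal a * I ^ s\<close> lies in I^(s+d), the other one is of
  order one higher. Every product other than the pure power of the first summand therefore gains at
  least one degree.\<close>

lemma principal_add_power_le:
  assumes "principal a \<le> I ^ d"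
  shows "(principal a * I ^ s + I ^ (s + d + 1)) ^ k
    \<le> principal (a ^ k) * I ^ (s * k) + I ^ ((s + d) * k + 1)"
proof (induction k)
  case 0
  show ?case by (intro ideal_le_addI1) (simp add: principal_1)
next
  case (Suc k)
  let ?e = "(s + d) * Suc k + 1"
  have "principal a * I ^ s * I ^ ((s + d) * k + 1) \<le> I ^ d * I ^ s * I ^ ((s + d) * k + 1)"
    by (intro ideal_mult_mono assms order_refl)
  also have "\<dots> = I ^ ?e" by (simp flip: power_add add: algebra_simps)
  finally have 1: "principal a * I ^ s * I ^ ((s + d) * k + 1) \<le> I ^ ?e" .
  have "I ^ (s + d + 1) * (principal (a ^ k) * I ^ (s * k)) \<le> I ^ (s + d + 1) * (I ^ (d * k) * I ^ (s * k))"
    by (intro ideal_mult_mono principal_mono_power assms order_refl)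
  also have "\<dots> = I ^ ?e" by (simp flip: power_add add: algebra_simps)
  finally have 2: "I ^ (s + d + 1) * (principal (a ^ k) * I ^ (s * k)) \<le> I ^ ?e" .
  have 3: "I ^ (s + d + 1) * I ^ ((s + d) * k + 1) \<le> I ^ ?e"
    unfolding power_add[symmetric] by (rule ideal_pow_antimono) (simp add: algebra_simps)
  have "(principal a * I ^ s + I ^ (s + d + 1)) ^ Suc k
      \<le> (principal a * I ^ s + I ^ (s + d + 1)) *
        (principal (a ^ k) * I ^ (s * k) + I ^ ((s + d) * k + 1))"
    unfolding power_Suc using Suc by (intro ideal_mult_mono order_refl)
  also have "\<dots> = principal (a ^ Suc k) * I ^ (s * Suc k) +
      (principal a * I ^ s * I ^ ((s + d) * k + 1) +
      (I ^ (s + d + 1) * (principal (a ^ k) * I ^ (s * k)) + I ^ (s + d + 1) * I ^ ((s + d) * k + 1)))"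
    by (simp add: principal_power principal_mult power_add distrib_left distrib_right ac_simps)
  also have "\<dots> \<le> principal (a ^ Suc k) * I ^ (s * Suc k) + I ^ ?e"
    by (intro add_left_mono ideal_add_le 1 2 3)
  finally show ?case .
qed

text \<open>Pigeonhole: a product of p + q factors from \<open>S\<close> and \<open>T\<close>
  contains \<open>p\<close> factors from \<open>S\<close> or \<open>q\<close> from \<open>T\<close>;
  the other factors are only recorded as lying in \<open>I\<close>.\<close>

lemma add_power_le:
  fixes S T :: "'a::comm_ring_1 ideal"
  assumes "S \<le> I" "T \<le> I"
  shows "(S + T) ^ (p + q) \<le> S ^ p * I ^ q + T ^ q * I ^ p"
proof (induction "p + q" arbitrary: p q)
  case 0
  then show ?case using ideal_le_add1[of 1 1] by simp
next
  case (Suc n)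
  have ST: "S + T \<le> I" using assms by (rule ideal_add_le)
  show ?case
  proof (cases "p = 0 \<or> q = 0")
    case True
    then have "(S + T) ^ (p + q) \<le> S ^ p * I ^ q \<or> (S + T) ^ (p + q) \<le> T ^ q * I ^ p"
      using ideal_pow_mono[OF ST, of "p + q"] by auto
    then show ?thesis using ideal_le_addI1 ideal_le_addI2 by blast
  next
    case False
    then obtain p' q' where pq: "p = Suc p'" "q = Suc q'" by (meson not0_implies_Suc)
    have IH1: "(S + T) ^ (p' + q) \<le> S ^ p' * I ^ q + T ^ q * I ^ p'"
      and IH2: "(S + T) ^ (p + q') \<le> S ^ p * I ^ q' + T ^ q' * I ^ p"
      using Suc.hyps(1)[of p' q] Suc.hyps(1)[of p q'] Suc.hyps(2) pq by auto
    have "(S + T) ^ (p + q) = S * (S + T) ^ (p' + q) + T * (S + T) ^ (p + q')"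
      by (simp add: pq distrib_right)
    also have "\<dots> \<le> S * (S ^ p' * I ^ q + T ^ q * I ^ p') + T * (S ^ p * I ^ q' + T ^ q' * I ^ p)"
      by (intro add_mono ideal_mult_mono IH1 IH2 order_refl)
    also have "\<dots> = (S ^ p * I ^ q + S * (T ^ q * I ^ p')) + (T * (S ^ p * I ^ q') + T ^ q * I ^ p)"
      by (simp add: pq distrib_left ac_simps)
    also have "\<dots> \<le> S ^ p * I ^ q + T ^ q * I ^ p"
    proof (intro ideal_add_le ideal_le_add1 ideal_le_add2)
      have "S * (T ^ q * I ^ p') \<le> I * (T ^ q * I ^ p')"
        by (intro ideal_mult_mono assms order_refl)
      then show "S * (T ^ q * I ^ p') \<le> S ^ p * I ^ q + T ^ q * I ^ p"
        by (intro ideal_le_addI2) (simp add: pq ac_simps)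
      have "T * (S ^ p * I ^ q') \<le> I * (S ^ p * I ^ q')"
        by (intro ideal_mult_mono assms order_refl)
      then show "T * (S ^ p * I ^ q') \<le> S ^ p * I ^ q + T ^ q * I ^ p"
        by (intro ideal_le_addI1) (simp add: pq ac_simps)
    qed
    finally show ?thesis .
  qed
qed

text \<open>All products but the pure power of \<open>Y\<close> contain a factor from
  \<open>C\<close>, and each of the \<open>m\<close> remaining factors lies in I^d.\<close>

lemma add_power_Suc_le:
  fixes C Y :: "'a::comm_ring_1 ideal"
  assumes "C \<le> I ^ d" "Y \<le> I ^ d"
  shows "(C + Y) ^ Suc m \<le> C * I ^ (d * m) + Y ^ Suc m"
proof (induction m)
  case (Suc m)
  have "(C + Y) ^ Suc (Suc m) = C * (C + Y) ^ Suc m + Y * (C + Y) ^ Suc m"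
    by (simp add: distrib_right)
  also have "\<dots> \<le> C * (I ^ d) ^ Suc m + Y * (C * I ^ (d * m) + Y ^ Suc m)"
    by (intro add_mono ideal_mult_mono Suc ideal_pow_mono ideal_add_le assms order_refl)
  also have "\<dots> = C * I ^ (d * Suc m) + (C * (Y * I ^ (d * m)) + Y ^ Suc (Suc m))"
    by (simp add: distrib_left power_add power_mult ac_simps)
  also have "\<dots> \<le> C * I ^ (d * Suc m) + Y ^ Suc (Suc m)"
  proof (intro ideal_add_le ideal_le_add1 ideal_le_add2)
    have "C * (Y * I ^ (d * m)) \<le> C * (I ^ d * I ^ (d * m))"
      by (intro ideal_mult_mono assms order_refl)
    then show "C * (Y * I ^ (d * m)) \<le> C * I ^ (d * Suc m) + Y ^ Suc (Suc m)"
      by (intro ideal_le_addI1) (simp add: power_add)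
  qed
  finally show ?case .
qed simp

section \<open>Reductions of powers of an ideal\<close>

text \<open>The colengths \<open>\<rho> n\<close> of the \<open>a\<close>-torsion in degree \<open>n\<close> of the associated graded ring are
  bounded, and multiplication by \<open>a\<close> shows \<open>\<rho> n \<le> \<rho> (n + d)\<close>. Hence they are eventually
  periodic, and then multiplication by \<open>a\<close> is onto modulo torsion.\<close>

lemma eventually_divisible_modulo_torsion:
  fixes I :: "'a::comm_ring_1 set"
  assumes bound: "\<And>n. quotient_length (*) (ideal_power I n) (ideal_power I (Suc n)) \<le> enat e"
    and a: "a \<in> ideal_power I d"
  obtains n0 where "\<And>n v. n \<ge> n0 \<Longrightarrow> v \<in> ideal_power I (n + d) \<Longrightarrow>
    \<exists>u\<in>ideal_power I n. \<exists>k. a ^ k * (v - a * u) \<in> ideal_power I (n + d + d * k + 1)"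
proof -
  interpret R: comm_module "(*) :: 'a \<Rightarrow> 'a \<Rightarrow> 'a" by (rule comm_module_mult)
  let ?I = "ideal_power I"
  have I: "R.subspace (?I n)" for n using ring_ideal_power unfolding ring_ideal_def .
  \<comment> \<open>\<open>K n\<close> is the preimage in I^n of the \<open>a\<close>-torsion of
    degree \<open>n\<close>: in the associated graded ring, a product vanishes exactly if its order
    exceeds the sum of the degrees.\<close>
  define K where "K n = {z \<in> ?I n. \<exists>k. a ^ k * z \<in> ?I (n + d * k + 1)}" for n
  have raise: "a ^ (k + j) * z \<in> ?I (n + d * (k + j) + 1)" if "a ^ k * z \<in> ?I (n + d * k + 1)" for n k j z
  proof -
    have "a ^ j * (a ^ k * z) \<in> ?I (d * j + (n + d * k + 1))"
      by (rule mult_in_ideal_power_add[OF power_in_ideal_power[OF a] that])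
    moreover have "d * j + (n + d * k + 1) = n + d * (k + j) + 1" by (simp add: algebra_simps)
    moreover have "a ^ j * (a ^ k * z) = a ^ (k + j) * z" by (simp only: power_add ac_simps)
    ultimately show ?thesis by metis
  qed
  have K: "R.subspace (K n)" for n
  proof (rule R.subspaceI)
    show "0 \<in> K n" using R.subspace_0[OF I] by (simp add: K_def del: ideal_power.simps)
    show "x + y \<in> K n" if xy: "x \<in> K n" "y \<in> K n" for x y
    proof -
      obtain k j where "a ^ k * x \<in> ?I (n + d * k + 1)" "a ^ j * y \<in> ?I (n + d * j + 1)"
        using xy by (auto simp: K_def)
      then have "a ^ (k + j) * x \<in> ?I (n + d * (k + j) + 1)" "a ^ (j + k) * y \<in> ?I (n + d * (j + k) + 1)"
        using raise by blast+
      then have "a ^ (k + j) * (x + y) \<in> ?I (n + d * (k + j) + 1)"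
        unfolding distrib_left by (subst R.subspace_add[OF I]) (simp_all add: add.commute)
      then show ?thesis using xy R.subspace_add[OF I] unfolding K_def by blast
    qed
    show "c * x \<in> K n" if x: "x \<in> K n" for c x
    proof -
      obtain k where "a ^ k * x \<in> ?I (n + d * k + 1)" using x by (auto simp: K_def)
      then have "c * (a ^ k * x) \<in> ?I (n + d * k + 1)" using R.subspace_scale[OF I] by blast
      then have "a ^ k * (c * x) \<in> ?I (n + d * k + 1)" by (simp only: mult.left_commute)
      then show ?thesis using x R.subspace_scale[OF I] unfolding K_def by blast
    qed
  qed
  have KI: "K n \<subseteq> ?I n" for n by (auto simp: K_def)
  have IK: "?I (Suc n) \<subseteq> K n" for n
    using ideal_power_mono[of n "Suc n" I] by (auto simp: K_def intro!: exI[of _ 0])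
  define \<rho> where "\<rho> n = the_enat (R.len (?I n) (K n))" for n
  have bd: "R.len (?I n) (K n) \<le> enat e" for n
    using R.len_mono_lower[OF I K I IK KI, of n] bound[of n] by (rule order_trans)
  have \<rho>: "R.len (?I n) (K n) = enat (\<rho> n)" "\<rho> n \<le> e" for n
    using bd[of n] unfolding \<rho>_def by (cases "R.len (?I n) (K n)"; simp)+
  have img: "a * u \<in> ?I (n + d)" if "u \<in> ?I n" for u n
    using mult_in_ideal_power_add[OF a that] by (simp add: add.commute)
  have imgK: "a * z \<in> K (n + d)" if z: "z \<in> K n" for z n
  proof -
    obtain k where "a ^ k * z \<in> ?I (n + d * k + 1)" using z by (auto simp: K_def)
    then have "a ^ (k + 1) * z \<in> ?I (n + d * (k + 1) + 1)" by (rule raise)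
    moreover have "a ^ (k + 1) * z = a ^ k * (a * z)" by (simp only: power_add power_one_right ac_simps)
    moreover have "n + d * (k + 1) + 1 = n + d + d * k + 1" by simp
    ultimately have "a ^ k * (a * z) \<in> ?I (n + d + d * k + 1)" by metis
    then show ?thesis using img[of z n] z unfolding K_def by blast
  qed
  have inj: "z \<in> K n" if z: "z \<in> ?I n" "a * z \<in> K (n + d)" for z n
  proof -
    obtain k where "a ^ k * (a * z) \<in> ?I (n + d + d * k + 1)" using z by (auto simp: K_def)
    moreover have "a ^ k * (a * z) = a ^ Suc k * z" by (simp only: power_Suc ac_simps)
    moreover have "n + d + d * k + 1 = n + d * Suc k + 1" by simp
    ultimately have "a ^ Suc k * z \<in> ?I (n + d * Suc k + 1)" by metis
    then show ?thesis using z unfolding K_def by blast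
  qed
  have le: "R.len (?I n) (K n) \<le> R.len S (K (n + d))"
    if "R.subspace S" "K (n + d) \<subseteq> S" "(*) a ` ?I n \<subseteq> S" for n S
    using that by (intro R.len_le_of_inj[OF R.module_hom_scale[of a]] K I KI) (auto intro: imgK inj)
  have mono: "\<rho> n \<le> \<rho> (n + d)" for n
    using le[OF I KI, of n] img[of _ n] by (auto simp: \<rho>)
  \<comment> \<open>The sequence \<open>\<rho>\<close> only grows in steps of \<open>d\<close>. The
    sum over a window of length \<open>d\<close> changes by \<rho> (n + d) - \<rho> n when the
    window moves by one, so it is increasing in the ordinary sense, and once it is constant, so is
    \<rho> along steps of \<open>d\<close>.\<close>
  define \<sigma> where "\<sigma> n = (\<Sum>i<d. \<rho> (n + i))" for n
  have \<sigma>: "\<sigma> (Suc n) + \<rho> n = \<sigma> n + \<rho> (n + d)" for n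
    using sum.lessThan_Suc[of "\<lambda>i. \<rho> (n + i)" d] sum.lessThan_Suc_shift[of "\<lambda>i. \<rho> (n + i)" d]
    by (simp add: \<sigma>_def)
  have "\<sigma> n \<le> \<sigma> (Suc n)" for n using \<sigma>[of n] mono[of n] by linarith
  moreover have "\<sigma> n \<le> d * e" for n
    using sum_bounded_above[of "{..<d}" "\<lambda>i. \<rho> (n + i)" e] \<rho>(2) by (simp add: \<sigma>_def)
  ultimately obtain N where N: "\<And>n. n \<ge> N \<Longrightarrow> \<sigma> n = \<sigma> N"
    using bounded_incseq_nat_eventually_const by metis
  have "\<exists>u\<in>?I n. \<exists>k. a ^ k * (v - a * u) \<in> ?I (n + d + d * k + 1)"
    if n: "n \<ge> N" and v: "v \<in> ?I (n + d)" for n v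
  proof -
    have eq: "\<rho> (n + d) = \<rho> n" using \<sigma>[of n] N[of n] N[of "Suc n"] n by simp
    \<comment> \<open>The image of \<open>a\<close> together with the torsion. Injectivity modulo
      torsion gives S / K (n + d) length at least \<rho> n = \<rho> (n + d), which leaves no room
      below I^(n+d).\<close>
    define S where "S = {x + y | x y. x \<in> (*) a ` ?I n \<and> y \<in> K (n + d)}"
    have S: "R.subspace S"
      unfolding S_def by (intro R.subspace_set_sum R.subspace_scale_image I K)
    have KS: "K (n + d) \<subseteq> S"
    proof
      fix y assume "y \<in> K (n + d)"
      then have "a * 0 + y \<in> S" using R.subspace_0[OF I[of n]] unfolding S_def by blast
      then show "y \<in> S" by simp
    qed
    have aS: "(*) a ` ?I n \<subseteq> S"
    proof
      fix x assume "x \<in> (*) a ` ?I n"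
      then have "x + 0 \<in> S" using R.subspace_0[OF K[of "n + d"]] unfolding S_def by blast
      then show "x \<in> S" by simp
    qed
    have SI: "S \<subseteq> ?I (n + d)"
      unfolding S_def using R.subspace_add[OF I] img KI by blast
    have "?I (n + d) = S"
      using le[OF S KS aS] R.len_mono_upper[OF K S I KS SI]
      by (intro R.len_eq_upper_imp_eq[OF K S I KS SI]) (auto simp: \<rho> eq)
    then obtain u y where u: "u \<in> ?I n" "y \<in> K (n + d)" "v = a * u + y"
      using v unfolding S_def by auto
    then obtain k where "a ^ k * y \<in> ?I (n + d + d * k + 1)" by (auto simp: K_def)
    moreover have "y = v - a * u" using u by simp
    ultimately show ?thesis using u(1) by blast
  qed
  then show ?thesis using that by blast
qed

text \<open>In degree \<open>d\<close>, the form \<open>c\<close> lies in the ideal generated by \<open>T\<close>, and \<open>T\<close> is nilpotent modulo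
  \<open>c\<close> in the associated graded ring: \<open>c\<close> and \<open>T\<close> have the same zeros on its projective spectrum.\<close>

definition same_zeros :: "'a::comm_ring_1 ideal \<Rightarrow> 'a ideal \<Rightarrow> 'a \<Rightarrow> nat \<Rightarrow> bool" where
  "same_zeros I T c d \<longleftrightarrow> principal c \<le> T * I ^ (d - 1) \<and>
     (\<exists>p q s. p + q = s + d \<and> T ^ p * I ^ q \<le> principal c * I ^ s + I ^ (s + d + 1))"

text \<open>Where \<open>a\<^sub>0\<close> does not vanish, the torsion element \<open>z\<close> does, and \<open>c\<close> is \<open>a\<close>; on the zeros of
  \<open>T\<close>, where \<open>a\<close> and \<open>a\<^sub>0\<close> vanish, \<open>c\<close> is \<open>b\<^sup>d\<close>.\<close>

lemma same_zeros_step: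
  fixes I T :: "'a::comm_ring_1 ideal"
  assumes T: "T \<le> I" and b: "b \<in> carrier I"
    and a0: "same_zeros I T a0 d0" and a: "same_zeros I T a d"
    and d: "0 < d0" "d0 \<le> d" and u: "u \<in> carrier (I ^ (d - d0))"
    and z: "a0 ^ k * (b ^ d - a0 * u) \<in> carrier (I ^ (d + d0 * k + 1))"
  shows "same_zeros I (T + principal b) (a + (b ^ d - a0 * u)) d"
proof -
  define z' where "z' = b ^ d - a0 * u"
  define c where "c = a + z'"
  have bI: "principal b \<le> I" using b by (simp add: principal_le_iff)
  have aT: "principal a \<le> T * I ^ (d - 1)" and a0T: "principal a0 \<le> T * I ^ (d0 - 1)"
    using a a0 by (auto simp: same_zeros_def)
  have TI: "T * I ^ (j - 1) \<le> I ^ j" if "0 < j" for j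
    using ideal_mult_mono[OF T order_refl, of "I ^ (j - 1)"] that by (simp flip: power_Suc)
  have aI: "principal a \<le> I ^ d" and a0I: "principal a0 \<le> I ^ d0"
    using aT a0T TI[of d] TI[of d0] d by auto
  have a0u: "a0 * u \<in> carrier (T * I ^ (d - 1))"
  proof -
    have "principal (a0 * u) \<le> T * I ^ (d0 - 1) * I ^ (d - d0)"
      unfolding principal_mult using u by (intro ideal_mult_mono a0T) (simp add: principal_le_iff)
    also have "\<dots> = T * I ^ (d - 1)" using d by (simp add: mult.assoc flip: power_add)
    finally show ?thesis by (simp add: principal_le_iff)
  qed
  have bd: "b ^ d \<in> carrier (principal b * I ^ (d - 1))"
  proof -
    have "principal (b ^ d) = principal b * principal b ^ (d - 1)"
      using d by (simp add: principal_power flip: power_Suc)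
    also have "\<dots> \<le> principal b * I ^ (d - 1)" by (intro ideal_mult_mono ideal_pow_mono bI order_refl)
    finally show ?thesis by (simp add: principal_le_iff)
  qed
  have neg: "- x \<in> carrier A" if "x \<in> carrier A" for x :: 'a and A
    using carrier_mult_left[OF that, of "-1"] by simp
  have cTb: "principal c \<le> (T + principal b) * I ^ (d - 1)"
  proof -
    have "a + (- (a0 * u)) \<in> carrier (T * I ^ (d - 1))"
      using aT a0u by (intro carrier_add_mem neg) (auto simp: principal_le_iff)
    then have "(a + (- (a0 * u))) + b ^ d \<in> carrier (T * I ^ (d - 1) + principal b * I ^ (d - 1))"
      unfolding carrier_add[of "T * I ^ (d - 1)"] using bd by blast
    then show ?thesis by (simp add: principal_le_iff c_def z'_def distrib_right algebra_simps)
  qed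
  have cI: "principal c \<le> I ^ d"
    using cTb TI[of d] ideal_mult_mono[OF ideal_add_le[OF T bI] order_refl, of "I ^ (d - 1)"] d
    by (auto simp flip: power_Suc)
  obtain p q s where
    pq: "p + q = s + d" "T ^ p * I ^ q \<le> principal a * I ^ s + I ^ (s + d + 1)"
    using a by (auto simp: same_zeros_def)
  obtain p0 q0 s0 where
    pq0: "p0 + q0 = s0 + d0" "T ^ p0 * I ^ q0 \<le> principal a0 * I ^ s0 + I ^ (s0 + d0 + 1)"
    using a0 by (auto simp: same_zeros_def)
  \<comment> \<open>The exponents that arise when the inequality for \<open>a\<close> is multiplied
    by the \<open>k\<close>-th power of the one for \<open>a0\<close>; \<open>k\<close> is the power
    of \<open>a0\<close> that kills \<open>z'\<close> in the associated graded ring.\<close>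
  define P Q S where "P = p + p0 * k" and "Q = q + q0 * k" and "S = s + (s0 + d0) * k"
  have PQ: "P + Q = S + d"
  proof -
    have "P + Q = (p + q) + (p0 + q0) * k" by (simp add: P_def Q_def algebra_simps)
    then show ?thesis by (simp add: pq(1) pq0(1) S_def algebra_simps)
  qed
  have prod: "principal (a * a0 ^ k) * I ^ (s + s0 * k) \<le> principal c * I ^ S + I ^ (S + d + 1)"
  proof -
    \<comment> \<open>Since a0^k z' has order higher than its degree, \<open>a\<close> may be
      replaced by \<open>c\<close> in the leading term a a0^k. This is how \<open>T\<close> becomes
      nilpotent modulo \<open>c\<close>.\<close>
    have "a * a0 ^ k = c * a0 ^ k + - (a0 ^ k * z')" by (simp add: c_def algebra_simps)
    moreover have "c * a0 ^ k \<in> carrier (principal (c * a0 ^ k))"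
      "- (a0 ^ k * z') \<in> carrier (I ^ (d + d0 * k + 1))"
      using z neg by (auto simp: z'_def simp flip: principal_le_iff)
    ultimately have "principal (a * a0 ^ k) \<le> principal (c * a0 ^ k) + I ^ (d + d0 * k + 1)"
      unfolding principal_le_iff carrier_add by blast
    also have "\<dots> \<le> principal c * I ^ (d0 * k) + I ^ (d + d0 * k + 1)"
      unfolding principal_mult
      by (intro add_right_mono ideal_mult_mono principal_mono_power a0I order_refl)
    finally have "principal (a * a0 ^ k) * I ^ (s + s0 * k) \<le>
        (principal c * I ^ (d0 * k) + I ^ (d + d0 * k + 1)) * I ^ (s + s0 * k)"
      by (intro ideal_mult_mono order_refl)
    also have "\<dots> = principal c * I ^ (d0 * k + (s + s0 * k)) + I ^ (d + d0 * k + 1 + (s + s0 * k))"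
      by (simp add: distrib_left distrib_right power_add ac_simps)
    also have "d0 * k + (s + s0 * k) = S" by (simp add: S_def algebra_simps)
    also have "d + d0 * k + 1 + (s + s0 * k) = S + d + 1" by (simp add: S_def algebra_simps)
    finally show ?thesis .
  qed
  have nil: "T ^ P * I ^ Q \<le> principal c * I ^ S + I ^ (S + d + 1)"
  proof -
    have "T ^ P * I ^ Q = (T ^ p * I ^ q) * (T ^ p0 * I ^ q0) ^ k"
      unfolding P_def Q_def power_add power_mult power_mult_distrib by (simp only: ac_simps)
    also have "\<dots> \<le> (principal a * I ^ s + I ^ (s + d + 1)) *
        (principal a0 * I ^ s0 + I ^ (s0 + d0 + 1)) ^ k"
      by (intro ideal_mult_mono ideal_pow_mono pq pq0)
    also have "\<dots> \<le> (principal a * I ^ s + I ^ (s + d + 1)) *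
        (principal (a0 ^ k) * I ^ (s0 * k) + I ^ ((s0 + d0) * k + 1))"
      by (intro ideal_mult_mono principal_add_power_le a0I order_refl)
    also have "\<dots> = principal (a * a0 ^ k) * I ^ (s + s0 * k) +
        (principal a * I ^ s * I ^ ((s0 + d0) * k + 1) +
         (I ^ (s + d + 1) * (principal (a0 ^ k) * I ^ (s0 * k)) +
          I ^ (s + d + 1) * I ^ ((s0 + d0) * k + 1)))"
      by (simp add: principal_mult power_add distrib_left distrib_right ac_simps)
    also have "\<dots> \<le> principal c * I ^ S + I ^ (S + d + 1)"
    proof (intro ideal_add_le prod)
      have "principal a * I ^ s * I ^ ((s0 + d0) * k + 1) \<le> I ^ d * I ^ s * I ^ ((s0 + d0) * k + 1)"
        by (intro ideal_mult_mono aI order_refl)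
      also have "\<dots> = I ^ (S + d + 1)" by (simp add: S_def algebra_simps flip: power_add)
      finally show "principal a * I ^ s * I ^ ((s0 + d0) * k + 1) \<le> principal c * I ^ S + I ^ (S + d + 1)"
        by (rule ideal_le_addI2)
      have "I ^ (s + d + 1) * (principal (a0 ^ k) * I ^ (s0 * k)) \<le>
          I ^ (s + d + 1) * (I ^ (d0 * k) * I ^ (s0 * k))"
        by (intro ideal_mult_mono principal_mono_power a0I order_refl)
      also have "\<dots> = I ^ (S + d + 1)" by (simp add: S_def algebra_simps flip: power_add)
      finally show "I ^ (s + d + 1) * (principal (a0 ^ k) * I ^ (s0 * k)) \<le>
          principal c * I ^ S + I ^ (S + d + 1)"
        by (rule ideal_le_addI2)
      show "I ^ (s + d + 1) * I ^ ((s0 + d0) * k + 1) \<le> principal c * I ^ S + I ^ (S + d + 1)"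
        unfolding power_add[symmetric]
        by (intro ideal_le_addI2 ideal_pow_antimono) (simp add: S_def algebra_simps)
    qed
    finally show ?thesis .
  qed
  \<comment> \<open>Modulo \<open>T\<close>, the form \<open>c\<close> is just
    \<open>b ^ d\<close>.\<close>
  have bd_le: "principal (b ^ d) \<le> principal c + T * I ^ (d - 1)"
  proof -
    have "b ^ d = c + (a0 * u + - a)" by (simp add: c_def z'_def)
    moreover have "c \<in> carrier (principal c)" by (simp flip: principal_le_iff)
    moreover have "a0 * u + - a \<in> carrier (T * I ^ (d - 1))"
      using aT a0u by (intro carrier_add_mem neg) (auto simp: principal_le_iff)
    ultimately show ?thesis unfolding principal_le_iff carrier_add by blast
  qed
  \<comment> \<open>So many factors \<open>b\<close> make up \<open>Suc P\<close> copies of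
    \<open>b ^ d\<close>, each replaced by \<open>c\<close> plus an element of T I^(d-1). What is
    free of \<open>c\<close> then has \<open>Suc P\<close> factors from \<open>T\<close>, enough for
    nilpotency. A positive exponent is needed to split off a factor \<open>c\<close>.\<close>
  define R where "R = d * Suc P"
  have T_part: "T ^ Suc P * I ^ Q * I ^ R \<le> principal c * I ^ (Suc S + R) + I ^ (Suc S + R + d + 1)"
  proof -
    have "T ^ Suc P * I ^ Q * I ^ R = (T ^ P * I ^ Q) * (T * I ^ R)" by (simp add: ac_simps)
    also have "\<dots> \<le> (principal c * I ^ S + I ^ (S + d + 1)) * (I * I ^ R)"
      by (intro ideal_mult_mono nil T order_refl)
    also have "\<dots> = principal c * I ^ (Suc S + R) + I ^ (Suc S + R + d + 1)"
      by (simp add: distrib_left distrib_right power_add ac_simps)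
    finally show ?thesis .
  qed
  have "(T + principal b) ^ (Suc P + R) * I ^ Q
      \<le> (T ^ Suc P * I ^ R + principal b ^ R * I ^ Suc P) * I ^ Q"
    by (intro ideal_mult_mono add_power_le T bI order_refl)
  also have "\<dots> = T ^ Suc P * I ^ Q * I ^ R + principal (b ^ d) ^ Suc P * I ^ (Suc P + Q)"
    by (simp only: distrib_left distrib_right power_add R_def power_mult principal_power ac_simps)
  also have "\<dots> \<le> principal c * I ^ (Suc S + R) + I ^ (Suc S + R + d + 1)"
  proof (intro ideal_add_le T_part)
    have "principal (b ^ d) ^ Suc P * I ^ (Suc P + Q) \<le>
        (principal c + T * I ^ (d - 1)) ^ Suc P * I ^ (Suc P + Q)"
      by (intro ideal_mult_mono ideal_pow_mono bd_le order_refl)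
    also have "\<dots> \<le> (principal c * I ^ (d * P) + (T * I ^ (d - 1)) ^ Suc P) * I ^ (Suc P + Q)"
      using TI[of d] d by (intro ideal_mult_mono add_power_Suc_le cI order_refl) auto
    also have "\<dots> = principal c * I ^ (d * P + (Suc P + Q)) +
        T ^ Suc P * I ^ Q * I ^ ((d - 1) * Suc P + Suc P)"
      unfolding distrib_right power_add power_mult_distrib power_mult by (simp only: ac_simps)
    also have "d * P + (Suc P + Q) = Suc S + R" using PQ by (simp add: R_def)
    also have "(d - 1) * Suc P + Suc P = R"
      using d by (cases d) (auto simp: R_def)
    also have "principal c * I ^ (Suc S + R) + T ^ Suc P * I ^ Q * I ^ R
        \<le> principal c * I ^ (Suc S + R) + I ^ (Suc S + R + d + 1)"
      by (intro ideal_add_le ideal_le_add1 T_part)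
    finally show "principal (b ^ d) ^ Suc P * I ^ (Suc P + Q) \<le>
        principal c * I ^ (Suc S + R) + I ^ (Suc S + R + d + 1)" .
  qed
  finally have "(T + principal b) ^ (Suc P + R) * I ^ Q
      \<le> principal c * I ^ (Suc S + R) + I ^ (Suc S + R + d + 1)" .
  moreover have "(Suc P + R) + Q = (Suc S + R) + d" using PQ by simp
  ultimately show ?thesis
    using cTb unfolding same_zeros_def c_def z'_def by blast
qed

text \<open>Generators are adjoined one at a time. All large degrees are covered at once because the
  step uses two forms for the old \<open>T\<close>: \<open>a0\<close> of a fixed degree, by which
  \<open>b ^ d\<close> is divided up to torsion, and \<open>a\<close> of the degree \<open>d\<close>
  in question.\<close>

lemma exists_same_zeros:
  fixes I :: "'a::comm_ring_1 ideal"
  assumes bound: "\<And>n. quotient_length (*) (carrier (I ^ n)) (carrier (I ^ Suc n)) \<le> enat e"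
    and F: "finite F" "F \<subseteq> carrier I"
  shows "\<exists>d0>0. \<forall>d\<ge>d0. \<exists>c. same_zeros I (Ideal (module.span (*) F)) c d"
  using F
proof (induction F rule: finite_induct)
  case empty
  have "Ideal (module.span (*) {}) = (0 :: 'a ideal)"
    by (simp add: zero_ideal_def module.span_empty[OF module_mult])
  \<comment> \<open>For \<open>T = 0\<close> the zero form works, and a positive \<open>d\<close>
    makes the \<open>d\<close>-th power of the zero ideal vanish.\<close>
  moreover have "same_zeros I 0 0 d" if "d > 0" for d
  proof -
    have "(0 :: 'a ideal) ^ d * I ^ 0 \<le> principal 0 * I ^ 0 + I ^ (0 + d + 1)"
      using that by (simp add: power_0_left)
    then have "\<exists>p q s. p + q = s + d \<and> (0 :: 'a ideal) ^ p * I ^ q \<le> principal 0 * I ^ s + I ^ (s + d + 1)"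
      by (intro exI[of _ d] exI[of _ 0] exI[of _ 0]) simp
    then show ?thesis unfolding same_zeros_def by (simp add: principal_le_iff)
  qed
  ultimately show ?case by (intro exI[of _ "1 :: nat"] conjI allI impI exI[of _ "0 :: 'a"]) auto
next
  case (insert b F)
  define T :: "'a ideal" where "T = Ideal (module.span (*) F)"
  have carr: "carrier (Ideal (module.span (*) G)) = module.span (*) G" for G :: "'a set"
    by (rule Ideal_inverse) (simp add: ring_ideal_def module.subspace_span[OF module_mult])
  have Tb: "Ideal (module.span (*) (insert b F)) = T + principal b"
    unfolding T_def by (rule ideal_eq_span) (simp_all add: carr)
  have TI: "T \<le> I"
    using insert.prems module.span_minimal[OF module_mult, of F "carrier I"]
    by (simp add: less_eq_ideal_def T_def carr)
  obtain d0 where d0: "d0 > 0" "\<And>d. d \<ge> d0 \<Longrightarrow> \<exists>c. same_zeros I T c d"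
    using insert.IH insert.prems unfolding T_def by auto
  then obtain a0 where a0: "same_zeros I T a0 d0" by blast
  have "a0 \<in> carrier (I ^ d0)"
  proof -
    have "principal a0 \<le> T * I ^ (d0 - 1)" using a0 by (simp add: same_zeros_def)
    also have "\<dots> \<le> I * I ^ (d0 - 1)" by (intro ideal_mult_mono TI order_refl)
    also have "\<dots> = I ^ d0" using d0(1) by (simp flip: power_Suc)
    finally show ?thesis by (simp add: principal_le_iff)
  qed
  then obtain n0 where n0: "\<And>n v. n \<ge> n0 \<Longrightarrow> v \<in> carrier (I ^ (n + d0)) \<Longrightarrow>
    \<exists>u\<in>carrier (I ^ n). \<exists>k. a0 ^ k * (v - a0 * u) \<in> carrier (I ^ (n + d0 + d0 * k + 1))"
    using eventually_divisible_modulo_torsion[of "carrier I" e a0 d0] bound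
    unfolding carrier_power by blast
  \<comment> \<open>The quotient \<open>u\<close> has degree d - d0, which must reach the bound
    \<open>n0\<close> for division by \<open>a0\<close>.\<close>
  have "\<exists>c. same_zeros I (T + principal b) c d" if d: "d \<ge> n0 + d0" for d
  proof -
    have "b ^ d \<in> carrier (I ^ (d - d0 + d0))"
      using d power_in_ideal_power[of b "carrier I" "Suc 0" d] insert.prems
      by (simp add: carrier_power ideal_power_1 del: ideal_power.simps)
    then obtain u k where u: "u \<in> carrier (I ^ (d - d0))"
      "a0 ^ k * (b ^ d - a0 * u) \<in> carrier (I ^ (d - d0 + d0 + d0 * k + 1))"
      using n0[of "d - d0" "b ^ d"] le_diff_conv2[of d0 d n0] d by auto
    obtain a where "same_zeros I T a d" using d0(2)[of d] d by auto
    then have "same_zeros I (T + principal b) (a + (b ^ d - a0 * u)) d"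
      using d u d0(1) insert.prems by (intro same_zeros_step[OF TI _ a0]) auto
    then show ?thesis by blast
  qed
  then show ?case unfolding Tb using d0(1) by (intro exI[of _ "n0 + d0"]) auto
qed

text \<open>With \<open>T\<close> equal to the whole ideal, nilpotency modulo \<open>c\<close> reads
  I^(s+d) \<le> c I^s + I^(s+d+1), and Nakayama's lemma removes the last term.\<close>

lemma exists_power_reduction:
  fixes I :: "'a::comm_ring_1 set"
  assumes noeth: "noetherian TYPE('a)" and loc: "local_ring TYPE('a)"
    and dim: "krull_dim TYPE('a) = 1" and I: "regular_ideal I"
  obtains d0 where "\<And>d. d \<ge> d0 \<Longrightarrow> \<exists>c\<in>ideal_power I d. \<exists>n0. \<forall>n\<ge>n0.
    ideal_power I (n + d) = (*) c ` ideal_power I n"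
\<comment> \<open>The unit ideal is not inside the maximal ideal, as Nakayama's lemma requires;
  there 1 serves in every degree.\<close>
proof (cases "I = UNIV")
  case True
  have "ideal_power I n = UNIV" for n
  proof (rule ring_ideal_eq_UNIV)
    show "1 \<in> ideal_power I n" using power_in_ideal_power[of 1 I "Suc 0" n] True
      ideal_power_1[of I] by (simp add: ring_ideal_iff del: ideal_power.simps)
  qed simp
  then have "\<exists>c\<in>ideal_power I d. \<exists>n0. \<forall>n\<ge>n0. ideal_power I (n + d) = (*) c ` ideal_power I n" for d
    by (intro bexI[of _ 1]) auto
  then show ?thesis using that by blast
next
  case False
  interpret R: noetherian_module "(*) :: 'a \<Rightarrow> 'a \<Rightarrow> 'a" by (rule noetherian_module_mult[OF noeth])
  obtain x where x: "x \<in> I" "nonzerodivisor x" and idI: "ring_ideal I"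
    using I by (auto simp: regular_ideal_def)
  obtain P where "maximal_ideal P" "I \<subseteq> P"
    using exists_maximal_ideal[OF noeth idI False] by blast
  then have Im: "I \<subseteq> max_ideal" using local_ring_maximal_ideal[OF loc] by blast
  have sub: "R.subspace (ideal_power I n)" for n
    using ring_ideal_power unfolding ring_ideal_def .
  have injx: "inj ((*) x)" using nonzerodivisor_cancel[OF x(2)] by (auto intro: injI)
  have finx: "R.len UNIV (range ((*) x)) \<noteq> \<infinity>"
    by (rule R.finite_length_quotient[OF dim x(2)]) (auto intro: R.subspace_scale_image)
  then obtain e where e: "R.len UNIV (range ((*) x)) = enat e" by auto
  \<comment> \<open>I^n / I^(n+1) is a quotient of I^n / x I^n, whose length is that of R / xR for
    every \<open>n\<close>.\<close>
  have bound: "R.len (ideal_power I n) (ideal_power I (Suc n)) \<le> enat e" for n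
  proof -
    have xn: "x ^ n \<in> ideal_power I n" 
      using power_in_ideal_power[of x I "Suc 0" n] x(1) ideal_power_1[OF idI] by (simp del: ideal_power.simps)
    have "range ((*) (x ^ n)) \<subseteq> ideal_power I n"
      using xn ring_ideal_power[of I n] by (auto simp: ring_ideal_iff mult.commute)
    then have "R.len UNIV (ideal_power I n) \<noteq> \<infinity>"
      using nonzerodivisor_power[OF x(2)] by (intro R.finite_length_quotient[OF dim _ sub])
    then have "R.len (ideal_power I n) ((*) x ` ideal_power I n) = enat e"
      using R.len_scale_quotient[OF injx sub] e by simp
    moreover have "(*) x ` ideal_power I n \<subseteq> ideal_power I (Suc n)"
      using x(1) by (auto intro: R.smult_mem)
    ultimately show ?thesis
      using R.len_mono_lower[of "(*) x ` ideal_power I n" "ideal_power I (Suc n)" "ideal_power I n"]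
        sub ideal_power_mono[of n "Suc n" I] R.subspace_scale_image[OF sub]
      by (auto simp del: ideal_power.simps)
  qed
  define J where "J = Ideal I"
  have J: "carrier J = I" unfolding J_def by (rule Ideal_inverse) (use idI in simp)
  obtain F where F: "finite F" "R.span F = I"
    using noeth idI unfolding noetherian_def by blast
  obtain d0 where d0: "d0 > 0" "\<And>d. d \<ge> d0 \<Longrightarrow> \<exists>c. same_zeros J J c d"
    using exists_same_zeros[of J e F] bound F R.span_superset[of F]
    by (auto simp: carrier_power J J_def[symmetric] simp del: power_Suc ideal_power.simps)
  have "\<exists>c\<in>ideal_power I d. \<exists>n0. \<forall>n\<ge>n0. ideal_power I (n + d) = (*) c ` ideal_power I n"
    if d: "d \<ge> d0" for d
  proof -
    obtain c p q s where
      c: "principal c \<le> J * J ^ (d - 1)" and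
      pq: "p + q = s + d" "J ^ p * J ^ q \<le> principal c * J ^ s + J ^ (s + d + 1)"
      using d0(2)[OF d] by (auto simp: same_zeros_def)
    have cJ: "principal c \<le> J ^ d" using c d d0(1) by (simp flip: power_Suc)
    have le: "J ^ (s + d) \<le> principal c * J ^ s + J ^ (s + d + 1)"
      using pq by (simp flip: power_add)
    have "carrier (J ^ (s + d)) = carrier (principal c * J ^ s)"
    proof (rule R.nakayama[OF loc Im])
      show "carrier (principal c * J ^ s) \<subseteq> carrier (J ^ (s + d))"
        using ideal_mult_mono[OF cJ order_refl, of "J ^ s"]
        by (simp add: less_eq_ideal_def power_add mult.commute)
      show "\<exists>b\<in>carrier (principal c * J ^ s). y - b \<in> set_smult (*) I (carrier (J ^ (s + d)))"
        if y: "y \<in> carrier (J ^ (s + d))" for y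
      proof -
        have "y \<in> carrier (principal c * J ^ s + J ^ (s + d + 1))"
          using le y by (auto simp: less_eq_ideal_def)
        then obtain b w where "y = b + w" "b \<in> carrier (principal c * J ^ s)" "w \<in> carrier (J ^ (s + d + 1))"
          by (auto simp: carrier_add)
        then show ?thesis by (intro bexI[of _ b]) (simp_all add: carrier_mult J)
      qed
    qed simp_all
    then have s: "J ^ (s + d) = principal c * J ^ s" by (simp add: carrier_inject)
    have "ideal_power I (n + d) = (*) c ` ideal_power I n" if n: "n \<ge> s" for n
    proof -
      have "J ^ (n + d) = J ^ (n - s) * J ^ (s + d)" using n by (simp flip: power_add)
      also have "\<dots> = principal c * (J ^ (n - s) * J ^ s)" by (simp add: s mult.left_commute)
      also have "\<dots> = principal c * J ^ n" using n by (simp flip: power_add)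
      finally have "carrier (J ^ (n + d)) = (*) c ` carrier (J ^ n)"
        by (simp add: carrier_principal_mult)
      then show ?thesis by (simp add: carrier_power J)
    qed
    moreover have "c \<in> ideal_power I d" using cJ by (simp add: principal_le_iff carrier_power J)
    ultimately show ?thesis by blast
  qed
  then show ?thesis using that by blast
qed

section \<open>Stable submodules\<close>

lemma (in comm_module) smult_left_commute: "A \<odot> (B \<odot> N) = B \<odot> (A \<odot> N)"
  by (metis smult_assoc ideal_mult_commute)

lemma (in comm_module) smult_power_Suc: "ideal_power J (Suc n) \<odot> N = J \<odot> (ideal_power J n \<odot> N)"
  by (simp add: smult_assoc)

text \<open>c I^n = I^(n+d) contains a nonzerodivisor, and factors of nonzerodivisors are
  nonzerodivisors.\<close>

lemma nonzerodivisor_of_power_reduction: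
  fixes I :: "'a::comm_ring_1 set"
  assumes "regular_ideal I" "ideal_power I (n + d) = (*) c ` ideal_power I n"
  shows "nonzerodivisor c"
proof -
  obtain w where w: "w \<in> ideal_power I (n + d)" "nonzerodivisor w"
    using regular_ideal_power[OF assms(1), of "n + d"] by (auto simp: regular_ideal_def)
  then obtain v where v: "w = c * v" using assms(2) by auto
  show ?thesis unfolding nonzerodivisor_def
  proof (intro allI impI)
    fix b assume "c * b = 0"
    then have "w * b = 0" by (simp add: v mult.assoc mult.left_commute[of c])
    then show "b = 0" using w(2) by (simp add: nonzerodivisor_def)
  qed
qed

text \<open>Injectivity of nonzerodivisors stands in for the depth condition. The exponent is a
  parameter because a second instance, for \<open>Suc r\<close>, is compared with the first.\<close>

locale power_reduction = noetherian_module scale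
  for scale :: "'a::comm_ring_1 \<Rightarrow> 'm::ab_group_add \<Rightarrow> 'm" (infixr "*s" 75) +
  fixes I :: "'a set" and r :: nat and x :: 'a and n0 :: nat
  assumes dim: "krull_dim TYPE('a) = 1"
    and torsion_free: "nonzerodivisor c \<Longrightarrow> c *s u = 0 \<Longrightarrow> u = 0"
    and regular: "regular_ideal I"
    and r_pos: "r > 0"
    and x_mem: "x \<in> ideal_power I r"
    and reduction: "n \<ge> n0 \<Longrightarrow> ideal_power I (n + r) = (*) x ` ideal_power I n"
begin

lemma scale_inj: "nonzerodivisor c \<Longrightarrow> inj (scale c)"
  using torsion_free[of c] by (intro injI) (metis eq_iff_diff_eq_0 scale_right_diff_distrib)

lemma x_nonzerodivisor: "nonzerodivisor x"
  using nonzerodivisor_of_power_reduction[OF regular reduction[of n0]] by simp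

lemmas inj_x = scale_inj[OF x_nonzerodivisor]
  and x_cancel = injD[OF scale_inj[OF x_nonzerodivisor]]

text \<open>This says that \<open>K\<close> is closed under the action of \<open>B(I)\<close> on
  \<open>Q(R) \<otimes> M\<close>: for large \<open>k\<close>, \<open>B(I) = x\<^sup>-\<^sup>k I\<^sup>r\<^sup>k\<close>.\<close>

definition stable :: "'m set \<Rightarrow> bool" where
  "stable K \<longleftrightarrow> subspace K \<and> ideal_power I r \<odot> K = scale x ` K"

lemma stable_subspace: "stable K \<Longrightarrow> subspace K"
  by (simp add: stable_def)

lemma stableI:
  assumes "subspace K" "\<And>z u. z \<in> ideal_power I r \<Longrightarrow> u \<in> K \<Longrightarrow> z *s u \<in> scale x ` K"
  shows "stable K"
  unfolding stable_def
proof (intro conjI order.antisym)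
  show "ideal_power I r \<odot> K \<subseteq> scale x ` K"
    using assms by (intro smult_least subspace_scale_image) auto
qed (use assms x_mem in \<open>auto intro: smult_mem\<close>)

lemma stable_scale: "stable K \<Longrightarrow> stable (scale c ` K)"
  unfolding stable_def
  by (auto simp: subspace_scale_image smult_scale_image image_image mult.commute)

lemma stable_scale_cancel:
  assumes "nonzerodivisor c" "subspace K" "stable (scale c ` K)"
  shows "stable K"
proof -
  have "scale c ` (ideal_power I r \<odot> K) = scale c ` scale x ` K"
    using assms(3) unfolding stable_def smult_scale_image by (simp add: image_image mult.commute)
  then show ?thesis
    using assms(2) scale_inj[OF assms(1)] by (simp add: stable_def inj_image_eq_iff)
qed

lemma stable_smult:
  assumes "stable K"
  shows "stable (A \<odot> K)"
  using assms unfolding stable_def smult_left_commute[of "ideal_power I r"]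
  by (simp add: smult_scale_image)

text \<open>Multiplication by \<open>e\<close> commutes with that by z / x, so the preimage of the
  stable module I L' is stable. If \<open>L'\<close> is maximal among the stable proper submodules
  of \<open>L\<close>, this forces the kernel of \<open>e\<close> from L/L' to IL/IL' to be trivial
  or everything.\<close>

lemma stable_kernel:
  assumes L: "stable L" and L1: "stable L'"
  shows "stable (L \<inter> scale e -` (I \<odot> L'))" (is "stable ?V")
proof (rule stableI)
  show "subspace ?V"
    using stable_subspace[OF L]
    by (intro subspace_inter module_hom.subspace_vimage[OF module_hom_scale] subspace_smult)
  fix z u assume z: "z \<in> ideal_power I r" and u: "u \<in> ?V"
  have "z *s u \<in> scale x ` L" using L z u smult_mem[of z] unfolding stable_def by blast
  then obtain v where v: "v \<in> L" "z *s u = x *s v" by auto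
  have "z *s (e *s u) \<in> scale x ` (I \<odot> L')"
    using stable_smult[OF L1, of I] z u smult_mem[of z _ "e *s u" "I \<odot> L'"] unfolding stable_def by auto
  then obtain w where w: "w \<in> I \<odot> L'" "z *s (e *s u) = x *s w" by auto
  have "x *s (e *s v) = e *s (z *s u)" unfolding v(2) by (rule scale_left_commute)
  also have "\<dots> = x *s w" unfolding w(2)[symmetric] by (rule scale_left_commute)
  finally have "e *s v = w" by (rule x_cancel)
  then show "z *s u \<in> scale x ` ?V" using v w by auto
qed

text \<open>Multiply by I^(r-1), which exists as \<open>r\<close> is positive. For stable modules
  the conclusion says xL \<subseteq> xL', hence L \<subseteq> L'.\<close>

lemma smult_power_le_cancel:
  assumes "I \<odot> L \<subseteq> I \<odot> L'"
  shows "ideal_power I r \<odot> L \<subseteq> ideal_power I r \<odot> L'"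
proof -
  obtain r' where r: "r = Suc r'" using r_pos gr0_implies_Suc by blast
  have "ideal_power I r' \<odot> (I \<odot> L) \<subseteq> ideal_power I r' \<odot> (I \<odot> L')"
    by (rule smult_mono[OF order_refl assms])
  then show ?thesis unfolding r smult_power_Suc smult_left_commute[of I] .
qed

text \<open>Iterating IN \<subseteq> eN + IN' only produces error terms in I^j N', because the
  powers of \<open>e\<close> already collected lie in the corresponding powers of
  \<open>I\<close>.\<close>

lemma power_smult_decompose:
  assumes e: "e \<in> I" and gen: "I \<odot> N \<subseteq> {u + v | u v. u \<in> scale e ` N \<and> v \<in> I \<odot> N'}"
    and sub: "subspace N" "subspace N'"
  shows "ideal_power I j \<odot> N \<subseteq> {u + v | u v. u \<in> scale (e ^ j) ` N \<and> v \<in> ideal_power I j \<odot> N'}"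
proof (induction j)
  case 0
  have "N \<subseteq> {u + v | u v. u \<in> N \<and> v \<in> N'}"
  proof
    fix u assume "u \<in> N"
    then have "u + 0 \<in> {u + v | u v. u \<in> N \<and> v \<in> N'}" using subspace_0[OF sub(2)] by blast
    then show "u \<in> {u + v | u v. u \<in> N \<and> v \<in> N'}" by simp
  qed
  then show ?case using sub by (simp add: smult_UNIV_left)
next
  case (Suc j)
  have ej: "e ^ j \<in> ideal_power I j"
    using power_in_ideal_power[of e I "Suc 0" j] e regular
    by (simp add: regular_ideal_def ideal_power_1 del: ideal_power.simps)
  show ?case
    unfolding smult_power_Suc
  proof (rule smult_least)
    fix a t assume a: "a \<in> I" and t: "t \<in> ideal_power I j \<odot> N"
    obtain u w where u: "t = e ^ j *s u + w" "u \<in> N" "w \<in> ideal_power I j \<odot> N'"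
      using t Suc by fastforce
    obtain v w' where v: "a *s u = e *s v + w'" "v \<in> N" "w' \<in> I \<odot> N'"
      using gen smult_mem[OF a u(2)] by fastforce
    have "e ^ j *s w' \<in> I \<odot> ideal_power I j \<odot> N'"
      unfolding smult_left_commute[of I] by (rule smult_mem[OF ej v(3)])
    moreover have "a *s w \<in> I \<odot> ideal_power I j \<odot> N'" by (rule smult_mem[OF a u(3)])
    ultimately have "e ^ j *s w' + a *s w \<in> I \<odot> ideal_power I j \<odot> N'"
      by (intro subspace_add subspace_smult)
    moreover have "a *s t = e ^ Suc j *s v + (e ^ j *s w' + a *s w)"
    proof -
      have "a *s t = e ^ j *s (a *s u) + a *s w"
        unfolding u(1) scale_right_distrib by (simp only: scale_left_commute[of a])
      also have "\<dots> = e ^ Suc j *s v + (e ^ j *s w' + a *s w)"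
        unfolding v(1) scale_right_distrib by (simp add: mult.commute add.assoc)
      finally show ?thesis .
    qed
    ultimately show "a *s t \<in> {u + v |u v. u \<in> scale (e ^ Suc j) ` N \<and> v \<in> I \<odot> ideal_power I j \<odot> N'}"
      using v(2) by blast
  qed (intro subspace_set_sum subspace_scale_image subspace_smult sub)
qed

text \<open>The inequality replaces a general element of \<open>I\<close>, which need not exist over a finite
  residue field. \<open>L/C\<close> is filtered by stable submodules with quotients that are simple among
  the stable ones; on each of them some \<open>e \<in> I\<close> is injective, but \<open>e\<close> varies.\<close>

lemma len_le_len_smult:
  assumes "stable L" "stable C" "subspace N" "C \<subseteq> N" "N \<subseteq> L" "len L C = enat n"
  shows "len N C \<le> len (I \<odot> N) (I \<odot> C) \<and>
    (len (I \<odot> N) (I \<odot> C) \<le> len N C \<longrightarrow> stable N)"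
  using assms
proof (induction n arbitrary: L N rule: less_induct)
  case (less n L N)
  note sub = stable_subspace[OF less.prems(1)] stable_subspace[OF less.prems(2)] less.prems(3)
  have CL: "C \<subseteq> L" using less.prems by auto
  show ?case
  proof (cases "L = C")
    case True
    then have "N = C" using less.prems by auto
    then show ?thesis using less.prems by simp
  next
    case False
    let ?S = "{K. stable K \<and> C \<subseteq> K \<and> K \<subset> L}"
    have "C \<in> ?S" using less.prems CL False by auto
    then have "?S \<noteq> {}" by blast
    moreover have "subspace K" if "K \<in> ?S" for K using that stable_subspace by blast
    ultimately obtain L1 where L1: "L1 \<in> ?S" "\<And>K. K \<in> ?S \<Longrightarrow> L1 \<subseteq> K \<Longrightarrow> K = L1"
      by (rule maximal_submodule) blast+
    then have L1': "stable L1" "C \<subseteq> L1" "L1 \<subset> L" "subspace L1" by (auto simp: stable_subspace)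
    \<comment> \<open>Otherwise xL \<subseteq> xL1, against injectivity of \<open>x\<close>. So some
      \<open>e\<close> in \<open>I\<close> is nonzero from L/L1 to IL/IL1.\<close>
    have "\<not> I \<odot> L \<subseteq> I \<odot> L1"
    proof
      assume "I \<odot> L \<subseteq> I \<odot> L1"
      then have "scale x ` L \<subseteq> scale x ` L1"
        using smult_power_le_cancel less.prems(1) L1'(1) unfolding stable_def by blast
      then show False using inj_x L1'(3) by (auto simp: inj_image_subset_iff)
    qed
    then have "\<exists>e\<in>I. \<exists>l\<in>L. e *s l \<notin> I \<odot> L1"
      using smult_least[of I L "I \<odot> L1"] by blast
    then obtain e l where e: "e \<in> I" "l \<in> L" "e *s l \<notin> I \<odot> L1" by blast
    \<comment> \<open>The kernel of \<open>e\<close> on L/L1 is stable and proper, so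
      \<open>V = L1\<close> by maximality: \<open>e\<close> is injective on L/L1 and hence on
      N/N'.\<close>
    define V where "V = L \<inter> scale e -` (I \<odot> L1)"
    have "L1 \<subseteq> V" using L1' e(1) by (auto simp: V_def intro: smult_mem)
    moreover have "V \<in> ?S"
      using stable_kernel[OF less.prems(1) L1'(1), of e] e L1'(2) \<open>L1 \<subseteq> V\<close> unfolding V_def by auto
    ultimately have V: "V = L1" using L1(2) by blast
    define N' where "N' = N \<inter> L1"
    have N': "subspace N'" "C \<subseteq> N'" "N' \<subseteq> L1" "N' \<subseteq> N"
      using sub L1' less.prems by (auto simp: N'_def subspace_inter)
    have e_inj: "u \<in> N'" if "u \<in> N" "e *s u \<in> I \<odot> L1" for u
      using that V less.prems(5) unfolding N'_def V_def by blast
    have IN': "I \<odot> N' \<subseteq> I \<odot> N" "I \<odot> N' \<subseteq> I \<odot> L1" "I \<odot> C \<subseteq> I \<odot> N'"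
      using N' by (simp_all add: smult_mono)
    have "len L C = len L L1 + len L1 C" using L1' sub by (intro len_add) auto
    moreover have "1 \<le> len L L1" using L1' sub by (intro len_ge_1)
    ultimately obtain m where m: "len L1 C = enat m" "m < n"
      using less.prems(6) by (cases "len L L1"; cases "len L1 C") (auto simp: one_enat_def)
    have IH: "len N' C \<le> len (I \<odot> N') (I \<odot> C)"
      "len (I \<odot> N') (I \<odot> C) \<le> len N' C \<Longrightarrow> stable N'"
      using less.IH[OF m(2) L1'(1) less.prems(2) N'(1,2,3) m(1)] by auto
    have le: "len N N' \<le> len S (I \<odot> N')"
      if "subspace S" "I \<odot> N' \<subseteq> S" "scale e ` N \<subseteq> S" for S
      using that e(1) IN'(2) N' sub
      by (intro len_le_of_inj[OF module_hom_scale[of e]]) (auto intro: smult_mem e_inj)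
    have eN: "scale e ` N \<subseteq> I \<odot> N" using e(1) by (auto intro: smult_mem)
    have le1: "len N N' \<le> len (I \<odot> N) (I \<odot> N')" using IN' eN by (intro le) auto
    have addN: "len N C = len N N' + len N' C" using N' sub by (intro len_add) auto
    have addIN: "len (I \<odot> N) (I \<odot> C) = len (I \<odot> N) (I \<odot> N') + len (I \<odot> N') (I \<odot> C)"
      using IN' by (intro len_add) auto
    have "len N C \<le> len L C" using sub less.prems by (intro len_mono_upper) auto
    then have fin: "len N N' \<noteq> \<infinity>" "len N' C \<noteq> \<infinity>"
      using less.prems(6) addN by (cases "len N N'"; cases "len N' C"; simp)+
    have "stable N" if eq: "len (I \<odot> N) (I \<odot> C) \<le> len N C"
    proof -
      have "len (I \<odot> N') (I \<odot> C) \<le> len N' C" "len (I \<odot> N) (I \<odot> N') \<le> len N N'"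
        using eq le1 IH(1) fin unfolding addN addIN
        by (cases "len N N'"; cases "len N' C"; cases "len (I \<odot> N) (I \<odot> N')";
            cases "len (I \<odot> N') (I \<odot> C)"; simp)+
      then have stN': "stable N'" and eq': "len (I \<odot> N) (I \<odot> N') \<le> len N N'" using IH(2) by auto
      \<comment> \<open>Equality of lengths leaves no room between S = eN + IN' and IN.\<close>
      define S where "S = {u + v | u v. u \<in> scale e ` N \<and> v \<in> I \<odot> N'}"
      have S: "subspace S" unfolding S_def by (intro subspace_set_sum subspace_scale_image sub subspace_smult)
      have "S \<subseteq> I \<odot> N"
        unfolding S_def using eN IN'(1) by (auto intro!: subspace_add[OF subspace_smult])
      moreover have S1: "I \<odot> N' \<subseteq> S"
      proof
        fix v assume "v \<in> I \<odot> N'"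
        then have "e *s 0 + v \<in> S" using subspace_0[OF sub(3)] unfolding S_def by blast
        then show "v \<in> S" by simp
      qed
      moreover have "scale e ` N \<subseteq> S"
      proof
        fix u assume "u \<in> scale e ` N"
        then have "u + 0 \<in> S" using subspace_0[of "I \<odot> N'"] unfolding S_def by blast
        then show "u \<in> S" by simp
      qed
      then have "len N N' \<le> len S (I \<odot> N')" using S S1 by (intro le)
      moreover have lenS: "len S (I \<odot> N') \<le> len (I \<odot> N) (I \<odot> N')"
        using S S1 \<open>S \<subseteq> I \<odot> N\<close> by (intro len_mono_upper) auto
      moreover have "len S (I \<odot> N') \<noteq> \<infinity>"
        using lenS eq' fin by (cases "len (I \<odot> N) (I \<odot> N')"; cases "len S (I \<odot> N')") simp_all
      ultimately have "I \<odot> N = S"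
        using S eq' by (intro len_eq_upper_imp_eq[of "I \<odot> N'"]) auto
      then have dec: "ideal_power I r \<odot> N \<subseteq>
          {u + v | u v. u \<in> scale (e ^ r) ` N \<and> v \<in> ideal_power I r \<odot> N'}"
        unfolding S_def using e(1) sub N' by (intro power_smult_decompose) auto
      have er: "e ^ r \<in> ideal_power I r"
        using power_in_ideal_power[of e I "Suc 0" r] e regular
        by (simp add: regular_ideal_def ideal_power_1 del: ideal_power.simps)
      have xN': "ideal_power I r \<odot> N' = scale x ` N'" using stN' by (simp add: stable_def)
      have subs: "subspace (scale x ` N')" "subspace (scale x ` N)"
        "scale x ` N' \<subseteq> scale x ` N" "scale x ` N \<subseteq> ideal_power I r \<odot> N"
        using N' sub x_mem by (auto intro: subspace_scale_image smult_mem)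
      \<comment> \<open>Now I^r N = e^r N + xN' is, modulo xN', an image of N/N', while its
        submodule xN/xN' is isomorphic to N/N'. Finite length forces I^r N = xN.\<close>
      have "len (ideal_power I r \<odot> N) (scale x ` N') \<le> len N N'"
      proof (rule len_le_of_surj[OF module_hom_scale[of "e ^ r"] N'(1) sub(3) subs(1) subspace_smult N'(4)])
        show "scale (e ^ r) ` N' \<subseteq> scale x ` N'"
          unfolding xN'[symmetric] using er by (auto intro: smult_mem)
        show "\<exists>u\<in>N. y - e ^ r *s u \<in> scale x ` N'" if y: "y \<in> ideal_power I r \<odot> N" for y
        proof -
          obtain u v where "u \<in> N" "v \<in> scale x ` N'" "y = e ^ r *s u + v"
            using subsetD[OF dec y] unfolding xN' by blast
          then show ?thesis by (intro bexI[of _ u]) auto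
        qed
      qed (use subs in auto)
      also have "len N N' = len (scale x ` N) (scale x ` N')"
        using len_image[OF module_hom_scale inj_x N'(1) sub(3) N'(4)] by simp
      finally have "ideal_power I r \<odot> N = scale x ` N"
        using subs len_image[OF module_hom_scale inj_x N'(1) sub(3) N'(4)] fin(1)
        by (intro len_eq_upper_imp_eq[of "scale x ` N'"]) auto
      then show ?thesis using sub by (simp add: stable_def)
    qed
    then show ?thesis unfolding addN addIN using add_mono[OF le1 IH(1)] by simp
  qed
qed

section \<open>The Hilbert function of M\<close>

abbreviation adic :: "nat \<Rightarrow> 'm set" where
  "adic n \<equiv> ideal_power I n \<odot> UNIV"

abbreviation hilbert :: "nat \<Rightarrow> enat" where
  "hilbert n \<equiv> len (adic n) (adic (Suc n))"

lemma adic_0: "adic 0 = UNIV"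
  by (simp add: smult_UNIV_left)

lemma adic_Suc: "adic (Suc n) = I \<odot> adic n"
  by (simp add: smult_assoc)

lemma adic_add: "adic (m + n) = ideal_power I m \<odot> adic n"
  by (simp add: ideal_power_add smult_assoc)

lemma adic_antimono: "m \<le> n \<Longrightarrow> adic n \<subseteq> adic m"
  by (intro smult_mono ideal_power_mono) auto

text \<open>A nonzerodivisor \<open>w\<close> in I^n gives c w M \<subseteq> K, so the finiteness
  result for dimension one applies.\<close>

lemma finite_colength:
  assumes "nonzerodivisor c" "subspace K" "scale c ` adic n \<subseteq> K"
  shows "len UNIV K \<noteq> \<infinity>"
proof -
  obtain w where w: "w \<in> ideal_power I n" "nonzerodivisor w"
    using regular_ideal_power[OF regular, of n] by (auto simp: regular_ideal_def)
  have "range (scale (c * w)) \<subseteq> scale c ` adic n"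
    using w(1) by (auto simp flip: scale_scale intro: smult_mem)
  then show ?thesis
    using assms w(2) by (intro finite_length_quotient[OF dim, of "c * w"] nonzerodivisor_mult) auto
qed

lemma finite_len:
  assumes "nonzerodivisor c" "subspace K" "scale c ` adic n \<subseteq> K" "subspace N" "K \<subseteq> N"
  shows "len N K \<noteq> \<infinity>"
  using finite_colength[OF assms(1-3)] len_mono_upper[OF assms(2,4) subspace_UNIV assms(5)]
  by (cases "len N K") simp_all

lemma finite_len_adic: "m \<le> n \<Longrightarrow> len (adic m) (adic n) \<noteq> \<infinity>"
  by (rule finite_len[of 1]) (use adic_antimono in auto)

lemma hilbert_neq_infinity: "hilbert n \<noteq> \<infinity>"
  by (rule finite_len_adic) simp

lemma stable_adic:
  assumes "n \<ge> n0"
  shows "stable (adic n)"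
proof -
  have "ideal_power I n \<odot> (scale x ` UNIV) = scale x ` adic n" by (rule smult_scale_image)
  moreover have "set_smult (*) (ideal_power I n) (range ((*) x)) = (*) x ` ideal_power I n"
    using comm_module.smult_principal[OF comm_module_mult, of "ideal_power I n" x]
      ring_ideal_power[of I n] by (simp add: ring_ideal_def ideal_mult_commute)
  then have "ideal_power I (n + r) = set_smult (*) (ideal_power I n) (range ((*) x))"
    using reduction[OF assms] by simp
  then have "adic (r + n) = ideal_power I n \<odot> (scale x ` UNIV)"
    by (simp add: add.commute smult_assoc smult_principal)
  ultimately show ?thesis unfolding stable_def adic_add by simp
qed

text \<open>From a stable member on, the values increase by the comparison of N/C with IN/IC, and
  multiplication by \<open>x\<close> makes them periodic with period \<open>r\<close>. An increasing
  periodic sequence is constant.\<close>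

lemma hilbert_const_if_stable:
  assumes "stable (adic n)"
  shows "hilbert (n + k) = hilbert n"
proof -
  have st: "stable (adic (n + j))" for j
    using stable_smult[OF assms] by (simp add: add.commute[of n] adic_add)
  have le: "hilbert (n + j) \<le> hilbert (Suc (n + j))" for j
  proof -
    obtain m where m: "hilbert (n + j) = enat m" using hilbert_neq_infinity by auto
    show ?thesis
      using len_le_len_smult[OF st[of j] st[of "Suc j"] _ _ order_refl, of m] m
        adic_antimono[of "n + j" "Suc (n + j)"] by (simp add: adic_Suc del: ideal_power.simps)
  qed
  have mono: "hilbert (n + j) \<le> hilbert (n + j')" if "j \<le> j'" for j j'
    by (rule lift_Suc_mono_le[of "\<lambda>j. hilbert (n + j)", OF _ that]) (use le in simp)
  have per: "hilbert (n + r + j) = hilbert (n + j)" for j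
  proof -
    have "adic (n + r + j) = scale x ` adic (n + j)" "adic (Suc (n + r + j)) = scale x ` adic (Suc (n + j))"
      using st[of j] st[of "Suc j"] adic_add[of r "n + j"] adic_add[of r "Suc (n + j)"]
      unfolding stable_def by (simp_all add: ac_simps del: ideal_power.simps)
    then show ?thesis
      using len_image[OF module_hom_scale inj_x, of "adic (Suc (n + j))" "adic (n + j)"]
        adic_antimono[of "n + j" "Suc (n + j)"] by (simp del: ideal_power.simps)
  qed
  have "hilbert (n + Suc j) = hilbert (n + j)" for j
    using mono[of j "Suc j"] mono[of "Suc j" "r + j"] per[of j] r_pos
    by (intro order.antisym) (simp_all add: ac_simps del: ideal_power.simps)
  then show ?thesis by (induction k) (simp_all del: ideal_power.simps)
qed

lemma hilbert_eventually_const: "n \<ge> n0 \<Longrightarrow> hilbert n = hilbert n0"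
  using hilbert_const_if_stable[OF stable_adic, of n0 "n - n0"] by simp

text \<open>The length of I^i M / I^(t+i) M cannot drop when both modules are multiplied by
  \<open>I\<close>. The change is the eventual value minus \<open>hilbert i\<close>, and if it is
  zero, the equality case gives stability.\<close>

lemma hilbert_le:
  shows "hilbert i \<le> hilbert n0" and "hilbert n0 \<le> hilbert i \<Longrightarrow> stable (adic i)"
proof -
  define t where "t = r * n0"
  have t: "t \<ge> n0" using r_pos by (simp add: t_def)
  define y where "y = x ^ n0"
  have y: "y \<in> ideal_power I t" "nonzerodivisor y"
    using power_in_ideal_power[OF x_mem] nonzerodivisor_power[OF x_nonzerodivisor] by (auto simp: y_def t_def)
  have inj_y: "inj (scale y)" by (rule scale_inj[OF y(2)])
  \<comment> \<open>I^i M need not lie inside a stable submodule of M, but its multiple by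
    \<open>y\<close> lies between the stable modules y I^(t+i) M and I^(t+i) M.\<close>
  define N L C where "N = scale y ` adic i" and "L = adic (t + i)" and "C = scale y ` adic (t + i)"
  have L: "stable L" unfolding L_def using t by (intro stable_adic) simp
  have C: "stable C" using L unfolding C_def L_def by (rule stable_scale)
  have N: "subspace N" unfolding N_def by (intro subspace_scale_image subspace_smult)
  have CN: "C \<subseteq> N" unfolding C_def N_def by (intro image_mono adic_antimono) simp
  have NL: "N \<subseteq> L" unfolding N_def L_def adic_add using y(1) by (auto intro: smult_mem)
  have "len L C \<noteq> \<infinity>"
    by (rule finite_len[OF y(2), of _ "t + i"])
      (use L C CN NL in \<open>auto simp: stable_subspace C_def\<close>)
  then obtain n where n: "len L C = enat n" by auto
  have main: "len N C \<le> len (I \<odot> N) (I \<odot> C)" "len (I \<odot> N) (I \<odot> C) \<le> len N C \<Longrightarrow> stable N"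
    using len_le_len_smult[OF L C N CN NL n] by auto
  have lenN: "len N C = len (adic i) (adic (t + i))"
    unfolding N_def C_def by (rule len_image[OF module_hom_scale inj_y]) (auto intro: adic_antimono[THEN subsetD, rotated])
  have lenIN: "len (I \<odot> N) (I \<odot> C) = len (adic (Suc i)) (adic (Suc (t + i)))"
    unfolding N_def C_def smult_scale_image adic_Suc[symmetric]
    by (rule len_image[OF module_hom_scale inj_y]) (auto simp del: ideal_power.simps intro: adic_antimono[THEN subsetD, rotated])
  \<comment> \<open>The same length is split at I^(t+i) M and then at I^(i+1) M.\<close>
  have a1: "len (adic i) (adic (Suc (t + i))) = len (adic i) (adic (t + i)) + hilbert (t + i)"
    by (rule len_add) (auto simp del: ideal_power.simps intro: adic_antimono[THEN subsetD, rotated])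
  have a2: "len (adic i) (adic (Suc (t + i))) = hilbert i + len (adic (Suc i)) (adic (Suc (t + i)))"
    by (rule len_add) (auto simp del: ideal_power.simps intro: adic_antimono[THEN subsetD, rotated])
  have ft: "hilbert (t + i) = hilbert n0" using t by (intro hilbert_eventually_const) simp
  obtain a where a: "len (adic i) (adic (t + i)) = enat a" using finite_len_adic[of i "t + i"] by auto
  obtain b where b: "len (adic (Suc i)) (adic (Suc (t + i))) = enat b"
    using finite_len_adic[of "Suc i" "Suc (t + i)"] by auto
  obtain p where p: "hilbert i = enat p" using hilbert_neq_infinity[of i] by auto
  obtain q where q: "hilbert n0 = enat q" using hilbert_neq_infinity[of n0] by auto
  have eq: "a + q = p + b" using a1 a2 unfolding ft a b p q by simp
  have "a \<le> b" using main(1) unfolding lenN lenIN a b by simp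
  then show "hilbert i \<le> hilbert n0" using eq unfolding p q by simp
  assume "hilbert n0 \<le> hilbert i"
  then have "b \<le> a" using eq unfolding p q by simp
  then have "stable N" using main(2) unfolding lenN lenIN a b by simp
  then show "stable (adic i)" unfolding N_def by (rule stable_scale_cancel[OF y(2) subspace_smult])
qed

lemma stable_UNIV_iff: "stable UNIV \<longleftrightarrow> hilbert 0 = hilbert n0"
  using hilbert_const_if_stable[of 0 n0] hilbert_le(2)[of 0] by (auto simp: adic_0 simp del: ideal_power.simps)

lemma len_adic_sum: "len (adic m) (adic (m + k)) = (\<Sum>i<k. hilbert (m + i))"
proof (induction k)
  case (Suc k)
  have "len (adic m) (adic (Suc (m + k))) = len (adic m) (adic (m + k)) + hilbert (m + k)"
    by (rule len_add) (auto simp del: ideal_power.simps intro: adic_antimono[THEN subsetD, rotated])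
  then show ?case using Suc by (simp del: ideal_power.simps)
qed simp

section \<open>Multiplicities and the Ulrich conditions\<close>

text \<open>A layer of the filtration by powers of I^k consists of \<open>k\<close> consecutive
  layers of the one by powers of \<open>I\<close>, all of the eventual length once n \<ge>
  n0.\<close>

lemma hs_multiplicity_power: "hs_multiplicity scale (ideal_power I k) = (\<Sum>i<k. hilbert n0)" if "k > 0"
proof -
  have *: "len (set_smult scale (ideal_power (ideal_power I k) n) UNIV)
      (set_smult scale (ideal_power (ideal_power I k) (Suc n)) UNIV) = (\<Sum>i<k. hilbert n0)" if "n \<ge> n0" for n
  proof -
    have "k * n \<ge> n0" using that \<open>k > 0\<close> by (auto intro: order_trans[of n0 n])
    then have "(\<Sum>i<k. hilbert (k * n + i)) = (\<Sum>i<k. hilbert n0)"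
      by (intro sum.cong refl hilbert_eventually_const) simp
    then show ?thesis
      using len_adic_sum[of "k * n" k] unfolding ideal_power_power by (simp add: add.commute)
  qed
  show ?thesis
    unfolding hs_multiplicity_def
  proof (rule the_equality)
    show "\<exists>N. \<forall>n\<ge>N. len (set_smult scale (ideal_power (ideal_power I k) n) UNIV)
      (set_smult scale (ideal_power (ideal_power I k) (Suc n)) UNIV) = (\<Sum>i<k. hilbert n0)"
      using * by blast
    fix e assume "\<exists>N. \<forall>n\<ge>N. len (set_smult scale (ideal_power (ideal_power I k) n) UNIV)
      (set_smult scale (ideal_power (ideal_power I k) (Suc n)) UNIV) = e"
    then obtain N where "\<forall>n\<ge>N. len (set_smult scale (ideal_power (ideal_power I k) n) UNIV)
      (set_smult scale (ideal_power (ideal_power I k) (Suc n)) UNIV) = e" by blast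
    then show "e = (\<Sum>i<k. hilbert n0)" using *[of "max N n0"] by force
  qed
qed

lemma ulrich_power_iff:
  assumes "max_cohen_macaulay scale" "k > 0"
  shows "ulrich scale (ideal_power I k) \<longleftrightarrow> stable UNIV"
proof -
  have "len UNIV (adic k) = (\<Sum>i<k. hilbert i)" using len_adic_sum[of 0 k] unfolding adic_0 add_0 .
  then have "ulrich scale (ideal_power I k) \<longleftrightarrow> (\<Sum>i<k. hilbert n0) = (\<Sum>i<k. hilbert i)"
    using regular_ideal_power[OF regular, of k] assms
    by (simp only: ulrich_def hs_multiplicity_power simp_thms)
  also have "\<dots> \<longleftrightarrow> stable UNIV"
  proof
    assume "stable UNIV"
    then have "hilbert i = hilbert n0" for i
      using hilbert_const_if_stable[of 0 i] hilbert_const_if_stable[of 0 n0] by (simp add: adic_0 del: ideal_power.simps)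
    then show "(\<Sum>i<k. hilbert n0) = (\<Sum>i<k. hilbert i)" by (intro sum.cong refl) (rule sym)
  next
    assume eq: "(\<Sum>i<k. hilbert n0) = (\<Sum>i<k. hilbert i)"
    obtain k' where k: "k = Suc k'" using assms(2) gr0_implies_Suc by blast
    \<comment> \<open>Cancelling the terms of positive index requires natural numbers. As each term
      is at most the eventual value, equal sums force equality at index 0, which occurs because
      \<open>k\<close> is positive.\<close>
    define g where "g i = the_enat (hilbert i)" for i
    have g: "hilbert i = enat (g i)" for i using hilbert_neq_infinity[of i] by (auto simp: g_def)
    have sum_g: "(\<Sum>i\<in>A. enat (h i)) = enat (\<Sum>i\<in>A. h i)" for A :: "nat set" and h
      by (induction A rule: infinite_finite_induct) (auto simp: zero_enat_def)
    have gle: "g i \<le> g n0" for i using hilbert_le(1)[of i] unfolding g by simp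
    have "(\<Sum>i<k. g n0) = (\<Sum>i<k. g i)" using eq unfolding g sum_g by simp
    moreover have "(\<Sum>i<k'. g (Suc i)) \<le> (\<Sum>i<k'. g n0)" by (intro sum_mono gle)
    ultimately have "g n0 \<le> g 0" unfolding k sum.lessThan_Suc_shift by simp
    then have "hilbert 0 = hilbert n0" using gle[of 0] unfolding g by simp
    then show "stable UNIV" by (simp only: stable_UNIV_iff)
  qed
  finally show ?thesis .
qed

section \<open>Isomorphisms between M and IM\<close>

text \<open>The isomorphism carries I^n M to I^(n+1) M, so the Hilbert function is constant from 0
  on.\<close>

lemma iso_imp_stable:
  assumes "iso_to_submodule scale (I \<odot> UNIV)"
  shows "stable UNIV"
proof -
  obtain \<phi> where \<phi>: "module_hom scale scale \<phi>" "inj \<phi>" "range \<phi> = I \<odot> UNIV"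
    using assms by (auto simp: iso_to_submodule_def bij_betw_def)
  have img: "\<phi> ` adic n = adic (Suc n)" for n
    using smult_image[OF \<phi>(1), of "ideal_power I n" UNIV] \<phi>(3)
    by (simp add: smult_assoc smult_left_commute[of I])
  have "hilbert (Suc n) = hilbert n" for n
    using len_image[OF \<phi>(1,2), of "adic (Suc n)" "adic n"] adic_antimono[of n "Suc n"]
    by (simp add: img del: ideal_power.simps)
  then have "hilbert n = hilbert 0" for n by (induction n) (simp_all del: ideal_power.simps)
  then show ?thesis unfolding stable_UNIV_iff by metis
qed

lemma stable_power:
  assumes "stable UNIV"
  shows "adic (r * j) = range (scale (x ^ j))"
proof (induction j)
  case (Suc j)
  have "adic (r * Suc j) = ideal_power I r \<odot> adic (r * j)" by (simp add: adic_add)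
  also have "\<dots> = scale (x ^ j) ` scale x ` UNIV"
    using assms unfolding Suc smult_scale_image stable_def by simp
  finally show ?case by (simp add: image_image mult.commute)
qed (simp add: adic_0[simplified])

lemma stable_imp_iso:
  assumes "stable UNIV" and y: "y \<in> ideal_power I (Suc r)"
    "\<And>n. n \<ge> n1 \<Longrightarrow> ideal_power I (n + Suc r) = (*) y ` ideal_power I n"
  shows "iso_to_submodule scale (I \<odot> UNIV)"
proof -
  have y_nzd: "nonzerodivisor y"
    using nonzerodivisor_of_power_reduction[OF regular y(2)[of n1]] by simp
  interpret Y: power_reduction scale I "Suc r" y n1
    by unfold_locales (use dim torsion_free regular y in auto)
  define j where "j = n1"
  have j: "r * j \<ge> n1" using r_pos by (simp add: j_def)
  have xj: "nonzerodivisor (x ^ j)" by (rule nonzerodivisor_power[OF x_nonzerodivisor])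
  \<comment> \<open>x^j M = I^(rj) M is so deep in the filtration that it is stable for
    \<open>y\<close> as well; cancelling x^j transfers this to M. Hence yM = I^(r+1) M = x
    IM.\<close>
  have "Y.stable UNIV"
    using Y.stable_adic[OF j] unfolding stable_power[OF assms(1)]
    by (rule Y.stable_scale_cancel[OF xj subspace_UNIV])
  then have "adic (Suc r) = range (scale y)" by (simp add: Y.stable_def del: ideal_power.simps)
  moreover have "adic (Suc r) = scale x ` (I \<odot> UNIV)"
    using assms(1) by (simp add: adic_Suc stable_def smult_scale_image del: ideal_power.simps)
  ultimately have yx: "range (scale y) = scale x ` (I \<odot> UNIV)" by simp
  then have "\<forall>u. \<exists>v. v \<in> I \<odot> UNIV \<and> x *s v = y *s u"
    by (metis imageE rangeI)
  then obtain \<phi> where \<phi>: "\<And>u. \<phi> u \<in> I \<odot> UNIV" "\<And>u. x *s \<phi> u = y *s u" by metis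
  have "module_hom scale scale \<phi>"
  proof
    show "\<phi> (u + v) = \<phi> u + \<phi> v" for u v
      by (rule x_cancel) (simp add: \<phi>(2) scale_right_distrib)
    show "\<phi> (c *s u) = c *s \<phi> u" for c u
    proof (rule x_cancel)
      have "x *s (c *s \<phi> u) = c *s (x *s \<phi> u)" by (rule scale_left_commute)
      also have "\<dots> = y *s (c *s u)" unfolding \<phi>(2) by (rule scale_left_commute)
      finally show "x *s \<phi> (c *s u) = x *s (c *s \<phi> u)" by (simp only: \<phi>(2))
    qed
  qed
  moreover have "bij_betw \<phi> UNIV (I \<odot> UNIV)"
  proof (rule bij_betw_imageI)
    show "inj \<phi>"
    proof (rule injI)
      fix u v assume "\<phi> u = \<phi> v"
      then have "y *s u = y *s v" using \<phi>(2) by metis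
      then show "u = v" by (rule injD[OF scale_inj[OF y_nzd]])
    qed
    show "range \<phi> = I \<odot> UNIV"
    proof (intro order.antisym subsetI)
      fix v assume "v \<in> I \<odot> UNIV"
      then obtain u where "y *s u = x *s v" using yx by (metis imageE imageI)
      then have "\<phi> u = v" using \<phi>(2) x_cancel by metis
      then show "v \<in> range \<phi>" by blast
    qed (use \<phi> in auto)
  qed
  ultimately show ?thesis unfolding iso_to_submodule_def by blast
qed

section \<open>The action of the blow-up ring\<close>

text \<open>Because I^n = I^(n-m) I^m. The union defining the blow-up ring is thus increasing, and
  its index may be taken to be a multiple of \<open>r\<close>.\<close>

lemma self_colon_power_mono:
  assumes "m \<le> n"
  shows "self_colon (ideal_power I m) \<subseteq> self_colon (ideal_power I n)"
proof
  fix q assume q: "q \<in> self_colon (ideal_power I m)"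
  let ?P = "{z. q * to_tfrac z \<in> to_tfrac ` ideal_power I n}"
  have idn: "module.subspace (*) (ideal_power I n)"
    using ring_ideal_power[of I n] by (simp add: ring_ideal_def)
  have sub: "module.subspace (*) ?P"
    unfolding module.subspace_def[OF module_mult]
  proof (intro conjI ballI allI)
    have "to_tfrac 0 \<in> to_tfrac ` ideal_power I n"
      using module.subspace_0[OF module_mult idn] by blast
    then show "0 \<in> ?P" by (simp add: to_tfrac_hom)
    fix z assume "z \<in> ?P"
    then obtain u where u: "q * to_tfrac z = to_tfrac u" "u \<in> ideal_power I n" by auto
    {
      fix z' assume "z' \<in> ?P"
      then obtain u' where u': "q * to_tfrac z' = to_tfrac u'" "u' \<in> ideal_power I n" by auto
      have "q * to_tfrac (z + z') = to_tfrac (u + u')"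
        using u u' by (simp add: to_tfrac_hom distrib_left)
      then show "z + z' \<in> ?P" using module.subspace_add[OF module_mult idn u(2) u'(2)] by blast
    }
    fix c
    have "q * to_tfrac (c * z) = to_tfrac (c * u)"
      using u by (metis mult.left_commute to_tfrac_hom(4))
    then show "c * z \<in> ?P" using module.subspace_scale[OF module_mult idn u(2), of c] by blast
  qed
  have "ideal_power I (n - m + m) \<subseteq> ?P"
    unfolding ideal_power_add
  proof (rule comm_module.smult_least[OF comm_module_mult _ sub])
    fix a z assume a: "a \<in> ideal_power I (n - m)" and z: "z \<in> ideal_power I m"
    obtain u where u: "q * to_tfrac z = to_tfrac u" "u \<in> ideal_power I m"
      using q z by (auto simp: self_colon_def)
    have "q * to_tfrac (a * z) = to_tfrac (a * u)"
      using u by (metis mult.left_commute to_tfrac_hom(4))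
    then show "a * z \<in> ?P"
      using mult_in_ideal_power_add[OF a u(2)] assms by auto
  qed
  then show "q \<in> self_colon (ideal_power I n)" using assms by (auto simp: self_colon_def)
qed

text \<open>The graph of multiplication by \<open>q\<close> on Q(R) \<otimes> M, restricted to M. It
  is a relation because the product need not lie in M; where it does, torsion-freeness makes it
  unique.\<close>

definition fraction_action :: "'a tfrac \<Rightarrow> 'm \<Rightarrow> 'm \<Rightarrow> bool" where
  "fraction_action q u v \<longleftrightarrow>
     (\<exists>a s. nonzerodivisor s \<and> q * to_tfrac s = to_tfrac a \<and> s *s v = a *s u)"

lemma fraction_action_unique:
  assumes "fraction_action q u v" "fraction_action q u v'"
  shows "v = v'"
proof -
  obtain a s where a: "nonzerodivisor s" "q * to_tfrac s = to_tfrac a" "s *s v = a *s u"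
    using assms(1) by (auto simp: fraction_action_def)
  obtain a' s' where a': "nonzerodivisor s'" "q * to_tfrac s' = to_tfrac a'" "s' *s v' = a' *s u"
    using assms(2) by (auto simp: fraction_action_def)
  have "to_tfrac (a * s') = to_tfrac (a' * s)"
    unfolding to_tfrac_hom a(2)[symmetric] a'(2)[symmetric] by (simp add: ac_simps)
  then have eq: "a * s' = a' * s" by simp
  have "s' *s (s *s v) = (a * s') *s u" unfolding a(3) by (simp add: mult.commute)
  also have "\<dots> = s *s (a' *s u)" unfolding eq by (simp add: mult.commute)
  also have "\<dots> = s' *s (s *s v')" unfolding a'(3)[symmetric] by (rule scale_left_commute)
  finally show ?thesis
    by (rule injD[OF scale_inj[OF a(1)], OF injD[OF scale_inj[OF a'(1)]]])
qed

lemma fraction_action_add: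
  assumes "fraction_action q u v" "fraction_action q' u v'"
  shows "fraction_action (q + q') u (v + v')"
proof -
  obtain a s where a: "nonzerodivisor s" "q * to_tfrac s = to_tfrac a" "s *s v = a *s u"
    using assms(1) by (auto simp: fraction_action_def)
  obtain a' s' where a': "nonzerodivisor s'" "q' * to_tfrac s' = to_tfrac a'" "s' *s v' = a' *s u"
    using assms(2) by (auto simp: fraction_action_def)
  have "(q + q') * to_tfrac (s * s') = (q * to_tfrac s) * to_tfrac s' + (q' * to_tfrac s') * to_tfrac s"
    by (simp add: to_tfrac_hom algebra_simps)
  then have "(q + q') * to_tfrac (s * s') = to_tfrac (a * s' + a' * s)"
    unfolding a(2) a'(2) by (simp add: to_tfrac_hom)
  moreover have "(s * s') *s (v + v') = s' *s (s *s v) + s *s (s' *s v')"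
    by (simp add: scale_right_distrib mult.commute)
  then have "(s * s') *s (v + v') = (a * s' + a' * s) *s u"
    unfolding a(3) a'(3) by (simp add: scale_left_distrib mult.commute)
  ultimately show ?thesis
    unfolding fraction_action_def using nonzerodivisor_mult[OF a(1) a'(1)] by blast
qed

lemma fraction_action_mult:
  assumes "fraction_action q v w" "fraction_action q' u v"
  shows "fraction_action (q * q') u w"
proof -
  obtain a s where a: "nonzerodivisor s" "q * to_tfrac s = to_tfrac a" "s *s w = a *s v"
    using assms(1) by (auto simp: fraction_action_def)
  obtain a' s' where a': "nonzerodivisor s'" "q' * to_tfrac s' = to_tfrac a'" "s' *s v = a' *s u"
    using assms(2) by (auto simp: fraction_action_def)
  have "(q * q') * to_tfrac (s * s') = (q * to_tfrac s) * (q' * to_tfrac s')"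
    by (simp add: to_tfrac_hom ac_simps)
  then have "(q * q') * to_tfrac (s * s') = to_tfrac (a * a')"
    unfolding a(2) a'(2) by (simp add: to_tfrac_hom)
  moreover have "(s * s') *s w = s' *s (s *s w)" by (simp add: mult.commute)
  then have "(s * s') *s w = a *s (s' *s v)" unfolding a(3) by (simp only: scale_left_commute)
  then have "(s * s') *s w = (a * a') *s u" unfolding a'(3) by simp
  ultimately show ?thesis
    unfolding fraction_action_def using nonzerodivisor_mult[OF a(1) a'(1)] by blast
qed

lemma fraction_action_add_right:
  assumes "fraction_action q u v" "fraction_action q u' v'"
  shows "fraction_action q (u + u') (v + v')"
proof -
  obtain a s where a: "nonzerodivisor s" "q * to_tfrac s = to_tfrac a" "s *s v = a *s u"
    using assms(1) by (auto simp: fraction_action_def)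
  obtain a' s' where a': "nonzerodivisor s'" "q * to_tfrac s' = to_tfrac a'" "s' *s v' = a' *s u'"
    using assms(2) by (auto simp: fraction_action_def)
  have "to_tfrac (a * s') = to_tfrac (a' * s)"
    unfolding to_tfrac_hom a(2)[symmetric] a'(2)[symmetric] by (simp add: ac_simps)
  then have eq: "a * s' = a' * s" by simp
  have "(s * s') *s (v + v') = s' *s (s *s v) + s *s (s' *s v')"
    by (simp add: scale_right_distrib mult.commute)
  also have "\<dots> = (a * s') *s u + (a' * s) *s u'" unfolding a(3) a'(3) by (simp add: mult.commute)
  also have "\<dots> = (a * s') *s (u + u')" unfolding eq by (simp add: scale_right_distrib)
  finally have "(s * s') *s (v + v') = (a * s') *s (u + u')" .
  moreover have "q * to_tfrac (s * s') = to_tfrac (a * s')"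
    using a(2) by (simp add: to_tfrac_hom flip: mult.assoc)
  ultimately show ?thesis
    unfolding fraction_action_def using nonzerodivisor_mult[OF a(1) a'(1)] by blast
qed

lemma fraction_action_to_tfrac: "fraction_action (to_tfrac a) u (a *s u)"
  unfolding fraction_action_def by (intro exI[of _ a] exI[of _ 1]) (simp add: to_tfrac_hom)

text \<open>Such a \<open>q\<close> is z / x^n with \<open>z\<close> in I^(rn), and z M \<subseteq>
  I^(rn) M = x^n M.\<close>

lemma stable_imp_fraction_action:
  assumes "stable UNIV" "q \<in> blowup_ring I"
  shows "\<exists>v. fraction_action q u v"
proof -
  obtain n where n: "q \<in> self_colon (ideal_power I n)" using assms(2) by (auto simp: blowup_ring_def)
  have "n \<le> r * n" using r_pos by simp
  then have "q \<in> self_colon (ideal_power I (r * n))" using n self_colon_power_mono by blast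
  moreover have "x ^ n \<in> ideal_power I (r * n)" by (rule power_in_ideal_power[OF x_mem])
  ultimately obtain z where z: "q * to_tfrac (x ^ n) = to_tfrac z" "z \<in> ideal_power I (r * n)"
    by (auto simp: self_colon_def)
  have "z *s u \<in> adic (r * n)" using z(2) by (auto intro: smult_mem)
  then obtain v where "z *s u = x ^ n *s v" using stable_power[OF assms(1)] by auto
  then show ?thesis
    using z(1) nonzerodivisor_power[OF x_nonzerodivisor, of n] unfolding fraction_action_def by metis
qed

lemma to_tfrac_in_blowup_ring: "to_tfrac a \<in> blowup_ring J"
proof -
  have "to_tfrac a \<in> self_colon (ideal_power J 0)"
    unfolding self_colon_def by (simp flip: to_tfrac_hom(4))
  then show ?thesis unfolding blowup_ring_def by blast
qed

lemma in_CM_iff: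
  assumes "max_cohen_macaulay scale"
  shows "in_CM scale (blowup_ring I) \<longleftrightarrow> stable UNIV"
proof
  assume "in_CM scale (blowup_ring I)"
  then obtain act where act: "subring_module (blowup_ring I) act" "\<And>a u. act (to_tfrac a) u = a *s u"
    unfolding in_CM_def by blast
  show "stable UNIV"
  proof (rule stableI)
    fix z u assume z: "z \<in> ideal_power I r"
    obtain w where w: "to_tfrac x * w = 1" using to_tfrac_unit[OF x_nonzerodivisor] by blast
    \<comment> \<open>The fraction z / x maps I^n0 into itself, since z I^n0 \<subseteq> I^(n0+r) =
      x I^n0. Acting with it gives z u = x (q u).\<close>
    define q where "q = to_tfrac z * w"
    have xq: "to_tfrac x * q = to_tfrac z" unfolding q_def using w by (metis mult.left_commute mult.right_neutral)
    have "q \<in> self_colon (ideal_power I n0)"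
      unfolding self_colon_def
    proof (intro CollectI ballI)
      fix b assume b: "b \<in> ideal_power I n0"
      have "b * z \<in> ideal_power I (n0 + r)" by (rule mult_in_ideal_power_add[OF b z])
      then obtain b' where b': "b * z = x * b'" "b' \<in> ideal_power I n0"
        using reduction[of n0] by auto
      have "q * to_tfrac b = w * to_tfrac (b * z)" by (simp add: q_def to_tfrac_hom ac_simps)
      also have "\<dots> = (to_tfrac x * w) * to_tfrac b'" unfolding b'(1) by (simp add: to_tfrac_hom ac_simps)
      finally show "q * to_tfrac b \<in> to_tfrac ` ideal_power I n0" using w b'(2) by simp
    qed
    then have q: "q \<in> blowup_ring I" unfolding blowup_ring_def by blast
    have "z *s u = act (to_tfrac x * q) u" by (simp add: xq act(2))
    also have "\<dots> = act (to_tfrac x) (act q u)"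
      using act(1) q to_tfrac_in_blowup_ring[of x I] unfolding subring_module_def by blast
    also have "\<dots> = x *s act q u" by (rule act(2))
    finally show "z *s u \<in> range (scale x)" by simp
  qed simp
next
  assume st: "stable UNIV"
  define act where "act q u = (THE v. fraction_action q u v)" for q u
  have act: "act q u = v" if "fraction_action q u v" for q u v
    unfolding act_def using that fraction_action_unique by blast
  have fa: "fraction_action q u (act q u)" if "q \<in> blowup_ring I" for q u
    using stable_imp_fraction_action[OF st that] act by metis
  have scale: "act (to_tfrac a) u = a *s u" for a u
    by (rule act[OF fraction_action_to_tfrac])
  \<comment> \<open>Each law holds for the relation \<open>fraction_action\<close>, and uniqueness
    turns it into an equation for \<open>act\<close>.\<close>
  have "subring_module (blowup_ring I) act"
    unfolding subring_module_def
  proof (intro conjI ballI allI)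
    show "act 1 u = u" for u using scale[of 1 u] by (simp add: to_tfrac_hom)
  qed (auto intro!: act fraction_action_add fraction_action_add_right intro: fraction_action_mult fa)
  moreover have "subring_fin_gen (blowup_ring I) act"
  proof -
    \<comment> \<open>Generators over R also generate over the larger ring, with coefficients taken
      from R.\<close>
    obtain G where G: "finite G" "span G = UNIV" using fin_gen by (auto simp: fin_gen_def)
    have "\<exists>c. (\<forall>g\<in>G. c g \<in> blowup_ring I) \<and> u = (\<Sum>g\<in>G. act (c g) g)" for u
    proof -
      have "u \<in> range (\<lambda>h. \<Sum>g\<in>G. h g *s g)" using G span_finite[OF G(1)] by auto
      then obtain h where "u = (\<Sum>g\<in>G. h g *s g)" by blast
      then show ?thesis
        by (intro exI[of _ "\<lambda>g. to_tfrac (h g)"]) (simp add: scale to_tfrac_in_blowup_ring)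
    qed
    then show ?thesis unfolding subring_fin_gen_def using G(1) by blast
  qed
  ultimately show "in_CM scale (blowup_ring I)"
    unfolding in_CM_def using scale assms by blast
qed

end

theorem theorem4p6:
  fixes scale :: "'a::comm_ring_1 \<Rightarrow> 'm::ab_group_add \<Rightarrow> 'm"
    and I :: "'a set"
  assumes "cohen_macaulay_local_ring TYPE('a)"
    and "krull_dim TYPE('a) = 1"
    and "regular_ideal I"
    and "module scale"
    and "fin_gen scale"
    and "max_cohen_macaulay scale"
  shows
    "(iso_to_submodule scale (set_smult scale I UNIV) \<longleftrightarrow> ulrich scale I) \<and>
     (ulrich scale I \<longleftrightarrow> (\<forall>n\<ge>1. ulrich scale (ideal_power I n))) \<and>
     ((\<forall>n\<ge>1. ulrich scale (ideal_power I n)) \<longleftrightarrow>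
        infinite {n. n \<ge> 1 \<and> ulrich scale (ideal_power I n)}) \<and>
     (infinite {n. n \<ge> 1 \<and> ulrich scale (ideal_power I n)} \<longleftrightarrow>
        (\<exists>n\<ge>1. ulrich scale (ideal_power I n))) \<and>
     ((\<exists>n\<ge>1. ulrich scale (ideal_power I n)) \<longleftrightarrow> in_CM scale (blowup_ring I))"
proof -
  have noeth: "noetherian TYPE('a)" and loc: "local_ring TYPE('a)"
    using assms(1) by (auto simp: cohen_macaulay_local_ring_def)
  interpret M: noetherian_module scale
    by (intro noetherian_module.intro comm_module.intro noetherian_module_axioms.intro noeth assms)
  obtain d0 where d0: "\<And>d. d \<ge> d0 \<Longrightarrow> \<exists>c\<in>ideal_power I d. \<exists>n0. \<forall>n\<ge>n0.
      ideal_power I (n + d) = (*) c ` ideal_power I n"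
    by (rule exists_power_reduction[OF noeth loc assms(2,3)]) blast
  \<comment> \<open>The successor makes \<open>r\<close> positive, and both \<open>r\<close> and
    \<open>Suc r\<close> are large enough to have reductions.\<close>
  define r where "r = Suc d0"
  obtain x n0 where x: "x \<in> ideal_power I r"
    "\<And>n. n \<ge> n0 \<Longrightarrow> ideal_power I (n + r) = (*) x ` ideal_power I n"
    using d0[of r] by (auto simp: r_def simp del: ideal_power.simps)
  obtain y n1 where y: "y \<in> ideal_power I (Suc r)"
    "\<And>n. n \<ge> n1 \<Longrightarrow> ideal_power I (n + Suc r) = (*) y ` ideal_power I n"
    using d0[of "Suc r"] by (auto simp: r_def simp del: ideal_power.simps)
  interpret M: power_reduction scale I r x n0
    using assms(2,3) x M.mcm_torsion_free[OF loc assms(2,6)]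
    by unfold_locales (auto simp: r_def)
  have ulrich: "ulrich scale (ideal_power I n) \<longleftrightarrow> M.stable UNIV" if "n \<ge> 1" for n
    using that by (intro M.ulrich_power_iff assms(6)) auto
  have "ideal_power I 1 = I" using assms(3) ideal_power_1[of I] by (simp add: regular_ideal_def)
  then have ulrich_1: "ulrich scale I \<longleftrightarrow> M.stable UNIV" using ulrich[of 1] by simp
  have iso: "iso_to_submodule scale (set_smult scale I UNIV) \<longleftrightarrow> M.stable UNIV"
    using M.iso_imp_stable M.stable_imp_iso[OF _ y] by blast
  have "{n. n \<ge> 1 \<and> ulrich scale (ideal_power I n)} = (if M.stable UNIV then {1..} else {})"
    using ulrich by auto
  then have inf: "infinite {n. n \<ge> 1 \<and> ulrich scale (ideal_power I n)} \<longleftrightarrow> M.stable UNIV"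
    by (simp add: infinite_Ici)
  show ?thesis
    unfolding iso ulrich_1 inf M.in_CM_iff[OF assms(6)] using ulrich by auto
qed

end
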